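(* Fix an integer $k\ge3$. For integers $N,m\ge1$ let $\Delta_N(r)=k(N-r)-m\binom{r-1}{k-1}$ and $M_N=\max\{1\le r\le N:\Delta_N(r)\ge0\}$. Then: (i) Fix a prime power $q$ and $m\ge1$. Along every sequence $N\to\infty$ for which $\Delta_N(M_N)>0$, $\mathbb P(\alpha_N=M_N)\to1$. (ii) Along every sequence of parameters for which $\Delta_N(M_N)=0$, put $r=M_N$. If $r\to\infty$, where the prime power $q=q_r$ and the integer $m=m_r\ge1$ are allowed to vary along the sequence, then $$\mathbb P(\alpha_N\notin\{r-1,r\})\to0,$$ and $$\mathbb P(\alpha_N=r)=1-e^{-C_q}+o(1),\qquad\mathbb P(\alpha_N=r-1)=e^{-C_q}+o(1).$$ In particular, if $q_r\to\infty$, these two probabilities converge to $1-e^{-1}$ and $e^{-1}$ respectively.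
   Context: Let $q$ be a prime power, $V_N=\mathbb F_q^N$ and let $\Theta_N$ be uniformly random in $\mathrm{Hom}(\Lambda^kV_N,\mathbb F_q^m)$. A subspace $H\le V_N$ is null if $\Theta_N(\Lambda^kH)=0$; $\alpha_N$ is the maximum dimension of a null subspace. $C_q=\prod_{j\ge1}(1-q^{-j})^{-1}$. *)

theory Defs
  imports
    "HOL-Probability.Probability"
    "HOL-Combinatorics.Permutations"
    "Jordan_Normal_Form.Missing_VectorSpace"
begin

text \<open>
  A finite field \<open>F\<close> of order \<open>q\<close> is a structure in the sense of HOL-Algebra, so that
  \<open>q = card (carrier F)\<close> may vary along a sequence. Vector spaces over \<open>F\<close> are those of the
  locale \<^locale>\<open>vectorspace\<close>, and \<open>ring.func_space F I\<close> is the coordinate space of all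
  families \<open>I \<rightarrow>\<^sub>E carrier F\<close>.
\<close>

definition coord_space :: "('a, 'b) ring_scheme \<Rightarrow> nat \<Rightarrow> ('a, nat \<Rightarrow> 'a) module" where
  "coord_space F N = ring.func_space F {..<N}"

definition ring_det :: "('a, 'b) ring_scheme \<Rightarrow> nat \<Rightarrow> (nat \<Rightarrow> nat \<Rightarrow> 'a) \<Rightarrow> 'a" where
  "ring_det F k A = (\<Oplus>\<^bsub>F\<^esub>p\<in>{p. p permutes {..<k}}.
     (let x = (\<Otimes>\<^bsub>F\<^esub>i\<in>{..<k}. A i (p i)) in if evenperm p then x else \<ominus>\<^bsub>F\<^esub> x))"

text \<open>
  \<open>\<Lambda>\<^sup>k (F\<^sup>N)\<close> in the coordinates given by its standard basis
  \<open>e\<^sub>S = e\<^bsub>s(0)\<^esub> \<and> \<dots> \<and> e\<^bsub>s(k-1)\<^esub>\<close>, where \<open>S = {s(0) < \<dots> < s(k-1)}\<close> ranges over the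
  \<open>k\<close>-element subsets of the index set. In these coordinates \<open>v 0 \<and> \<dots> \<and> v (k - 1)\<close> is the family
  of \<open>k \<times> k\<close> minors of the matrix with rows \<open>v 0, \<dots>, v (k - 1)\<close>; this is valid in every
  characteristic.
\<close>

definition exterior_power :: "('a, 'b) ring_scheme \<Rightarrow> nat \<Rightarrow> nat \<Rightarrow> ('a, nat set \<Rightarrow> 'a) module" where
  "exterior_power F k N = ring.func_space F {S. S \<subseteq> {..<N} \<and> card S = k}"

definition wedge :: "('a, 'b) ring_scheme \<Rightarrow> nat \<Rightarrow> nat \<Rightarrow> (nat \<Rightarrow> nat \<Rightarrow> 'a) \<Rightarrow> (nat set \<Rightarrow> 'a)" where
  "wedge F k N v = (\<lambda>S\<in>{S. S \<subseteq> {..<N} \<and> card S = k}.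
     ring_det F k (\<lambda>i j. v i (sorted_list_of_set S ! j)))"

text \<open>The subspace \<open>\<Lambda>\<^sup>k H\<close> of \<open>\<Lambda>\<^sup>k (F\<^sup>N)\<close>, for a subspace \<open>H\<close> of \<open>F\<^sup>N\<close>.\<close>

definition exterior_power_of ::
    "('a, 'b) ring_scheme \<Rightarrow> nat \<Rightarrow> nat \<Rightarrow> (nat \<Rightarrow> 'a) set \<Rightarrow> (nat set \<Rightarrow> 'a) set" where
  "exterior_power_of F k N H =
     module.span F (exterior_power F k N) (wedge F k N ` ({..<k} \<rightarrow> H))"

text \<open>
  Linear maps are made extensional, so that distinct elements of \<open>exterior_hom\<close> are distinct as
  maps on the carrier and the set is finite.
\<close>

definition exterior_hom ::
    "('a, 'b) ring_scheme \<Rightarrow> nat \<Rightarrow> nat \<Rightarrow> nat \<Rightarrow> ((nat set \<Rightarrow> 'a) \<Rightarrow> (nat \<Rightarrow> 'a)) set" where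
  "exterior_hom F k N m = {\<Theta>. linear_map F (exterior_power F k N) (coord_space F m) \<Theta> \<and>
     \<Theta> \<in> extensional (carrier (exterior_power F k N))}"

definition random_hom ::
    "('a, 'b) ring_scheme \<Rightarrow> nat \<Rightarrow> nat \<Rightarrow> nat \<Rightarrow> ((nat set \<Rightarrow> 'a) \<Rightarrow> (nat \<Rightarrow> 'a)) pmf" where
  "random_hom F k N m = pmf_of_set (exterior_hom F k N m)"

definition null_subspace ::
    "('a, 'b) ring_scheme \<Rightarrow> nat \<Rightarrow> nat \<Rightarrow> nat \<Rightarrow> ((nat set \<Rightarrow> 'a) \<Rightarrow> (nat \<Rightarrow> 'a)) \<Rightarrow>
     (nat \<Rightarrow> 'a) set \<Rightarrow> bool" where
  "null_subspace F k N m \<Theta> H \<longleftrightarrow> subspace F H (coord_space F N) \<and>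
     \<Theta> ` exterior_power_of F k N H = {\<zero>\<^bsub>coord_space F m\<^esub>}"

definition null_dim ::
    "('a, 'b) ring_scheme \<Rightarrow> nat \<Rightarrow> nat \<Rightarrow> nat \<Rightarrow> ((nat set \<Rightarrow> 'a) \<Rightarrow> (nat \<Rightarrow> 'a)) \<Rightarrow> nat" where
  "null_dim F k N m \<Theta> = Max {vectorspace.dim F (coord_space F N\<lparr>carrier := H\<rparr>) | H.
     null_subspace F k N m \<Theta> H}"

definition Delta :: "nat \<Rightarrow> nat \<Rightarrow> nat \<Rightarrow> nat \<Rightarrow> int" where
  "Delta k m N r = int k * (int N - int r) - int m * int ((r - 1) choose (k - 1))"

definition critical_dim :: "nat \<Rightarrow> nat \<Rightarrow> nat \<Rightarrow> nat" where
  "critical_dim k m N = Max {r. 1 \<le> r \<and> r \<le> N \<and> Delta k m N r \<ge> 0}"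

definition C_const :: "nat \<Rightarrow> real" where
  "C_const q = (\<Prod>j. inverse (1 - 1 / real q ^ Suc j))"

text \<open>\<^const>\<open>pmf_of_set\<close> is only meaningful on a finite nonempty set.\<close>

lemma exterior_hom_finite_nonempty:
  assumes "field F" "finite (carrier F)"
  shows "finite (exterior_hom F k N m)" "exterior_hom F k N m \<noteq> {}"
proof -
  interpret field F by fact
  let ?I = "{S. S \<subseteq> {..<N} \<and> card S = k}"
  let ?L = "exterior_power F k N" and ?W = "coord_space F m"
  have carr: "carrier ?L = ?I \<rightarrow>\<^sub>E carrier F" "carrier ?W = {..<m} \<rightarrow>\<^sub>E carrier F"
    by (simp_all add: exterior_power_def coord_space_def func_space_def)
  have "finite ?I" by (rule finite_subset[of _ "Pow {..<N}"]) auto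
  then have fin: "finite (carrier ?L)" "finite (carrier ?W)"
    unfolding carr using assms(2) by (auto intro!: finite_PiE)
  have "exterior_hom F k N m \<subseteq> carrier ?L \<rightarrow>\<^sub>E carrier ?W"
    by (auto simp: exterior_hom_def linear_map_def mod_hom_def mod_hom_axioms_def
        module_hom_def PiE_def)
  with fin show "finite (exterior_hom F k N m)"
    by (meson finite_PiE finite_subset)
  have vs: "vectorspace F ?L" "vectorspace F ?W"
    unfolding exterior_power_def coord_space_def 
    by (intro vectorspace.intro func_space_is_module field_axioms)+
  interpret L: vectorspace F ?L by fact
  interpret W: vectorspace F ?W by fact
  have "(\<lambda>x\<in>carrier ?L. \<zero>\<^bsub>?W\<^esub>) \<in> exterior_hom F k N m"
    unfolding exterior_hom_def linear_map_def mod_hom_def mod_hom_axioms_def module_hom_def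
    using vs L.module_axioms W.module_axioms by auto
  then show "exterior_hom F k N m \<noteq> {}" by blast
qed

end

theory Submission
  imports Defs
begin

text \<open>
  If \<open>r\<close>-dimensional subspaces are in direct sum, so are their exterior powers, and therefore the events
  that they are null are independent. The number of null subspaces of dimension \<open>r\<close> has mean
  \<open>lam\<close>, a Gaussian binomial coefficient times \<open>q\<close> to the power \<open>- m * (r choose k)\<close>, which is
  \<open>q\<close> to the power \<open>r * Delta r / k\<close> up to a factor between 1 and 4. The decisive estimate is that
  families of subspaces not in direct sum contribute negligibly to the factorial moments. It rests on
  two facts: the loss of independence caused by a further subspace is governed by its intersections with the
  individual members of a direct family, which is proved by contracting elements of exterior powers; and by
  the convexity of \<open>r choose k\<close>, intersections of intermediate dimension are rare once
  \<open>Delta r \<ge> 0\<close>. So the first and second moments decide the cases \<open>Delta r \<noteq> 0\<close>. If \<open>Delta r = 0\<close>,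
  then \<open>lam\<close> is close to \<open>C_const q\<close> and the Bonferroni inequalities, restricted to direct families,
  yield Poisson statistics.
\<close>

section \<open>Subspaces of a finite vector space\<close>

text \<open>In part (ii) \<open>q\<close> and \<open>m\<close> vary, so every estimate is explicit
  and the final error bounds depend only on \<open>k\<close>, \<open>r\<close> and the order of
  truncation; powers of \<open>q\<close> are bounded by powers of 2. The hypothesis
  \<open>3 \<le> k\<close> makes \<open>(r - 1) choose (k - 1)\<close> grow faster than linearly in
  \<open>r\<close>. Hence, where Delta is nonnegative, \<open>N - r\<close> exceeds any fixed
  multiple of \<open>r\<close>, and a bounded number of \<open>r\<close>-dimensional subspaces
  leaves room for almost all others to be independent of them. Full factorial moments would involve
  arbitrary dependent families. Counting only direct families leaves one kind of error: a direct
  null family together with one null subspace that breaks directness. The constant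
  \<open>C_const q\<close> appears because a Gaussian binomial coefficient, divided by
  \<open>q ^ (r * (N - r))\<close>, approaches the product of the \<open>1 / (1 - q ^ (-j))\<close>
  when \<open>r\<close> and \<open>N - r\<close> grow. Subspaces of null subspaces are null, so the
  law of \<alpha> is read off from the probabilities that no null subspace of dimension
  \<open>s\<close> exists. Delta strictly decreases in \<open>s\<close>; if it vanishes at
  \<open>r\<close>, it is positive at \<open>r - 1\<close> and negative at
  \<open>r + 1\<close>.\<close>

locale finite_vectorspace = vectorspace K V for K and V +
  assumes finite_field: "finite (carrier K)" and finite_carrier: "finite (carrier V)"
begin

abbreviation q :: nat where "q \<equiv> card (carrier K)"

definition sdim :: "'c set \<Rightarrow> nat" where "sdim H = vectorspace.dim K (vs H)"

lemma q_ge_2: "2 \<le> q"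
proof -
  have "{\<zero>\<^bsub>K\<^esub>, \<one>\<^bsub>K\<^esub>} \<subseteq> carrier K" by auto
  from card_mono[OF finite_field this] show ?thesis using zero_not_one by auto
qed

lemma subspaceI:
  assumes "H \<subseteq> carrier V" "\<zero>\<^bsub>V\<^esub> \<in> H" "\<And>u v. u \<in> H \<Longrightarrow> v \<in> H \<Longrightarrow> u \<oplus>\<^bsub>V\<^esub> v \<in> H"
    "\<And>c v. c \<in> carrier K \<Longrightarrow> v \<in> H \<Longrightarrow> c \<odot>\<^bsub>V\<^esub> v \<in> H"
  shows "subspace K H V"
  by (intro subspace.intro submodule.intro vectorspace_axioms assms module_axioms)

lemma subspaceD:
  assumes "subspace K H V"
  shows "H \<subseteq> carrier V" "\<zero>\<^bsub>V\<^esub> \<in> H" "\<And>u v. u \<in> H \<Longrightarrow> v \<in> H \<Longrightarrow> u \<oplus>\<^bsub>V\<^esub> v \<in> H"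
    "\<And>c v. c \<in> carrier K \<Longrightarrow> v \<in> H \<Longrightarrow> c \<odot>\<^bsub>V\<^esub> v \<in> H" "\<And>v. v \<in> H \<Longrightarrow> \<ominus>\<^bsub>V\<^esub> v \<in> H"
    "\<And>u v. u \<in> H \<Longrightarrow> v \<in> H \<Longrightarrow> u \<ominus>\<^bsub>V\<^esub> v \<in> H" "finite H"
proof -
  interpret submodule K H V using assms by (rule subspace.submod)
  show 1: "H \<subseteq> carrier V" by (rule subset)
  show "\<zero>\<^bsub>V\<^esub> \<in> H" by (rule zero_closed)
  show 2: "\<And>u v. u \<in> H \<Longrightarrow> v \<in> H \<Longrightarrow> u \<oplus>\<^bsub>V\<^esub> v \<in> H" by (rule m_closed)
  show 3: "\<And>c v. c \<in> carrier K \<Longrightarrow> v \<in> H \<Longrightarrow> c \<odot>\<^bsub>V\<^esub> v \<in> H" by (rule smult_closed)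
  show 4: "\<ominus>\<^bsub>V\<^esub> v \<in> H" if "v \<in> H" for v
  proof -
    have "\<ominus>\<^bsub>K\<^esub> \<one>\<^bsub>K\<^esub> \<odot>\<^bsub>V\<^esub> v \<in> H" by (rule 3) (use that in auto)
    moreover have "v \<in> carrier V" using that 1 by auto
    ultimately show ?thesis using smult_minus_1[of v] by metis
  qed
  show "\<And>u v. u \<in> H \<Longrightarrow> v \<in> H \<Longrightarrow> u \<ominus>\<^bsub>V\<^esub> v \<in> H"
    using 2 4 unfolding a_minus_def by blast
  show "finite H" using 1 finite_carrier by (rule finite_subset)
qed

lemma subspace_carrier: "subspace K (carrier V) V"
  by (rule subspaceI) auto

lemma subspace_zero: "subspace K {\<zero>\<^bsub>V\<^esub>} V"
  by (rule subspaceI) auto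

lemma subspace_Int:
  assumes "subspace K A V" "subspace K B V" shows "subspace K (A \<inter> B) V"
  by (rule subspaceI) (use subspaceD[OF assms(1)] subspaceD[OF assms(2)] in auto)

lemma span_minimal: "S \<subseteq> N \<Longrightarrow> subspace K N V \<Longrightarrow> span S \<subseteq> N"
  using span_is_subset is_module by blast

lemma span_subspace: "subspace K H V \<Longrightarrow> span H = H"
  using span_minimal[of H H] in_own_span[of H] subspaceD(1) by blast

text \<open>Coordinates in a basis give a bijection with the functions from the basis to the field.
  From here on dimensions are compared through cardinalities, which are powers of
  \<open>q\<close>.\<close>

lemma card_subspace:
  assumes "subspace K H V"
  shows "card H = q ^ sdim H"
proof -
  interpret H: vectorspace K "vs H" using assms by (rule subspace_is_vs)
  have fin: "finite (carrier (vs H))" using subspaceD(7)[OF assms] by simp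
  have "H.fin_dim" unfolding H.fin_dim_def
    using fin H.in_own_span[of "carrier (vs H)"] H.span_is_subset2[of "carrier (vs H)"] by blast
  then obtain B where B: "finite B" "H.basis B" using H.finite_basis_exists by auto
  then have sub: "B \<subseteq> carrier (vs H)" unfolding H.basis_def by auto
  have ex: "\<exists>!a. a \<in> B \<rightarrow>\<^sub>E carrier K \<and> H.module.lincomb a B = v" if "v \<in> carrier (vs H)" for v
    using H.basis_criterion[OF B(1) sub] B(2) that by blast
  have "bij_betw (\<lambda>a. H.module.lincomb a B) (B \<rightarrow>\<^sub>E carrier K) (carrier (vs H))"
  proof (rule bij_betw_imageI)
    have cl: "H.module.lincomb a B \<in> carrier (vs H)" if "a \<in> B \<rightarrow>\<^sub>E carrier K" for a
      using that sub by (intro H.lincomb_closed) auto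
    show "inj_on (\<lambda>a. H.module.lincomb a B) (B \<rightarrow>\<^sub>E carrier K)"
      using ex cl by (intro inj_onI) blast
    show "(\<lambda>a. H.module.lincomb a B) ` (B \<rightarrow>\<^sub>E carrier K) = carrier (vs H)"
      using ex cl by blast
  qed
  from bij_betw_same_card[OF this] have "card (carrier (vs H)) = q ^ card B"
    using B(1) by (simp add: card_PiE)
  then show ?thesis using H.dim_basis[OF B] by (simp add: sdim_def)
qed

lemma power_q_eq_iff: "q ^ a = q ^ b \<longleftrightarrow> a = b"
  using q_ge_2 by (simp add: power_inject_exp)

lemma sdim_eqI: "subspace K H V \<Longrightarrow> card H = q ^ d \<Longrightarrow> sdim H = d"
  using card_subspace power_q_eq_iff by auto

lemma sdim_mono: "subspace K A V \<Longrightarrow> subspace K B V \<Longrightarrow> A \<subseteq> B \<Longrightarrow> sdim A \<le> sdim B"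
  using card_mono[of B A] subspaceD(7)[of B] card_subspace[of A] card_subspace[of B] q_ge_2
  by (simp add: power_increasing_iff)

lemma sdim_eq_imp_eq: "subspace K A V \<Longrightarrow> subspace K B V \<Longrightarrow> A \<subseteq> B \<Longrightarrow> sdim A = sdim B \<Longrightarrow> A = B"
  using card_subset_eq[of B A] subspaceD(7)[of B] card_subspace[of A] card_subspace[of B] by simp

lemma sdim_zero: "sdim {\<zero>\<^bsub>V\<^esub>} = 0"
  by (rule sdim_eqI[OF subspace_zero]) simp

lemma sdim_eq_0D: "subspace K A V \<Longrightarrow> sdim A = 0 \<Longrightarrow> A = {\<zero>\<^bsub>V\<^esub>}"
  using sdim_eq_imp_eq[of "{\<zero>\<^bsub>V\<^esub>}" A] subspace_zero sdim_zero subspaceD(2)[of A] by auto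

text \<open>The dimension formula in multiplicative form. The addition map from
  \<open>A \<times> B\<close> onto the sum has fibres of equal size: the one over
  \<open>u + w\<close> consists of the pairs \<open>(u + x, w - x)\<close> with \<open>x\<close> in
  \<open>A \<inter> B\<close>.\<close>

lemma card_subspace_sum:
  assumes A: "subspace K A V" and B: "subspace K B V"
  shows "card (subspace_sum A B) * card (A \<inter> B) = card A * card B"
proof -
  note a = subspaceD[OF A] and b = subspaceD[OF B]
  let ?f = "\<lambda>(x,y). x \<oplus>\<^bsub>V\<^esub> y"
  have im: "?f ` (A \<times> B) = subspace_sum A B"
    unfolding submodule_sum_def by (rule arg_cong[where f = "\<lambda>S. ?f ` S"]) auto
  have fib: "card {p \<in> A \<times> B. ?f p = s} = card (A \<inter> B)" if "s \<in> subspace_sum A B" for s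
  proof -
    from that im obtain u w where uw: "u \<in> A" "w \<in> B" "s = u \<oplus>\<^bsub>V\<^esub> w" by force
    have c: "u \<in> carrier V" "w \<in> carrier V" using uw a(1) b(1) by auto
    have "bij_betw (\<lambda>x. (u \<oplus>\<^bsub>V\<^esub> x, w \<ominus>\<^bsub>V\<^esub> x)) (A \<inter> B) {p \<in> A \<times> B. ?f p = s}"
    proof (rule bij_betw_imageI)
      show "inj_on (\<lambda>x. (u \<oplus>\<^bsub>V\<^esub> x, w \<ominus>\<^bsub>V\<^esub> x)) (A \<inter> B)"
        using a(1) c by (intro inj_onI) (auto simp: subset_iff)
      show "(\<lambda>x. (u \<oplus>\<^bsub>V\<^esub> x, w \<ominus>\<^bsub>V\<^esub> x)) ` (A \<inter> B) = {p \<in> A \<times> B. ?f p = s}"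
      proof (intro equalityI subsetI)
        fix p assume "p \<in> (\<lambda>x. (u \<oplus>\<^bsub>V\<^esub> x, w \<ominus>\<^bsub>V\<^esub> x)) ` (A \<inter> B)"
        then obtain x where x: "x \<in> A" "x \<in> B" "p = (u \<oplus>\<^bsub>V\<^esub> x, w \<ominus>\<^bsub>V\<^esub> x)" by auto
        have xc: "x \<in> carrier V" using x a(1) by auto
        have "(u \<oplus>\<^bsub>V\<^esub> x) \<oplus>\<^bsub>V\<^esub> (w \<ominus>\<^bsub>V\<^esub> x) = u \<oplus>\<^bsub>V\<^esub> w"
          using c xc by (simp add: a_minus_def M.a_ac M.r_neg M.r_neg1 M.r_neg2)
        then show "p \<in> {p \<in> A \<times> B. ?f p = s}"
          using x uw a(3)[of u x] b(6)[of w x] by auto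
      next
        fix p assume "p \<in> {p \<in> A \<times> B. ?f p = s}"
        then obtain y z where p: "p = (y, z)" "y \<in> A" "z \<in> B" "y \<oplus>\<^bsub>V\<^esub> z = u \<oplus>\<^bsub>V\<^esub> w"
          using uw by auto
        have pc: "y \<in> carrier V" "z \<in> carrier V" using p a(1) b(1) by auto
        define x where "x = y \<ominus>\<^bsub>V\<^esub> u"
        have xc: "x \<in> carrier V" unfolding x_def using pc c by auto
        have y: "y = u \<oplus>\<^bsub>V\<^esub> x" unfolding x_def
          using pc c M.a_lcomm[of u y "\<ominus>\<^bsub>V\<^esub> u"] by (simp add: a_minus_def M.r_neg)
        have "u \<oplus>\<^bsub>V\<^esub> (x \<oplus>\<^bsub>V\<^esub> z) = u \<oplus>\<^bsub>V\<^esub> w"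
          using p(4) y c pc xc by (simp add: M.a_assoc)
        then have w: "w = x \<oplus>\<^bsub>V\<^esub> z" using c xc pc M.r_neg1[of u w] M.r_neg1[of u "x \<oplus>\<^bsub>V\<^esub> z"] by auto
        have z: "z = w \<ominus>\<^bsub>V\<^esub> x" unfolding w
          using pc c xc M.a_comm[of x z] by (simp add: a_minus_def M.a_assoc M.r_neg)
        have "x = w \<ominus>\<^bsub>V\<^esub> z" unfolding w
          using pc c xc by (simp add: a_minus_def M.a_assoc M.r_neg)
        then have "x \<in> A" "x \<in> B"
          using a(6)[OF p(2) uw(1)] b(6)[OF uw(2) p(3)] x_def by auto
        then show "p \<in> (\<lambda>x. (u \<oplus>\<^bsub>V\<^esub> x, w \<ominus>\<^bsub>V\<^esub> x)) ` (A \<inter> B)"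
          using y z p by auto
      qed
    qed
    then show ?thesis using bij_betw_same_card by fastforce
  qed
  have fAB: "finite (A \<times> B)" using a(7) b(7) by auto
  have "card (A \<times> B) = (\<Sum>s\<in>subspace_sum A B. card {p \<in> A \<times> B. ?f p = s})"
    unfolding card_eq_sum
    by (rule sum.group[symmetric]) (use im finite_imageI[OF fAB, of ?f] fAB in auto)
  also have "\<dots> = card (subspace_sum A B) * card (A \<inter> B)" using fib by simp
  finally show ?thesis by (simp add: card_cartesian_product)
qed

lemma span_Un_subspaces:
  assumes "subspace K A V" "subspace K B V"
  shows "span (A \<union> B) = subspace_sum A B"
  using span_union_is_sum[of A B] assms subspaceD(1) span_subspace by metis

lemma card_span_Un:
  assumes "subspace K A V" "subspace K B V"
  shows "card (span (A \<union> B)) * card (A \<inter> B) = card A * card B"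
  using card_subspace_sum span_Un_subspaces assms by simp

lemma span_span_Un:
  assumes "A \<subseteq> carrier V" "B \<subseteq> carrier V"
  shows "span (span A \<union> B) = span (A \<union> B)"
proof
  have "span A \<union> B \<subseteq> span (A \<union> B)"
    using span_is_monotone[of A "A \<union> B"] in_own_span[of "A \<union> B"] assms by auto
  then show "span (span A \<union> B) \<subseteq> span (A \<union> B)"
    using span_is_subspace[of "A \<union> B"] assms by (intro span_minimal) auto
  show "span (A \<union> B) \<subseteq> span (span A \<union> B)"
    using in_own_span[of A] assms by (intro span_is_monotone) auto
qed

lemma span_singleton: "v \<in> carrier V \<Longrightarrow> span {v} = (\<lambda>c. c \<odot>\<^bsub>V\<^esub> v) ` carrier K"
proof -
  assume v: "v \<in> carrier V"
  have "span {v} = {lincomb a {v} | a. a \<in> {v} \<rightarrow> carrier K}" using v by (intro finite_span) auto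
  also have "\<dots> = (\<lambda>c. c \<odot>\<^bsub>V\<^esub> v) ` carrier K"
  proof (intro equalityI subsetI)
    fix x assume "x \<in> {lincomb a {v} | a. a \<in> {v} \<rightarrow> carrier K}"
    then show "x \<in> (\<lambda>c. c \<odot>\<^bsub>V\<^esub> v) ` carrier K" using v by (auto simp: lincomb_def)
  next
    fix x assume "x \<in> (\<lambda>c. c \<odot>\<^bsub>V\<^esub> v) ` carrier K"
    then obtain c where c: "c \<in> carrier K" "x = c \<odot>\<^bsub>V\<^esub> v" by auto
    then have "x = lincomb (\<lambda>_. c) {v}" using v by (simp add: lincomb_def)
    then show "x \<in> {lincomb a {v} | a. a \<in> {v} \<rightarrow> carrier K}" using c by auto
  qed
  finally show ?thesis .
qed

lemma smult_in_subspaceD: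
  assumes "subspace K H V" "v \<in> carrier V" "c \<in> carrier K" "c \<noteq> \<zero>\<^bsub>K\<^esub>" "c \<odot>\<^bsub>V\<^esub> v \<in> H"
  shows "v \<in> H"
  using mult_inverse[OF assms(3,2) refl assms(4)] subspaceD(4)[OF assms(1), of "inv\<^bsub>K\<^esub> c"] assms(3-5)
  by (metis field.field_Units field_axioms Diff_iff empty_iff insert_iff Units_inv_closed)

text \<open>The line through \<open>v\<close> has \<open>q\<close> elements and meets
  \<open>H\<close> only in zero, so the dimension formula applies.\<close>

lemma card_span_insert:
  assumes H: "subspace K H V" and v: "v \<in> carrier V" "v \<notin> H"
  shows "card (span (insert v H)) = q * card H"
proof -
  have s: "subspace K (span {v}) V" using v by (intro span_is_subspace) auto
  have v0: "v \<noteq> \<zero>\<^bsub>V\<^esub>" using v subspaceD(2)[OF H] by auto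
  have inj: "inj_on (\<lambda>c. c \<odot>\<^bsub>V\<^esub> v) (carrier K)"
  proof (rule inj_onI)
    fix c d assume cd: "c \<in> carrier K" "d \<in> carrier K" "c \<odot>\<^bsub>V\<^esub> v = d \<odot>\<^bsub>V\<^esub> v"
    then have "(c \<ominus>\<^bsub>K\<^esub> d) \<odot>\<^bsub>V\<^esub> v = \<zero>\<^bsub>V\<^esub>"
      using v by (simp add: a_minus_def smult_l_distr smult_l_minus M.r_neg)
    then have "c \<ominus>\<^bsub>K\<^esub> d = \<zero>\<^bsub>K\<^esub>"
      using smult_in_subspaceD[OF subspace_zero v(1), of "c \<ominus>\<^bsub>K\<^esub> d"] cd v0 by auto
    then show "c = d" using cd by simp
  qed
  have "card (span {v}) = q" using span_singleton[OF v(1)] inj by (simp add: card_image)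
  moreover have "H \<inter> span {v} = {\<zero>\<^bsub>V\<^esub>}"
  proof
    show "H \<inter> span {v} \<subseteq> {\<zero>\<^bsub>V\<^esub>}"
    proof
      fix x assume x: "x \<in> H \<inter> span {v}"
      then obtain c where c: "c \<in> carrier K" "x = c \<odot>\<^bsub>V\<^esub> v" using span_singleton[OF v(1)] by auto
      then have "c = \<zero>\<^bsub>K\<^esub>" using x smult_in_subspaceD[OF H v(1)] v by auto
      then show "x \<in> {\<zero>\<^bsub>V\<^esub>}" using c v by simp
    qed
    show "{\<zero>\<^bsub>V\<^esub>} \<subseteq> H \<inter> span {v}" using subspaceD(2)[OF H] subspaceD(2)[OF s] by auto
  qed
  moreover have "span (insert v H) = span (H \<union> span {v})"
    using span_span_Un[of "{v}" H] v subspaceD(1)[OF H] by (simp add: Un_commute)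
  ultimately show ?thesis using card_span_Un[OF H s] by (simp add: mult.commute)
qed

end

section \<open>Counting the subspaces between two given subspaces\<close>

context finite_vectorspace
begin

definition between :: "'c set \<Rightarrow> 'c set \<Rightarrow> nat \<Rightarrow> 'c set set" where
  "between A B r = {H. subspace K H V \<and> A \<subseteq> H \<and> H \<subseteq> B \<and> sdim H = r}"

lemma finite_between: "finite (between A B r)"
  by (rule finite_subset[of _ "Pow (carrier V)"])
    (use finite_carrier subspaceD(1) in \<open>auto simp: between_def\<close>)

text \<open>Both sides count the pairs of a subspace \<open>H\<close> and a vector \<open>v \<in> H - A\<close>.\<close>

lemma card_between_step:
  assumes A: "subspace K A V" and B: "subspace K B V" and AB: "A \<subseteq> B" and r: "sdim A < r"
  shows "card (between A B r) * (q ^ r - q ^ sdim A) =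
         (\<Sum>v\<in>B - A. card (between (span (insert v A)) B r))"
proof -
  let ?S = "between A B r"
  have fB: "finite B" using B by (rule subspaceD)
  have "card {v \<in> B - A. v \<in> H} = q ^ r - q ^ sdim A" if "H \<in> ?S" for H
  proof -
    have "{v \<in> B - A. v \<in> H} = H - A" using that by (auto simp: between_def)
    moreover have "card (H - A) = card H - card A"
      using that subspaceD(7)[OF A] by (intro card_Diff_subset) (auto simp: between_def)
    ultimately show ?thesis using that card_subspace A by (auto simp: between_def)
  qed
  then have "card ?S * (q ^ r - q ^ sdim A) = (\<Sum>H\<in>?S. card {v \<in> B - A. v \<in> H})" by simp
  also have "\<dots> = (\<Sum>v\<in>B - A. card {H \<in> ?S. v \<in> H})"
    unfolding card_eq_sum by (rule sum.swap_restrict) (use finite_between fB in auto)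
  also have "\<dots> = (\<Sum>v\<in>B - A. card (between (span (insert v A)) B r))"
  proof (rule sum.cong[OF refl])
    fix v assume v: "v \<in> B - A"
    have c: "insert v A \<subseteq> carrier V" using v subspaceD(1)[OF A] subspaceD(1)[OF B] by auto
    have "{H \<in> ?S. v \<in> H} = between (span (insert v A)) B r"
      using span_minimal[of "insert v A"] in_own_span[OF c] by (auto simp: between_def)
    then show "card {H \<in> ?S. v \<in> H} = card (between (span (insert v A)) B r)" by simp
  qed
  finally show ?thesis .
qed

lemma sdim_span_insert:
  assumes "subspace K A V" "v \<in> carrier V" "v \<notin> A"
  shows "sdim (span (insert v A)) = Suc (sdim A)"
  using card_span_insert[OF assms] card_subspace[OF assms(1)] subspaceD(1)[OF assms(1)] assms(2)
  by (intro sdim_eqI span_is_subspace) auto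

text \<open>Induction on the codimension \<open>n\<close> of \<open>A\<close> in the sought
  subspaces: \<open>card_between_step\<close> trades \<open>A\<close> for its one-dimensional
  extensions, and each of the \<open>q ^ sdim B - q ^ sdim A\<close> vectors outside
  \<open>A\<close> contributes equally. The denominator stays on the left so that the identity lives
  in the natural numbers.\<close>

lemma card_between:
  assumes "subspace K A V" "subspace K B V" "A \<subseteq> B" "sdim A + n = r" "r \<le> sdim B"
  shows "card (between A B r) * (\<Prod>i=sdim A..<r. q ^ r - q ^ i) = (\<Prod>i=sdim A..<r. q ^ sdim B - q ^ i)"
  using assms
proof (induction n arbitrary: A)
  case 0
  then have "H = A" if "H \<in> between A B r" for H
    using that sdim_eq_imp_eq[of A H] by (simp add: between_def)
  then have "between A B r = {A}" using 0 by (auto simp: between_def)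
  then show ?case using 0 by simp
next
  case (Suc n)
  let ?P = "\<lambda>s t. \<Prod>i=s..<r. q ^ t - q ^ i"
  have lt: "sdim A < r" using Suc.prems by simp
  have "card (between A B r) * ?P (sdim A) r
      = card (between A B r) * (q ^ r - q ^ sdim A) * ?P (Suc (sdim A)) r"
    using lt by (simp add: prod.atLeast_Suc_lessThan)
  also have "\<dots> = (\<Sum>v\<in>B - A. card (between (span (insert v A)) B r) * ?P (Suc (sdim A)) r)"
    using card_between_step[OF Suc.prems(1-3) lt] by (simp add: sum_distrib_right)
  also have "\<dots> = (\<Sum>v\<in>B - A. ?P (Suc (sdim A)) (sdim B))"
  proof (rule sum.cong[OF refl])
    fix v assume v: "v \<in> B - A"
    have vc: "v \<in> carrier V" using v subspaceD(1)[OF Suc.prems(2)] by auto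
    have d: "sdim (span (insert v A)) = Suc (sdim A)"
      using sdim_span_insert[OF Suc.prems(1) vc] v by simp
    have "subspace K (span (insert v A)) V"
      using subspaceD(1)[OF Suc.prems(1)] vc by (intro span_is_subspace) auto
    moreover have "span (insert v A) \<subseteq> B" using v Suc.prems by (intro span_minimal) auto
    ultimately show "card (between (span (insert v A)) B r) * ?P (Suc (sdim A)) r = ?P (Suc (sdim A)) (sdim B)"
      using Suc.IH[of "span (insert v A)"] Suc.prems d by simp
  qed
  also have "\<dots> = (q ^ sdim B - q ^ sdim A) * ?P (Suc (sdim A)) (sdim B)"
    using card_Diff_subset[OF subspaceD(7)[OF Suc.prems(1)] Suc.prems(3)]
      card_subspace[OF Suc.prems(1)] card_subspace[OF Suc.prems(2)] by simp
  also have "\<dots> = ?P (sdim A) (sdim B)"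
    using lt by (simp add: prod.atLeast_Suc_lessThan)
  finally show ?case .
qed

text \<open>After cancelling \<open>q ^ i\<close> in each factor this is the Gaussian binomial
  coefficient of \<open>sdim B - sdim A\<close> over \<open>r - sdim A\<close>.\<close>

lemma card_between_real:
  assumes "subspace K A V" "subspace K B V" "A \<subseteq> B" "sdim A \<le> r" "r \<le> sdim B"
  shows "real (card (between A B r)) =
    (\<Prod>i=sdim A..<r. (real q ^ sdim B - real q ^ i) / (real q ^ r - real q ^ i))"
proof -
  have le: "q ^ i \<le> q ^ t" if "i < r" "r \<le> t" for i t
    using that q_ge_2 by (intro power_increasing) auto
  have lt: "real q ^ i < real q ^ r" if "i < r" for i
    using that q_ge_2 by (intro power_strict_increasing) auto
  have "real (card (between A B r)) * (\<Prod>i=sdim A..<r. real q ^ r - real q ^ i)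
      = (\<Prod>i=sdim A..<r. real q ^ sdim B - real q ^ i)"
    using arg_cong[OF card_between[OF assms(1-3) le_add_diff_inverse[OF assms(4)] assms(5)], of real] le assms(5)
    by (simp add: of_nat_diff)
  moreover have "(\<Prod>i=sdim A..<r. real q ^ r - real q ^ i) \<noteq> 0"
    using lt by fastforce
  ultimately show ?thesis by (simp add: prod_dividef field_simps)
qed

end

text \<open>Weierstrass's product inequality; in the induction the discarded cross term is a product
  of nonnegative numbers.\<close>

lemma prod_one_minus_ge:
  fixes f :: "'i \<Rightarrow> real"
  assumes "finite A" "\<And>i. i \<in> A \<Longrightarrow> 0 \<le> f i \<and> f i \<le> 1"
  shows "1 - (\<Sum>i\<in>A. f i) \<le> (\<Prod>i\<in>A. 1 - f i)"
  using assms
proof (induction A rule: finite_induct)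
  case (insert x A)
  have a: "0 \<le> (\<Sum>i\<in>A. f i)" using insert by (intro sum_nonneg) auto
  have fx: "0 \<le> f x" "f x \<le> 1" using insert by auto
  have "(1 - f x) * (1 - (\<Sum>i\<in>A. f i)) \<le> (1 - f x) * (\<Prod>i\<in>A. 1 - f i)"
    using insert fx by (intro mult_left_mono) auto
  moreover have "1 - (f x + (\<Sum>i\<in>A. f i)) \<le> (1 - f x) * (1 - (\<Sum>i\<in>A. f i))"
    using a fx by (simp add: algebra_simps)
  ultimately show ?case using insert by simp
qed simp

text \<open>For \<open>x = 1/2\<close> all the powers together can sum to nearly 1, and the product
  inequality would give nothing uniform. So the factor \<open>1 - x \<ge> 1/2\<close> is split off;
  the other powers sum to at most \<open>1/2\<close>, which leaves a product of at least
  \<open>1/2\<close>.\<close>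

lemma prod_one_minus_power_ge:
  fixes x :: real
  assumes "0 \<le> x" "x \<le> 1/2"
  shows "1/4 \<le> (\<Prod>j<n. 1 - x ^ Suc j)"
proof (cases n)
  case (Suc m)
  have le: "x ^ j \<le> (1/2) ^ j" for j using assms by (intro power_mono) auto
  have x1: "x ^ j \<le> 1" for j using assms by (intro power_le_one) auto
  have "(\<Sum>j<m. x ^ Suc (Suc j)) \<le> (\<Sum>j<m. (1/2) ^ Suc (Suc j))" by (intro sum_mono le)
  also have "\<dots> = (1/4) * (\<Sum>j<m. (1/2::real) ^ j)" by (simp add: sum_distrib_left)
  also have "(\<Sum>j<m. (1/2::real) ^ j) \<le> 2" by (simp add: sum_gp_strict)
  finally have "(\<Sum>j<m. x ^ Suc (Suc j)) \<le> 1/2" by simp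
  then have "1/2 \<le> (\<Prod>j<m. 1 - x ^ Suc (Suc j))"
    using prod_one_minus_ge[of "{..<m}" "\<lambda>j. x ^ Suc (Suc j)"] assms x1[of "Suc (Suc _)"] by simp
  then have "(1/2) * (1/2) \<le> (1 - x) * (\<Prod>j<m. 1 - x ^ Suc (Suc j))"
    using assms by (intro mult_mono) auto
  then show ?thesis using Suc by (simp only: prod.lessThan_Suc_shift) simp
qed simp

text \<open>Every factor is at least \<open>x ^ (b - r)\<close>. For the upper bound
  \<open>x ^ i\<close> is dropped from the numerator; what remains besides the power is the inverse
  of a product of the \<open>1 - x ^ (-j)\<close>, which is at most 4. This is the source of the
  factor 4 in all counting bounds below.\<close>

lemma gaussian_prod_bounds:
  fixes x :: real
  assumes "2 \<le> x" "a \<le> r" "r \<le> b"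
  defines "P \<equiv> (\<Prod>i=a..<r. (x ^ b - x ^ i) / (x ^ r - x ^ i))"
  shows "x ^ ((r - a) * (b - r)) \<le> P" "P \<le> 4 * x ^ ((r - a) * (b - r))"
proof -
  have pos: "0 < x ^ n" for n using assms by simp
  have lt: "x ^ i < x ^ r" if "i < r" for i using that assms by (intro power_strict_increasing) auto
  have split: "x ^ b = x ^ (b - r) * x ^ r" using assms by (simp flip: power_add)
  have ge1: "1 \<le> x ^ (b - r)" using assms by (intro one_le_power) auto
  have "(\<Prod>i=a..<r. x ^ (b - r)) \<le> P"
    unfolding P_def
  proof (rule prod_mono, safe)
    fix i assume "i \<in> {a..<r}"
    then have "x ^ i < x ^ r" using lt by simp
    moreover have "x ^ (b - r) * (x ^ r - x ^ i) \<le> x ^ b - x ^ i"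
      using mult_right_mono[OF ge1, of "x ^ i"] pos[of i] unfolding split by (simp add: right_diff_distrib)
    ultimately show "x ^ (b - r) \<le> (x ^ b - x ^ i) / (x ^ r - x ^ i)" by (simp add: pos_le_divide_eq)
  qed (use pos in \<open>auto simp: less_imp_le\<close>)
  then show "x ^ ((r - a) * (b - r)) \<le> P" by (simp add: power_mult mult.commute[of "r - a"])
  let ?y = "inverse x"
  have y: "0 \<le> ?y" "?y \<le> 1/2" using assms by (auto simp: field_simps)
  have "P \<le> (\<Prod>i=a..<r. x ^ (b - r) / (1 - ?y ^ (r - i)))"
    unfolding P_def
  proof (rule prod_mono, safe)
    fix i assume i: "i \<in> {a..<r}"
    then have l: "x ^ i < x ^ r" using lt by simp
    have "x ^ r * (1 - ?y ^ (r - i)) = x ^ r - x ^ i"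
      using i assms by (simp add: right_diff_distrib power_inverse power_diff field_simps)
    then have e: "1 - ?y ^ (r - i) = (x ^ r - x ^ i) / x ^ r" using assms by (simp add: field_simps)
    have "x ^ (b - r) / (1 - ?y ^ (r - i)) = x ^ b / (x ^ r - x ^ i)"
      unfolding e split using l by simp
    then show "(x ^ b - x ^ i) / (x ^ r - x ^ i) \<le> x ^ (b - r) / (1 - ?y ^ (r - i))"
      using l pos[of i] by (simp add: divide_right_mono)
    have "x ^ i \<le> x ^ b" using i assms by (intro power_increasing) auto
    then show "0 \<le> (x ^ b - x ^ i) / (x ^ r - x ^ i)" using l by simp
  qed
  also have "\<dots> = x ^ ((r - a) * (b - r)) / (\<Prod>i=a..<r. 1 - ?y ^ (r - i))"
    by (simp add: prod_dividef power_mult mult.commute[of "r - a"])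
  also have "(\<Prod>i=a..<r. 1 - ?y ^ (r - i)) = (\<Prod>j<r - a. 1 - ?y ^ Suc j)"
    by (rule prod.reindex_bij_witness[of _ "\<lambda>j. r - Suc j" "\<lambda>i. r - Suc i"])
      (auto simp: Suc_diff_Suc simp del: power_Suc)
  also have "x ^ ((r - a) * (b - r)) / \<dots> \<le> x ^ ((r - a) * (b - r)) / (1/4)"
    using prod_one_minus_power_ge[OF y, of "r - a"] pos by (intro divide_left_mono) (auto simp: less_imp_le)
  finally show "P \<le> 4 * x ^ ((r - a) * (b - r))" by simp
qed

context finite_vectorspace
begin

lemma card_between_bounds:
  assumes "subspace K A V" "subspace K B V" "A \<subseteq> B" "sdim A \<le> r" "r \<le> sdim B"
  shows "real q ^ ((r - sdim A) * (sdim B - r)) \<le> card (between A B r)"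
    "card (between A B r) \<le> 4 * real q ^ ((r - sdim A) * (sdim B - r))"
  using gaussian_prod_bounds[of "real q" "sdim A" r "sdim B"] q_ge_2 assms
  by (simp_all add: card_between_real)

lemma between_nonempty:
  assumes "subspace K A V" "subspace K B V" "A \<subseteq> B" "sdim A \<le> r" "r \<le> sdim B"
  shows "between A B r \<noteq> {}"
proof
  assume "between A B r = {}"
  with card_between_bounds(1)[OF assms] have "real q ^ ((r - sdim A) * (sdim B - r)) \<le> 0" by simp
  then show False using q_ge_2 by (simp add: power_le_zero_eq)
qed

text \<open>The spanning vectors form an indexed tuple rather than a set, so that they can later be
  attached to coordinate positions in \<open>adapted_map_exists\<close>.\<close>

lemma spanning_family_exists:
  assumes A: "subspace K A V" and B: "subspace K B V" and AB: "A \<subseteq> B"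
  shows "\<exists>b. b \<in> {..<sdim B - sdim A} \<rightarrow> B \<and> span (A \<union> b ` {..<sdim B - sdim A}) = B"
  using A AB
proof (induction "sdim B - sdim A" arbitrary: A)
  case 0
  then have "A = B" using sdim_eq_imp_eq[of A B] sdim_mono[of A B] B by simp
  then show ?case using span_subspace[OF B] by auto
next
  case (Suc n)
  have "A \<noteq> B" using Suc by auto
  then obtain v where v: "v \<in> B" "v \<notin> A" using Suc by auto
  have vc: "v \<in> carrier V" using v subspaceD(1)[OF B] by auto
  let ?A = "span (insert v A)"
  have Ac: "A \<subseteq> carrier V" using Suc subspaceD(1) by auto
  have sA: "subspace K ?A V" using vc Ac by (intro span_is_subspace) auto
  have d: "sdim ?A = Suc (sdim A)" using sdim_span_insert Suc.prems vc v by auto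
  have "?A \<subseteq> B" using v Suc.prems B by (intro span_minimal) auto
  then obtain b where b: "b \<in> {..<n} \<rightarrow> B" "span (?A \<union> b ` {..<n}) = B"
    using Suc.hyps(1)[OF _ sA] d Suc.hyps(2) by (metis Suc_diff_Suc diff_Suc_Suc diff_add_inverse2 old.nat.inject zero_less_Suc zero_less_diff)
  define b' where "b' = b(n := v)"
  have im: "b' ` {..<Suc n} = insert v (b ` {..<n})" by (auto simp: b'_def lessThan_Suc)
  have "b ` {..<n} \<subseteq> carrier V" using b(1) subspaceD(1)[OF B] by auto
  then have "span (A \<union> b' ` {..<Suc n}) = B"
    using span_span_Un[of "insert v A" "b ` {..<n}"] vc Ac b(2) unfolding im by simp
  moreover have "b' \<in> {..<Suc n} \<rightarrow> B" using b(1) v by (auto simp: b'_def Pi_iff)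
  ultimately show ?case using Suc.hyps(2) by (metis)
qed

end

section \<open>Linear maps between coordinate spaces\<close>

locale finite_scalar_field = field F for F (structure) +
  assumes finite_scalars: "finite (carrier F)"
begin

lemma func_space_simps [simp]:
  "carrier (func_space I) = I \<rightarrow>\<^sub>E carrier F"
  "\<zero>\<^bsub>func_space I\<^esub> = (\<lambda>i\<in>I. \<zero>)"
  "x \<oplus>\<^bsub>func_space I\<^esub> y = (\<lambda>i\<in>I. x i \<oplus> y i)"
  "c \<odot>\<^bsub>func_space I\<^esub> x = (\<lambda>i\<in>I. c \<otimes> x i)"
  by (simp_all add: func_space_def)

lemma vectorspace_func_space: "vectorspace F (func_space I)"
  by (intro vectorspace.intro func_space_is_module field_axioms)

lemma finite_vectorspace_func_space:
  assumes "finite I" shows "finite_vectorspace F (func_space I)"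
  using assms finite_scalars
  by (intro finite_vectorspace.intro vectorspace_func_space finite_vectorspace_axioms.intro)
    (auto intro: finite_PiE)

definition lin_maps :: "'i set \<Rightarrow> 'j set \<Rightarrow> (('i \<Rightarrow> 'a) \<Rightarrow> ('j \<Rightarrow> 'a)) set" where
  "lin_maps I J = {T. linear_map F (func_space I) (func_space J) T \<and>
     T \<in> extensional (carrier (func_space I))}"

lemma lin_maps_iff:
  "T \<in> lin_maps I J \<longleftrightarrow> T \<in> (I \<rightarrow>\<^sub>E carrier F) \<rightarrow>\<^sub>E (J \<rightarrow>\<^sub>E carrier F) \<and>
     (\<forall>x\<in>I \<rightarrow>\<^sub>E carrier F. \<forall>y\<in>I \<rightarrow>\<^sub>E carrier F. T (\<lambda>i\<in>I. x i \<oplus> y i) = (\<lambda>j\<in>J. T x j \<oplus> T y j)) \<and>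
     (\<forall>c\<in>carrier F. \<forall>x\<in>I \<rightarrow>\<^sub>E carrier F. T (\<lambda>i\<in>I. c \<otimes> x i) = (\<lambda>j\<in>J. c \<otimes> T x j))"
proof -
  have m: "module F (func_space A)" for A :: "'x set" by (rule func_space_is_module)
  show ?thesis unfolding lin_maps_def linear_map_def mod_hom_def mod_hom_axioms_def module_hom_def
    using m[of I] m[of J] vectorspace_func_space[of I] vectorspace_func_space[of J]
    by (auto simp: PiE_iff[of T] PiE_def[of _ "\<lambda>_. J \<rightarrow>\<^sub>E carrier F"])
qed

lemma finite_lin_maps: "finite I \<Longrightarrow> finite J \<Longrightarrow> finite (lin_maps I J)"
  using finite_scalars
  by (intro finite_subset[of "lin_maps I J" "(I \<rightarrow>\<^sub>E carrier F) \<rightarrow>\<^sub>E (J \<rightarrow>\<^sub>E carrier F)"] subsetI finite_PiE)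
    (simp_all add: lin_maps_iff)

text \<open>With \<open>Y\<close> the union of the exterior powers of some subspaces, this is the
  event that all of them are null.\<close>

definition annihilator :: "'i set \<Rightarrow> 'j set \<Rightarrow> ('i \<Rightarrow> 'a) set \<Rightarrow> (('i \<Rightarrow> 'a) \<Rightarrow> ('j \<Rightarrow> 'a)) set" where
  "annihilator I J Y = {T \<in> lin_maps I J. \<forall>y\<in>Y. T y = (\<lambda>j\<in>J. \<zero>)}"

lemma annihilator_span:
  assumes "Y \<subseteq> I \<rightarrow>\<^sub>E carrier F" "finite I"
  shows "annihilator I J (module.span F (func_space I) Y) = annihilator I J Y"
proof -
  interpret L: finite_vectorspace F "func_space I"
    using assms by (intro finite_vectorspace_func_space)
  have Yc: "Y \<subseteq> carrier (func_space I)" using assms by simp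
  show ?thesis
  proof
    show "annihilator I J (L.module.span Y) \<subseteq> annihilator I J Y"
      using L.in_own_span[OF Yc] by (auto simp: annihilator_def)
    show "annihilator I J Y \<subseteq> annihilator I J (L.module.span Y)"
    proof
      fix T assume T: "T \<in> annihilator I J Y"
      then have "linear_map F (func_space I) (func_space J) T" by (auto simp: annihilator_def lin_maps_def)
      then interpret T: linear_map F "func_space I" "func_space J" T .
      have "Y \<subseteq> T.ker" using T Yc by (auto simp: annihilator_def T.ker_def)
      then have "L.module.span Y \<subseteq> T.ker" using T.kerT_is_subspace by (rule L.span_minimal)
      then show "T \<in> annihilator I J (L.module.span Y)"
        using T by (auto simp: annihilator_def T.ker_def)
    qed
  qed
qed

text \<open>The maps are sorted by their value at \<open>v\<close>, for which there are
  \<open>q ^ card J\<close> choices. Subtracting a fixed map \<open>T0\<close> of a nonempty class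
  embeds the class into the maps that also vanish at \<open>v\<close>.\<close>

lemma card_annihilator_step:
  assumes fin: "finite I" "finite J" and Y: "Y \<subseteq> I \<rightarrow>\<^sub>E carrier F" and v: "v \<in> I \<rightarrow>\<^sub>E carrier F"
  shows "card (annihilator I J Y) \<le> card (carrier F) ^ card J * card (annihilator I J (insert v Y))"
proof -
  let ?A = "annihilator I J Y" and ?B = "annihilator I J (insert v Y)" and ?W = "J \<rightarrow>\<^sub>E carrier F"
  have fA: "finite ?A" "finite ?B" using finite_lin_maps[OF fin] by (auto simp: annihilator_def)
  have fW: "finite ?W" using fin finite_scalars by (auto intro: finite_PiE)
  have fib: "card {T \<in> ?A. T v = w} \<le> card ?B" for w
  proof (cases "{T \<in> ?A. T v = w} = {}")
    case False
    then obtain T0 where T0: "T0 \<in> ?A" "T0 v = w" by auto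
    let ?f = "\<lambda>T. \<lambda>x\<in>I \<rightarrow>\<^sub>E carrier F. \<lambda>j\<in>J. T x j \<ominus> T0 x j"
    have mem: "T x j \<in> carrier F" if "T \<in> lin_maps I J" "x \<in> I \<rightarrow>\<^sub>E carrier F" "j \<in> J" for T x j
      using that unfolding lin_maps_iff by (auto simp: PiE_iff)
    have alg1: "(a \<oplus> b) \<ominus> (c \<oplus> d) = (a \<ominus> c) \<oplus> (b \<ominus> d)"
      if "a \<in> carrier F" "b \<in> carrier F" "c \<in> carrier F" "d \<in> carrier F" for a b c d
      using that by (simp add: a_minus_def minus_add a_ac)
    have alg2: "e \<otimes> a \<ominus> e \<otimes> c = e \<otimes> (a \<ominus> c)"
      if "a \<in> carrier F" "c \<in> carrier F" "e \<in> carrier F" for a c e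
      using that by (simp add: a_minus_def r_distr r_minus)
    have "inj_on ?f {T \<in> ?A. T v = w}"
    proof (rule inj_onI)
      fix S T assume S: "S \<in> {T \<in> ?A. T v = w}" and T: "T \<in> {T \<in> ?A. T v = w}" and e: "?f S = ?f T"
      have l: "S \<in> lin_maps I J" "T \<in> lin_maps I J" "T0 \<in> lin_maps I J"
        using S T T0 by (auto simp: annihilator_def)
      show "S = T"
      proof (rule PiE_ext)
        show "S \<in> (I \<rightarrow>\<^sub>E carrier F) \<rightarrow>\<^sub>E ?W" "T \<in> (I \<rightarrow>\<^sub>E carrier F) \<rightarrow>\<^sub>E ?W" using l by (auto simp: lin_maps_iff)
        fix x assume x: "x \<in> I \<rightarrow>\<^sub>E carrier F"
        show "S x = T x"
        proof (rule PiE_ext)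
          show "S x \<in> ?W" "T x \<in> ?W" using l x by (auto simp: lin_maps_iff PiE_iff[of S] PiE_iff[of T])
          fix j assume j: "j \<in> J"
          have "S x j \<ominus> T0 x j = T x j \<ominus> T0 x j"
            using fun_cong[OF fun_cong[OF e, of x], of j] x j by simp
          then show "S x j = T x j" using mem[OF _ x j] l by (simp add: a_minus_def)
        qed
      qed
    qed
    moreover have "?f ` {T \<in> ?A. T v = w} \<subseteq> ?B"
    proof safe
      fix T assume T: "T \<in> ?A" "w = T v"
      have l: "T \<in> lin_maps I J" "T0 \<in> lin_maps I J" using T T0 by (auto simp: annihilator_def)
      have "?f T \<in> lin_maps I J"
        unfolding lin_maps_iff
      proof (intro conjI ballI)
        show "?f T \<in> (I \<rightarrow>\<^sub>E carrier F) \<rightarrow>\<^sub>E ?W" using mem l by auto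
      next
        fix x y assume xy: "x \<in> I \<rightarrow>\<^sub>E carrier F" "y \<in> I \<rightarrow>\<^sub>E carrier F"
        then have s: "(\<lambda>i\<in>I. x i \<oplus> y i) \<in> I \<rightarrow>\<^sub>E carrier F" by auto
        have t: "S (\<lambda>i\<in>I. x i \<oplus> y i) = (\<lambda>j\<in>J. S x j \<oplus> S y j)" if "S \<in> lin_maps I J" for S
          using that xy unfolding lin_maps_iff by blast
        show "?f T (\<lambda>i\<in>I. x i \<oplus> y i) = (\<lambda>j\<in>J. ?f T x j \<oplus> ?f T y j)"
          using s xy mem[OF l(1)] mem[OF l(2)] unfolding restrict_apply'[OF s] t[OF l(1)] t[OF l(2)]
          by (intro restrict_ext) (simp add: alg1)
      next
        fix c x assume cx: "c \<in> carrier F" "x \<in> I \<rightarrow>\<^sub>E carrier F"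
        then have s: "(\<lambda>i\<in>I. c \<otimes> x i) \<in> I \<rightarrow>\<^sub>E carrier F" by auto
        have t: "S (\<lambda>i\<in>I. c \<otimes> x i) = (\<lambda>j\<in>J. c \<otimes> S x j)" if "S \<in> lin_maps I J" for S
          using that cx unfolding lin_maps_iff by blast
        show "?f T (\<lambda>i\<in>I. c \<otimes> x i) = (\<lambda>j\<in>J. c \<otimes> ?f T x j)"
          using s cx mem[OF l(1)] mem[OF l(2)] unfolding restrict_apply'[OF s] t[OF l(1)] t[OF l(2)]
          by (intro restrict_ext) (simp add: alg2)
      qed
      moreover have "?f T y = (\<lambda>j\<in>J. \<zero>)" if y: "y \<in> insert v Y" for y
      proof -
        have yc: "y \<in> I \<rightarrow>\<^sub>E carrier F" using y Y v by auto
        have "T y = T0 y" using y T T0 by (auto simp: annihilator_def)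
        then show ?thesis using yc mem[OF l(2) yc] by (auto intro!: restrict_ext)
      qed
      ultimately show "?f T \<in> ?B" by (auto simp: annihilator_def)
    qed
    ultimately show ?thesis using fA(2) by (rule card_inj_on_le)
  next
    case True
    show ?thesis unfolding True by simp
  qed
  have "T v \<in> ?W" if "T \<in> ?A" for T
    using that v by (auto simp: annihilator_def lin_maps_iff PiE_iff[of T])
  then have "(\<Union>w\<in>?W. {T \<in> ?A. T v = w}) = ?A" by blast
  then have "card ?A \<le> (\<Sum>w\<in>?W. card {T \<in> ?A. T v = w})"
    using card_UN_le[OF fW, of "\<lambda>w. {T \<in> ?A. T v = w}"] by (simp only:)
  also have "\<dots> \<le> (\<Sum>w\<in>?W. card ?B)" by (intro sum_mono fib)
  also have "\<dots> = card (carrier F) ^ card J * card ?B" using fin by (simp add: card_PiE)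
  finally show ?thesis .
qed

text \<open>The one-vector step is iterated from \<open>Y\<close> up to \<open>B\<close>. The weight
  \<open>card Y ^ card J\<close> grows at each step by exactly the factor that the step may
  lose.\<close>

lemma card_annihilator_mono:
  assumes fin: "finite I" "finite J"
    and Y: "subspace F Y (func_space I)" and B: "subspace F B (func_space I)" and YB: "Y \<subseteq> B"
  shows "card (annihilator I J Y) * card Y ^ card J \<le> card (annihilator I J B) * card B ^ card J"
proof -
  interpret L: finite_vectorspace F "func_space I"
    using fin by (intro finite_vectorspace_func_space)
  let ?q = "card (carrier F)"
  show ?thesis using Y YB
  proof (induction "L.sdim B - L.sdim Y" arbitrary: Y)
    case 0
    then have "Y = B" using L.sdim_eq_imp_eq[of Y B] L.sdim_mono[of Y B] B by simp
    then show ?case by simp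
  next
    case (Suc n)
    then have "Y \<noteq> B" by auto
    then obtain v where v: "v \<in> B" "v \<notin> Y" using Suc.prems by auto
    then have vc: "v \<in> carrier (func_space I)" using L.subspaceD(1)[OF B] by blast
    let ?Y = "L.module.span (insert v Y)"
    have Yc: "insert v Y \<subseteq> carrier (func_space I)" using vc L.subspaceD(1)[OF Suc.prems(1)] by auto
    have d: "L.sdim ?Y = Suc (L.sdim Y)" using L.sdim_span_insert Suc.prems v vc by auto
    have "card (annihilator I J Y) * card Y ^ card J
        \<le> (?q ^ card J * card (annihilator I J (insert v Y))) * card Y ^ card J"
      using card_annihilator_step[OF fin, of Y v] Yc by (intro mult_right_mono) auto
    also have "annihilator I J (insert v Y) = annihilator I J ?Y"
      using annihilator_span[of "insert v Y" I J] Yc fin by simp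
    also have "(?q ^ card J * card (annihilator I J ?Y)) * card Y ^ card J
        = card (annihilator I J ?Y) * card ?Y ^ card J"
      using L.card_span_insert[OF Suc.prems(1) vc v(2)] by (simp add: power_mult_distrib)
    also have "\<dots> \<le> card (annihilator I J B) * card B ^ card J"
      using Suc.hyps(2) d L.span_is_subspace[OF Yc] L.span_minimal[of "insert v Y" B] Suc.prems v B
      by (intro Suc.hyps(1)) auto
    finally show ?case .
  qed
qed

lemma finsum_unit:
  assumes "finite I" "i \<in> I" "a \<in> I \<rightarrow> carrier F"
  shows "(\<Oplus>s\<in>I. (if s = i then \<one> else \<zero>) \<otimes> a s) = a i"
proof -
  have "(\<Oplus>s\<in>I. (if s = i then \<one> else \<zero>) \<otimes> a s) = (\<Oplus>s\<in>I. if i = s then a s else \<zero>)"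
    using assms by (intro finsum_cong') (auto simp: Pi_iff)
  also have "\<dots> = a i" using assms by (intro finsum_singleton) auto
  finally show ?thesis .
qed

definition unit_vec :: "'i set \<Rightarrow> 'i \<Rightarrow> ('i \<Rightarrow> 'a)" where
  "unit_vec I i = (\<lambda>s\<in>I. if s = i then \<one> else \<zero>)"

lemma unit_vec_closed [simp]: "unit_vec I i \<in> I \<rightarrow>\<^sub>E carrier F"
  by (auto simp: unit_vec_def)

lemma unit_vec_apply [simp]: "s \<in> I \<Longrightarrow> unit_vec I i s = (if s = i then \<one> else \<zero>)"
  by (simp add: unit_vec_def)

definition lin_ext :: "'i set \<Rightarrow> 'j set \<Rightarrow> ('i \<Rightarrow> 'j \<Rightarrow> 'a) \<Rightarrow> ('i \<Rightarrow> 'a) \<Rightarrow> ('j \<Rightarrow> 'a)" where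
  "lin_ext I J b = (\<lambda>x\<in>I \<rightarrow>\<^sub>E carrier F. \<lambda>j\<in>J. \<Oplus>s\<in>I. x s \<otimes> b s j)"

lemma lin_ext_unit_vec:
  assumes "finite I" "b \<in> I \<rightarrow> (J \<rightarrow>\<^sub>E carrier F)" "i \<in> I"
  shows "lin_ext I J b (unit_vec I i) = b i"
proof (rule PiE_ext)
  show "lin_ext I J b (unit_vec I i) \<in> J \<rightarrow>\<^sub>E carrier F"
  proof -
    have "b s j \<in> carrier F" if "s \<in> I" "j \<in> J" for s j using assms that by fastforce
    then have "(\<Oplus>s\<in>I. unit_vec I i s \<otimes> b s j) \<in> carrier F" if "j \<in> J" for j
      using that by (intro finsum_closed) auto
    then show ?thesis by (simp add: lin_ext_def)
  qed
  show "b i \<in> J \<rightarrow>\<^sub>E carrier F" using assms by auto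
  fix j assume j: "j \<in> J"
  have bc: "b s j \<in> carrier F" if "s \<in> I" for s using assms that j by fastforce
  have "(\<Oplus>s\<in>I. unit_vec I i s \<otimes> b s j) = (\<Oplus>s\<in>I. (if s = i then \<one> else \<zero>) \<otimes> b s j)"
    using bc by (intro finsum_cong') (auto simp: unit_vec_def)
  also have "\<dots> = b i j" using finsum_unit[of I i "\<lambda>s. b s j"] assms bc by auto
  finally show "lin_ext I J b (unit_vec I i) j = b i j" using j by (simp add: lin_ext_def)
qed

lemma lin_ext_in_lin_maps:
  assumes fin: "finite I" and b: "b \<in> I \<rightarrow> (J \<rightarrow>\<^sub>E carrier F)"
  shows "lin_ext I J b \<in> lin_maps I J"
  unfolding lin_maps_iff
proof (intro conjI ballI)
  have th: "b s j \<in> carrier F" if "s \<in> I" "j \<in> J" for s j using b that by fastforce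
  have xc: "x s \<in> carrier F" if "x \<in> I \<rightarrow>\<^sub>E carrier F" "s \<in> I" for x s using that by auto
  have mem: "(\<Oplus>s\<in>I. x s \<otimes> b s j) \<in> carrier F" if "x \<in> I \<rightarrow>\<^sub>E carrier F" "j \<in> J" for x j
    using that th xc by (intro finsum_closed) auto
  show "lin_ext I J b \<in> (I \<rightarrow>\<^sub>E carrier F) \<rightarrow>\<^sub>E J \<rightarrow>\<^sub>E carrier F" using mem by (auto simp: lin_ext_def)
  {
    fix x y assume xy: "x \<in> I \<rightarrow>\<^sub>E carrier F" "y \<in> I \<rightarrow>\<^sub>E carrier F"
    then have s: "(\<lambda>i\<in>I. x i \<oplus> y i) \<in> I \<rightarrow>\<^sub>E carrier F" by auto
    have "(\<Oplus>s\<in>I. (\<lambda>i\<in>I. x i \<oplus> y i) s \<otimes> b s j) = (\<Oplus>s\<in>I. x s \<otimes> b s j) \<oplus> (\<Oplus>s\<in>I. y s \<otimes> b s j)"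
      if j: "j \<in> J" for j
    proof -
      have "(\<Oplus>s\<in>I. (\<lambda>i\<in>I. x i \<oplus> y i) s \<otimes> b s j) = (\<Oplus>s\<in>I. x s \<otimes> b s j \<oplus> y s \<otimes> b s j)"
        using xc[OF xy(1)] xc[OF xy(2)] th[OF _ j] by (intro finsum_cong') (auto simp: l_distr)
      also have "\<dots> = (\<Oplus>s\<in>I. x s \<otimes> b s j) \<oplus> (\<Oplus>s\<in>I. y s \<otimes> b s j)"
        using xc[OF xy(1)] xc[OF xy(2)] th[OF _ j] by (intro finsum_addf) auto
      finally show ?thesis .
    qed
    then show "lin_ext I J b (\<lambda>i\<in>I. x i \<oplus> y i) = (\<lambda>j\<in>J. lin_ext I J b x j \<oplus> lin_ext I J b y j)"
      using s xy by (auto simp: lin_ext_def intro!: restrict_ext)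
  next
    fix c x assume cx: "c \<in> carrier F" "x \<in> I \<rightarrow>\<^sub>E carrier F"
    then have s: "(\<lambda>i\<in>I. c \<otimes> x i) \<in> I \<rightarrow>\<^sub>E carrier F" by auto
    have "(\<Oplus>s\<in>I. (\<lambda>i\<in>I. c \<otimes> x i) s \<otimes> b s j) = c \<otimes> (\<Oplus>s\<in>I. x s \<otimes> b s j)"
      if j: "j \<in> J" for j
    proof -
      have "(\<Oplus>s\<in>I. (\<lambda>i\<in>I. c \<otimes> x i) s \<otimes> b s j) = (\<Oplus>s\<in>I. c \<otimes> (x s \<otimes> b s j))"
        using xc[OF cx(2)] th[OF _ j] cx by (intro finsum_cong') (auto simp: m_assoc)
      also have "\<dots> = c \<otimes> (\<Oplus>s\<in>I. x s \<otimes> b s j)"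
        using xc[OF cx(2)] th[OF _ j] cx fin by (intro finsum_rdistr[symmetric]) auto
      finally show ?thesis .
    qed
    then show "lin_ext I J b (\<lambda>i\<in>I. c \<otimes> x i) = (\<lambda>j\<in>J. c \<otimes> lin_ext I J b x j)"
      using s cx by (auto simp: lin_ext_def intro!: restrict_ext)
  }
qed

text \<open>Distinct choices of images for the unit vectors have distinct linear extensions.
  Equality comes out of the squeeze in \<open>card_annihilator\<close>.\<close>

lemma card_lin_maps_ge:
  assumes fin: "finite I" "finite J"
  shows "(card (carrier F) ^ card I) ^ card J \<le> card (lin_maps I J)"
proof -
  let ?M = "I \<rightarrow>\<^sub>E (J \<rightarrow>\<^sub>E carrier F)"
  have "inj_on (lin_ext I J) ?M"
  proof (rule inj_onI)
    fix b b' assume t: "b \<in> ?M" "b' \<in> ?M" and e: "lin_ext I J b = lin_ext I J b'"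
    show "b = b'"
    proof (rule PiE_ext[OF t])
      fix i assume "i \<in> I"
      then show "b i = b' i"
        using lin_ext_unit_vec[OF fin(1), of b J i] lin_ext_unit_vec[OF fin(1), of b' J i] t e
        by (simp add: PiE_def)
    qed
  qed
  moreover have "lin_ext I J ` ?M \<subseteq> lin_maps I J"
    using lin_ext_in_lin_maps[OF fin(1)] by (auto simp: PiE_def)
  ultimately have "card ?M \<le> card (lin_maps I J)" using finite_lin_maps[OF fin] by (rule card_inj_on_le)
  then show ?thesis using fin by (simp add: card_PiE mult.commute flip: power_mult)
qed

text \<open>
  Every one-dimensional extension of the subspace shrinks its annihilator by a factor of at most
  \<open>q ^ card J\<close>. Since the annihilator of \<open>0\<close> has at least \<open>(q ^ card J) ^ card I\<close> elements and that of
  the whole space has one, no extension can shrink it by less.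
\<close>

lemma card_annihilator:
  assumes fin: "finite I" "finite J" and Y: "subspace F Y (func_space I)"
  shows "card (annihilator I J Y) * card Y ^ card J = card (lin_maps I J)"
proof (rule antisym)
  interpret L: finite_vectorspace F "func_space I"
    using fin by (intro finite_vectorspace_func_space)
  have "annihilator I J (I \<rightarrow>\<^sub>E carrier F) \<subseteq> {\<lambda>x\<in>I \<rightarrow>\<^sub>E carrier F. \<lambda>j\<in>J. \<zero>}"
    unfolding annihilator_def lin_maps_iff by (auto simp: fun_eq_iff PiE_iff extensional_def)
  from card_mono[OF _ this] have "card (annihilator I J (I \<rightarrow>\<^sub>E carrier F)) \<le> 1" by simp
  then have "card (annihilator I J (carrier (func_space I))) * card (carrier (func_space I)) ^ card J
      \<le> 1 * (card (carrier F) ^ card I) ^ card J"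
    using fin by (intro mult_mono) (auto simp: card_PiE)
  also have "\<dots> \<le> card (lin_maps I J)" using card_lin_maps_ge[OF fin] by simp
  finally show "card (annihilator I J Y) * card Y ^ card J \<le> card (lin_maps I J)"
    using card_annihilator_mono[OF fin Y L.subspace_carrier L.subspaceD(1)[OF Y]] by linarith
  have "annihilator I J {\<zero>\<^bsub>func_space I\<^esub>} = lin_maps I J"
    unfolding annihilator_def
  proof (intro equalityI subsetI CollectI conjI ballI)
    fix T y assume "T \<in> lin_maps I J" and y: "y \<in> {\<zero>\<^bsub>func_space I\<^esub>}"
    then have "linear_map F (func_space I) (func_space J) T" by (simp add: lin_maps_def)
    then interpret T: linear_map F "func_space I" "func_space J" T .
    show "T y = (\<lambda>j\<in>J. \<zero>)" using T.T0_is_0 y by simp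
  qed auto
  then show "card (lin_maps I J) \<le> card (annihilator I J Y) * card Y ^ card J"
    using card_annihilator_mono[OF fin L.subspace_zero Y] L.subspaceD(2)[OF Y] by simp
qed

end

section \<open>Determinants\<close>

context finite_scalar_field
begin

text \<open>The sign is a field element, so that it can be multiplied with determinants; in
  characteristic 2 both values coincide.\<close>

definition perm_sign :: "(nat \<Rightarrow> nat) \<Rightarrow> 'a" where
  "perm_sign p = (if evenperm p then \<one> else \<ominus> \<one>)"

lemma perm_sign_closed [simp]: "perm_sign p \<in> carrier F"
  by (simp add: perm_sign_def)

lemma permutes_imp_permutation: "p permutes {..<k::nat} \<Longrightarrow> permutation p"
  by (auto simp: permutation_permutes)

lemma minus_one_square: "\<ominus> \<one> \<otimes> \<ominus> \<one> = \<one>"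
  by (simp add: l_minus r_minus)

lemma perm_sign_comp:
  "p permutes {..<k::nat} \<Longrightarrow> s permutes {..<k} \<Longrightarrow> perm_sign (p \<circ> s) = perm_sign p \<otimes> perm_sign s"
  using evenperm_comp[OF permutes_imp_permutation permutes_imp_permutation, of p k s k]
  by (cases "evenperm p"; cases "evenperm s") (simp_all add: perm_sign_def minus_one_square)

lemma perm_sign_inv: "p permutes {..<k::nat} \<Longrightarrow> perm_sign (Hilbert_Choice.inv p) = perm_sign p"
  by (auto simp: perm_sign_def evenperm_inv permutes_imp_permutation)

lemma perm_sign_square: "perm_sign p \<otimes> perm_sign p = \<one>"
  by (auto simp: perm_sign_def minus_one_square)

lemma finite_perms: "finite {p. p permutes {..<k::nat}}"
  by (rule finite_permutations) simp

lemma permutes_lessThan: "p permutes {..<k::nat} \<Longrightarrow> i < k \<Longrightarrow> p i < k"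
  using permutes_in_image[of p "{..<k}" i] by auto

lemma ring_det_eq:
  assumes "\<And>i j. i < k \<Longrightarrow> j < k \<Longrightarrow> A i j \<in> carrier F"
  shows "ring_det F k A = (\<Oplus>p\<in>{p. p permutes {..<k}}. perm_sign p \<otimes> (\<Otimes>i\<in>{..<k}. A i (p i)))"
proof -
  have "(\<Otimes>i\<in>{..<k}. A i (p i)) \<in> carrier F" if "p permutes {..<k}" for p
    using assms permutes_lessThan[OF that] by (intro finprod_closed) auto
  then show ?thesis unfolding ring_det_def
    by (intro finsum_cong') (auto simp: perm_sign_def Let_def l_minus)
qed

lemma ring_det_cong:
  assumes "\<And>i j. i < k \<Longrightarrow> j < k \<Longrightarrow> A i j = B i j" "\<And>i j. i < k \<Longrightarrow> j < k \<Longrightarrow> B i j \<in> carrier F"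
  shows "ring_det F k A = ring_det F k B"
proof -
  have "(\<Otimes>i\<in>{..<k}. A i (p i)) = (\<Otimes>i\<in>{..<k}. B i (p i))" if "p permutes {..<k}" for p
    using assms permutes_lessThan[OF that] by (intro finprod_cong') auto
  moreover have "(\<Otimes>i\<in>{..<k}. B i (p i)) \<in> carrier F" if "p permutes {..<k}" for p
    using assms permutes_lessThan[OF that] by (intro finprod_closed) auto
  ultimately show ?thesis
    using assms by (subst (1 2) ring_det_eq) (auto intro!: finsum_cong')
qed

lemma ring_det_closed:
  assumes "\<And>i j. i < k \<Longrightarrow> j < k \<Longrightarrow> A i j \<in> carrier F"
  shows "ring_det F k A \<in> carrier F"
proof -
  have "(\<Otimes>i\<in>{..<k}. A i (p i)) \<in> carrier F" if "p permutes {..<k}" for p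
    using assms permutes_lessThan[OF that] by (intro finprod_closed) auto
  then show ?thesis using assms by (subst ring_det_eq) (auto intro!: finsum_closed)
qed

text \<open>The Leibniz sum with the entry of row \<open>i\<close> pulled out of each product. The
  cofactor of that entry does not involve row \<open>i\<close>, which gives linearity in the row;
  applied to the transpose, it also drives the contraction below.\<close>

lemma ring_det_expand_row:
  assumes "i < k" "\<And>i j. i < k \<Longrightarrow> j < k \<Longrightarrow> A i j \<in> carrier F"
  shows "ring_det F k A = (\<Oplus>p\<in>{p. p permutes {..<k}}.
     A i (p i) \<otimes> (perm_sign p \<otimes> (\<Otimes>i'\<in>{..<k} - {i}. A i' (p i'))))"
proof -
  have c: "(\<lambda>i'. A i' (p i')) \<in> ({..<k} - {i}) \<rightarrow> carrier F" "A i (p i) \<in> carrier F"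
    if "p permutes {..<k}" for p
    using assms permutes_lessThan[OF that] by auto
  have "perm_sign p \<otimes> (\<Otimes>i'\<in>{..<k}. A i' (p i')) =
      A i (p i) \<otimes> (perm_sign p \<otimes> (\<Otimes>i'\<in>{..<k} - {i}. A i' (p i')))" if p: "p permutes {..<k}" for p
  proof -
    have e: "{..<k} = insert i ({..<k} - {i})" using assms(1) by auto
    have "(\<Otimes>i'\<in>{..<k}. A i' (p i')) = A i (p i) \<otimes> (\<Otimes>i'\<in>{..<k} - {i}. A i' (p i'))"
      using c[OF p] by (subst e, subst finprod_insert) auto
    then show ?thesis using c[OF p] by (simp add: m_lcomm)
  qed
  then show ?thesis using assms(2) c by (subst ring_det_eq) (auto intro!: finsum_cong')
qed

text \<open>The sum is reindexed by inversion of permutations, which preserves signs, and each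
  product is reindexed along \<open>p\<close>.\<close>

lemma ring_det_transpose:
  assumes "\<And>i j. i < k \<Longrightarrow> j < k \<Longrightarrow> A i j \<in> carrier F"
  shows "ring_det F k (\<lambda>i j. A j i) = ring_det F k A"
proof -
  let ?P = "{p. p permutes {..<k}}"
  let ?t = "\<lambda>p. perm_sign p \<otimes> (\<Otimes>i\<in>{..<k}. A i (p i))"
  have cl: "(\<Otimes>i\<in>{..<k}. A i (p i)) \<in> carrier F" "(\<Otimes>i\<in>{..<k}. A (p i) i) \<in> carrier F" if "p \<in> ?P" for p
    using assms that permutes_lessThan by (auto intro!: finprod_closed)
  have bij: "Hilbert_Choice.inv ` ?P = ?P" "inj_on Hilbert_Choice.inv ?P"
  proof -
    have "p \<in> Hilbert_Choice.inv ` ?P" if "p \<in> ?P" for p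
      using that permutes_inv permutes_inv_inv[of p "{..<k}"]
      by (intro image_eqI[of _ _ "Hilbert_Choice.inv p"]) (simp_all add: permutes_inv)
    then show "Hilbert_Choice.inv ` ?P = ?P" using permutes_inv by auto
    show "inj_on Hilbert_Choice.inv ?P" by (rule inj_on_inverseI[of _ Hilbert_Choice.inv]) (auto simp: permutes_inv_inv)
  qed
  have "ring_det F k A = (\<Oplus>p\<in>Hilbert_Choice.inv ` ?P. ?t p)" unfolding bij using assms by (rule ring_det_eq)
  also have "\<dots> = (\<Oplus>p\<in>?P. ?t (Hilbert_Choice.inv p))"
    using cl bij by (intro finsum_reindex) auto
  also have "\<dots> = (\<Oplus>p\<in>?P. perm_sign p \<otimes> (\<Otimes>i\<in>{..<k}. A (p i) i))"
  proof (rule finsum_cong'[OF refl])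
    show "(\<lambda>p. perm_sign p \<otimes> (\<Otimes>i\<in>{..<k}. A (p i) i)) \<in> ?P \<rightarrow> carrier F" using cl by auto
    fix p assume p: "p \<in> ?P"
    then have p': "p permutes {..<k}" by simp
    have "(\<Otimes>i\<in>{..<k}. A i (Hilbert_Choice.inv p i)) = (\<Otimes>i\<in>p ` {..<k}. A i (Hilbert_Choice.inv p i))"
      using permutes_image[OF p'] by simp
    also have "\<dots> = (\<Otimes>i\<in>{..<k}. A (p i) (Hilbert_Choice.inv p (p i)))"
      using assms permutes_lessThan[OF p'] permutes_lessThan[OF permutes_inv[OF p']]
      by (intro finprod_reindex permutes_inj_on[OF p']) auto
    also have "\<dots> = (\<Otimes>i\<in>{..<k}. A (p i) i)" using permutes_inverses(2)[OF p'] by simp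
    finally show "?t (Hilbert_Choice.inv p) = perm_sign p \<otimes> (\<Otimes>i\<in>{..<k}. A (p i) i)"
      using perm_sign_inv[OF p'] by simp
  qed
  also have "\<dots> = ring_det F k (\<lambda>i j. A j i)" using assms by (subst ring_det_eq) auto
  finally show ?thesis by simp
qed

text \<open>The sum is reindexed by composition with \<open>s\<close>; the sign of \<open>s\<close>
  then occurs twice and its square is one.\<close>

lemma ring_det_permute_columns:
  assumes "\<And>i j. i < k \<Longrightarrow> j < k \<Longrightarrow> A i j \<in> carrier F" "s permutes {..<k}"
  shows "ring_det F k (\<lambda>i j. A i (s j)) = perm_sign s \<otimes> ring_det F k A"
proof -
  let ?P = "{p. p permutes {..<k}}"
  let ?t = "\<lambda>p. perm_sign p \<otimes> (\<Otimes>i\<in>{..<k}. A i (p i))"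
  have cl: "?t p \<in> carrier F" if "p permutes {..<k}" for p
    using assms permutes_lessThan[OF that] by (auto intro!: finprod_closed)
  have im: "(\<circ>) s ` ?P = ?P"
  proof
    show "(\<circ>) s ` ?P \<subseteq> ?P" using permutes_compose assms by auto
    show "?P \<subseteq> (\<circ>) s ` ?P"
    proof
      fix p assume p: "p \<in> ?P"
      have "p = s \<circ> (Hilbert_Choice.inv s \<circ> p)" using permutes_inv_o(1)[OF assms(2)] by (simp add: o_assoc)
      moreover have "Hilbert_Choice.inv s \<circ> p \<in> ?P" using p permutes_compose permutes_inv[OF assms(2)] by auto
      ultimately show "p \<in> (\<circ>) s ` ?P" by blast
    qed
  qed
  have inj: "inj_on ((\<circ>) s) ?P" using permutes_inj[OF assms(2)] by (auto intro!: inj_onI simp: fun_eq_iff inj_eq)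
  have "ring_det F k A = (\<Oplus>p\<in>(\<circ>) s ` ?P. ?t p)" unfolding im using assms(1) by (rule ring_det_eq)
  also have "\<dots> = (\<Oplus>p\<in>?P. ?t (s \<circ> p))" using cl permutes_compose[OF _ assms(2)] inj by (intro finsum_reindex) auto
  finally have e: "ring_det F k A = (\<Oplus>p\<in>?P. ?t (s \<circ> p))" .
  have "perm_sign s \<otimes> ring_det F k A = (\<Oplus>p\<in>?P. perm_sign s \<otimes> ?t (s \<circ> p))"
    unfolding e
    by (rule finsum_rdistr[OF finite_perms perm_sign_closed], rule Pi_I, rule cl)
      (simp add: permutes_compose[OF _ assms(2)])
  also have "\<dots> = (\<Oplus>p\<in>?P. perm_sign p \<otimes> (\<Otimes>i\<in>{..<k}. A i (s (p i))))"
  proof (rule finsum_cong'[OF refl])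
    have cl': "(\<Otimes>i\<in>{..<k}. A i (s (p i))) \<in> carrier F" if "p permutes {..<k}" for p
      using assms permutes_lessThan[OF that] permutes_lessThan[OF assms(2)] by (auto intro!: finprod_closed)
    then show "(\<lambda>p. perm_sign p \<otimes> (\<Otimes>i\<in>{..<k}. A i (s (p i)))) \<in> ?P \<rightarrow> carrier F" by auto
    fix p assume "p \<in> ?P"
    then have p: "p permutes {..<k}" by simp
    have "perm_sign s \<otimes> ?t (s \<circ> p) = (perm_sign s \<otimes> perm_sign s) \<otimes> (perm_sign p \<otimes> (\<Otimes>i\<in>{..<k}. A i (s (p i))))"
      using cl'[OF p] perm_sign_comp[OF assms(2) p] by (simp add: m_assoc)
    then show "perm_sign s \<otimes> ?t (s \<circ> p) = perm_sign p \<otimes> (\<Otimes>i\<in>{..<k}. A i (s (p i)))"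
      using cl'[OF p] by (simp add: perm_sign_square)
  qed
  also have "\<dots> = ring_det F k (\<lambda>i j. A i (s j))"
    using assms permutes_lessThan[OF assms(2)] by (subst ring_det_eq) auto
  finally show ?thesis by simp
qed

lemma ring_det_permute_rows:
  assumes "\<And>i j. i < k \<Longrightarrow> j < k \<Longrightarrow> A i j \<in> carrier F" "s permutes {..<k}"
  shows "ring_det F k (\<lambda>i j. A (s i) j) = perm_sign s \<otimes> ring_det F k A"
proof -
  have "ring_det F k (\<lambda>i j. A (s i) j) = ring_det F k (\<lambda>i j. A (s j) i)"
    using ring_det_transpose[of k "\<lambda>i j. A (s j) i"] assms(1) permutes_lessThan[OF assms(2)] by simp
  also have "\<dots> = perm_sign s \<otimes> ring_det F k (\<lambda>i j. A j i)"
    using ring_det_permute_columns[of k "\<lambda>i j. A j i"] assms by simp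
  also have "ring_det F k (\<lambda>i j. A j i) = ring_det F k A" using ring_det_transpose assms(1) by blast
  finally show ?thesis .
qed

text \<open>
  Composition with the transposition of the two columns pairs even with odd permutations, and
  paired terms cancel; this also covers characteristic 2.
\<close>

lemma ring_det_equal_columns:
  assumes A: "\<And>i j. i < k \<Longrightarrow> j < k \<Longrightarrow> A i j \<in> carrier F"
    and ab: "a < k" "b < k" "a \<noteq> b" "\<And>i. i < k \<Longrightarrow> A i a = A i b"
  shows "ring_det F k A = \<zero>"
proof -
  let ?P = "{p. p permutes {..<k}}" and ?E = "{p. p permutes {..<k} \<and> evenperm p}"
    and ?O = "{p. p permutes {..<k} \<and> \<not> evenperm p}"
  let ?c = "\<lambda>p. \<Otimes>i\<in>{..<k}. A i (p i)"
  let ?s = "Transposition.transpose a b"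
  have s: "?s permutes {..<k}" using ab by (intro permutes_swap_id) auto
  have cl: "?c p \<in> carrier F" if "p permutes {..<k}" for p
    using A permutes_lessThan[OF that] by (auto intro!: finprod_closed)
  have P: "?P = ?E \<union> ?O" "?E \<inter> ?O = {}" "finite ?E" "finite ?O" using finite_perms[of k] by auto
  have sp: "(?s \<circ> p) permutes {..<k}" "evenperm (?s \<circ> p) \<longleftrightarrow> \<not> evenperm p" if "p permutes {..<k}" for p
    using that s permutes_compose ab
    by (auto simp: evenperm_comp permutes_imp_permutation evenperm_swap permutation_swap_id)
  have im: "(\<circ>) ?s ` ?E = ?O"
  proof
    show "(\<circ>) ?s ` ?E \<subseteq> ?O" using sp by auto
    show "?O \<subseteq> (\<circ>) ?s ` ?E"
    proof
      fix p assume p: "p \<in> ?O"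
      have "p = ?s \<circ> (?s \<circ> p)" by (simp add: fun_eq_iff)
      then show "p \<in> (\<circ>) ?s ` ?E" using p sp by blast
    qed
  qed
  have inj: "inj_on ((\<circ>) ?s) ?E" by (auto simp: inj_on_def fun_eq_iff) (metis transpose_involutory)
  have "(\<Oplus>p\<in>?O. \<ominus> ?c p) = (\<Oplus>p\<in>?E. \<ominus> ?c (?s \<circ> p))"
    unfolding im[symmetric] using cl sp inj by (intro finsum_reindex) auto
  also have "\<dots> = (\<Oplus>p\<in>?E. \<ominus> ?c p)"
  proof (rule finsum_cong'[OF refl])
    fix p assume "p \<in> ?E"
    then have p: "p permutes {..<k}" by simp
    have "?c (?s \<circ> p) = ?c p"
      using A permutes_lessThan[OF p] ab by (intro finprod_cong') (auto simp: Transposition.transpose_def)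
    then show "\<ominus> ?c (?s \<circ> p) = \<ominus> ?c p" by simp
  qed (use cl in auto)
  finally have O: "(\<Oplus>p\<in>?O. \<ominus> ?c p) = (\<Oplus>p\<in>?E. \<ominus> ?c p)" .
  have "ring_det F k A = (\<Oplus>p\<in>?E \<union> ?O. perm_sign p \<otimes> ?c p)" 
    unfolding P(1)[symmetric] using A by (rule ring_det_eq)
  also have "\<dots> = (\<Oplus>p\<in>?E. perm_sign p \<otimes> ?c p) \<oplus> (\<Oplus>p\<in>?O. perm_sign p \<otimes> ?c p)"
    by (rule finsum_Un_disjoint[OF P(3) P(4) P(2)]; rule Pi_I; intro m_closed cl; simp)
  also have "(\<Oplus>p\<in>?E. perm_sign p \<otimes> ?c p) = (\<Oplus>p\<in>?E. ?c p)"
    using cl by (intro finsum_cong') (auto simp: perm_sign_def)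
  also have "(\<Oplus>p\<in>?O. perm_sign p \<otimes> ?c p) = (\<Oplus>p\<in>?O. \<ominus> ?c p)"
    using cl by (intro finsum_cong') (auto simp: perm_sign_def l_minus)
  also have "(\<Oplus>p\<in>?E. ?c p) \<oplus> (\<Oplus>p\<in>?O. \<ominus> ?c p) = (\<Oplus>p\<in>?E. ?c p \<oplus> \<ominus> ?c p)"
    unfolding O using cl P(3) by (intro finsum_addf[symmetric]) auto
  also have "\<dots> = (\<Oplus>p\<in>?E. \<zero>)" using cl by (intro finsum_cong') (auto simp: r_neg)
  finally show ?thesis by simp
qed

lemma ring_det_equal_rows:
  assumes A: "\<And>i j. i < k \<Longrightarrow> j < k \<Longrightarrow> A i j \<in> carrier F"
    and ab: "a < k" "b < k" "a \<noteq> b" "\<And>j. j < k \<Longrightarrow> A a j = A b j"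
  shows "ring_det F k A = \<zero>"
  using ring_det_equal_columns[of k "\<lambda>i j. A j i" a b] ring_det_transpose[of k A] assms by simp

lemma ring_det_zero_row:
  assumes A: "\<And>i j. i < k \<Longrightarrow> j < k \<Longrightarrow> A i j \<in> carrier F"
    and a: "a < k" "\<And>j. j < k \<Longrightarrow> A a j = \<zero>"
  shows "ring_det F k A = \<zero>"
proof -
  have "(\<Otimes>i'\<in>{..<k} - {a}. A i' (p i')) \<in> carrier F" if "p permutes {..<k}" for p
    using A permutes_lessThan[OF that] by (intro finprod_closed) auto
  then have "(\<Oplus>p\<in>{p. p permutes {..<k}}. A a (p a) \<otimes> (perm_sign p \<otimes> (\<Otimes>i'\<in>{..<k} - {a}. A i' (p i'))))
      = (\<Oplus>p\<in>{p. p permutes {..<k}}. \<zero>)"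
    using a permutes_lessThan[OF _ a(1)] by (intro finsum_cong') auto
  then show ?thesis using ring_det_expand_row[of a k A, OF a(1) A] by simp
qed

lemma ring_det_zero_column:
  assumes A: "\<And>i j. i < k \<Longrightarrow> j < k \<Longrightarrow> A i j \<in> carrier F"
    and a: "a < k" "\<And>i. i < k \<Longrightarrow> A i a = \<zero>"
  shows "ring_det F k A = \<zero>"
  using ring_det_zero_row[of k "\<lambda>i j. A j i" a] ring_det_transpose[of k A] assms by simp

lemma ring_det_row_add:
  assumes "a < k" "\<And>i j. i < k \<Longrightarrow> j < k \<Longrightarrow> A i j \<in> carrier F"
    "\<And>j. j < k \<Longrightarrow> x j \<in> carrier F" "\<And>j. j < k \<Longrightarrow> y j \<in> carrier F"
  shows "ring_det F k (A(a := \<lambda>j. x j \<oplus> y j)) = ring_det F k (A(a := x)) \<oplus> ring_det F k (A(a := y))"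
proof -
  let ?r = "\<lambda>p. perm_sign p \<otimes> (\<Otimes>i'\<in>{..<k} - {a}. A i' (p i'))"
  have e: "ring_det F k (A(a := z)) = (\<Oplus>p\<in>{p. p permutes {..<k}}. z (p a) \<otimes> ?r p)"
    if "\<And>j. j < k \<Longrightarrow> z j \<in> carrier F" for z
  proof -
    have "(\<Otimes>i'\<in>{..<k} - {a}. (A(a := z)) i' (p i')) = (\<Otimes>i'\<in>{..<k} - {a}. A i' (p i'))"
      if "p permutes {..<k}" for p
      using assms permutes_lessThan[OF that] by (intro finprod_cong') auto
    moreover have "(\<Otimes>i'\<in>{..<k} - {a}. A i' (p i')) \<in> carrier F" if "p permutes {..<k}" for p
      using assms permutes_lessThan[OF that] by (intro finprod_closed) auto
    ultimately show ?thesis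
      using assms that permutes_lessThan[OF _ assms(1)]
      by (subst ring_det_expand_row[OF assms(1)]) (auto intro!: finsum_cong')
  qed
  have r: "?r p \<in> carrier F" if "p permutes {..<k}" for p
    using assms permutes_lessThan[OF that] by (auto intro!: finprod_closed)
  have "(\<Oplus>p\<in>{p. p permutes {..<k}}. (x (p a) \<oplus> y (p a)) \<otimes> ?r p)
      = (\<Oplus>p\<in>{p. p permutes {..<k}}. x (p a) \<otimes> ?r p \<oplus> y (p a) \<otimes> ?r p)"
    using assms r permutes_lessThan[OF _ assms(1)] by (intro finsum_cong') (auto intro!: l_distr)
  also have "\<dots> = (\<Oplus>p\<in>{p. p permutes {..<k}}. x (p a) \<otimes> ?r p) \<oplus> (\<Oplus>p\<in>{p. p permutes {..<k}}. y (p a) \<otimes> ?r p)"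
    using assms r permutes_lessThan[OF _ assms(1)] by (intro finsum_addf) auto
  finally show ?thesis using assms by (simp add: e)
qed

lemma ring_det_row_smult:
  assumes "a < k" "\<And>i j. i < k \<Longrightarrow> j < k \<Longrightarrow> A i j \<in> carrier F"
    "\<And>j. j < k \<Longrightarrow> x j \<in> carrier F" "c \<in> carrier F"
  shows "ring_det F k (A(a := \<lambda>j. c \<otimes> x j)) = c \<otimes> ring_det F k (A(a := x))"
proof -
  let ?r = "\<lambda>p. perm_sign p \<otimes> (\<Otimes>i'\<in>{..<k} - {a}. A i' (p i'))"
  have e: "ring_det F k (A(a := z)) = (\<Oplus>p\<in>{p. p permutes {..<k}}. z (p a) \<otimes> ?r p)"
    if "\<And>j. j < k \<Longrightarrow> z j \<in> carrier F" for z
  proof -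
    have "(\<Otimes>i'\<in>{..<k} - {a}. (A(a := z)) i' (p i')) = (\<Otimes>i'\<in>{..<k} - {a}. A i' (p i'))"
      if "p permutes {..<k}" for p
      using assms permutes_lessThan[OF that] by (intro finprod_cong') auto
    moreover have "(\<Otimes>i'\<in>{..<k} - {a}. A i' (p i')) \<in> carrier F" if "p permutes {..<k}" for p
      using assms permutes_lessThan[OF that] by (intro finprod_closed) auto
    ultimately show ?thesis
      using assms that permutes_lessThan[OF _ assms(1)]
      by (subst ring_det_expand_row[OF assms(1)]) (auto intro!: finsum_cong')
  qed
  have r: "?r p \<in> carrier F" if "p permutes {..<k}" for p
    using assms permutes_lessThan[OF that] by (auto intro!: finprod_closed)
  have "(\<Oplus>p\<in>{p. p permutes {..<k}}. (c \<otimes> x (p a)) \<otimes> ?r p)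
      = (\<Oplus>p\<in>{p. p permutes {..<k}}. c \<otimes> (x (p a) \<otimes> ?r p))"
    using assms r permutes_lessThan[OF _ assms(1)] by (intro finsum_cong') (auto intro!: m_assoc)
  also have "\<dots> = c \<otimes> (\<Oplus>p\<in>{p. p permutes {..<k}}. x (p a) \<otimes> ?r p)"
    using assms r permutes_lessThan[OF _ assms(1)] finite_perms by (intro finsum_rdistr[symmetric]) auto
  finally show ?thesis using assms by (simp add: e)
qed

lemma ring_det_one: "ring_det F k (\<lambda>i j. if i = j then \<one> else \<zero>) = \<one>"
proof -
  let ?A = "\<lambda>i j. if i = j then \<one> else \<zero>" and ?P = "{p. p permutes {..<k}}"
  have "(\<Otimes>i\<in>{..<k}. ?A i (p i)) = (if p = id then \<one> else \<zero>)" if p: "p permutes {..<k}" for p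
  proof (cases "p = id")
    case False
    then obtain i where i: "p i \<noteq> i" by (auto simp: fun_eq_iff)
    then have "i \<in> {..<k}" using permutes_not_in[OF p] by blast
    then have e: "{..<k} = insert i ({..<k} - {i})" by auto
    have "(\<Otimes>i\<in>{..<k}. ?A i (p i)) = \<zero> \<otimes> (\<Otimes>i\<in>{..<k} - {i}. ?A i (p i))"
      using i by (subst e, subst finprod_insert) auto
    then show ?thesis using False by (simp add: finprod_closed Pi_iff)
  qed simp
  then have "ring_det F k ?A = (\<Oplus>p\<in>?P. if id = p then \<one> else \<zero>)"
    by (subst ring_det_eq) (auto intro!: finsum_cong' simp: perm_sign_def id_def)
  also have "\<dots> = \<one>" using finite_perms by (intro finsum_singleton) (auto simp: permutes_id)
  finally show ?thesis .
qed

end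

context finite_vectorspace
begin

text \<open>The image of the span is a subspace containing the generators of the right side, and the
  preimage of the right side is a subspace containing \<open>X\<close>.\<close>

lemma span_image_linear:
  assumes "linear_map K V W T" "X \<subseteq> carrier V" "finite_vectorspace K W"
  shows "T ` span X = LinearCombinations.module.span K W (T ` X)"
proof -
  interpret W: finite_vectorspace K W by fact
  interpret T: linear_map K V W T by fact
  have TX: "T ` X \<subseteq> carrier W" using assms(2) by auto
  have sX: "subspace K (span X) V" using assms(2) by (rule span_is_subspace)
  have "subspace K (T ` span X) W"
  proof (rule W.subspaceI)
    show "T ` span X \<subseteq> carrier W" using subspaceD(1)[OF sX] by auto
    show "\<zero>\<^bsub>W\<^esub> \<in> T ` span X" using subspaceD(2)[OF sX] T.T0_is_0 by force
    show "u \<oplus>\<^bsub>W\<^esub> v \<in> T ` span X" if uv: "u \<in> T ` span X" "v \<in> T ` span X" for u v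
    proof -
      obtain a b where ab: "a \<in> span X" "u = T a" "b \<in> span X" "v = T b" using uv by blast
      then have "u \<oplus>\<^bsub>W\<^esub> v = T (a \<oplus>\<^bsub>V\<^esub> b)" using subspaceD(1)[OF sX] by (auto simp: T.T_add subset_iff)
      then show ?thesis using subspaceD(3)[OF sX] ab by blast
    qed
    show "c \<odot>\<^bsub>W\<^esub> v \<in> T ` span X" if cv: "c \<in> carrier K" "v \<in> T ` span X" for c v
    proof -
      obtain b where b: "b \<in> span X" "v = T b" using cv by blast
      then have "c \<odot>\<^bsub>W\<^esub> v = T (c \<odot>\<^bsub>V\<^esub> b)" using subspaceD(1)[OF sX] cv by (auto simp: T.T_smult subset_iff)
      then show ?thesis using subspaceD(4)[OF sX cv(1)] b by blast
    qed
  qed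
  then have 1: "W.module.span (T ` X) \<subseteq> T ` span X"
    using in_own_span[OF assms(2)] by (intro W.span_minimal) auto
  note sT = W.subspaceD[OF W.span_is_subspace[OF TX]]
  let ?P = "{x \<in> carrier V. T x \<in> W.module.span (T ` X)}"
  have "subspace K ?P V"
    by (rule subspaceI) (use sT T.T_add T.T_smult T.T0_is_0 in auto)
  then have "span X \<subseteq> ?P" using W.in_own_span[OF TX] assms(2) by (intro span_minimal) auto
  then show ?thesis using 1 by auto
qed

end

section \<open>Index sets of the exterior power and their increasing enumerations\<close>

definition ksubs :: "nat \<Rightarrow> nat \<Rightarrow> nat set set" where
  "ksubs N k = {S. S \<subseteq> {..<N} \<and> card S = k}"

lemma finite_ksubs [simp]: "finite (ksubs N k)"
  by (rule finite_subset[of _ "Pow {..<N}"]) (auto simp: ksubs_def)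

lemma ksubs_finite: "S \<in> ksubs N k \<Longrightarrow> finite S"
  by (auto simp: ksubs_def intro: finite_subset)

lemma sorted_nth_ksubs:
  assumes "S \<in> ksubs N k" "i < k"
  shows "sorted_list_of_set S ! i \<in> S" "sorted_list_of_set S ! i < N"
proof -
  have "i < length (sorted_list_of_set S)" using assms by (simp add: ksubs_def)
  then have "sorted_list_of_set S ! i \<in> set (sorted_list_of_set S)" by (rule nth_mem)
  then show "sorted_list_of_set S ! i \<in> S" using ksubs_finite[OF assms(1)] by simp
  then show "sorted_list_of_set S ! i < N" using assms by (auto simp: ksubs_def)
qed

lemma sorted_nth_image: "S \<in> ksubs N k \<Longrightarrow> (\<lambda>i. sorted_list_of_set S ! i) ` {..<k} = S"
  using ksubs_finite[of S N k] nth_image[of k "sorted_list_of_set S"]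
  by (simp add: ksubs_def lessThan_atLeast0)

lemma sorted_nth_inj: "S \<in> ksubs N k \<Longrightarrow> inj_on (\<lambda>i. sorted_list_of_set S ! i) {..<k}"
  using ksubs_finite[of S N k] by (auto simp: inj_on_def ksubs_def nth_eq_iff_index_eq)

text \<open>Compose \<open>c\<close> with the inverse of the increasing enumeration. The lemma turns
  minors with columns in arbitrary order into coordinates of a wedge, up to sign.\<close>

lemma enumeration_permutes:
  assumes S: "S \<in> ksubs N k" and c: "inj_on c {..<k}" "c ` {..<k} = S"
  shows "\<exists>s. s permutes {..<k} \<and> (\<forall>t<k. c t = sorted_list_of_set S ! s t)"
proof -
  let ?l = "\<lambda>i. sorted_list_of_set S ! i"
  define s where "s t = (if t < k then inv_into {..<k} ?l (c t) else t)" for t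
  have l: "bij_betw ?l {..<k} S" using sorted_nth_inj[OF S] sorted_nth_image[OF S] by (simp add: bij_betw_def)
  have "bij_betw (inv_into {..<k} ?l \<circ> c) {..<k} {..<k}"
    by (rule bij_betw_trans[OF _ bij_betw_inv_into[OF l]]) (use c in \<open>simp add: bij_betw_def\<close>)
  then have "bij_betw s {..<k} {..<k}" by (rule bij_betw_cong[THEN iffD1, rotated]) (simp add: s_def)
  then have "s permutes {..<k}" by (rule bij_imp_permutes) (simp add: s_def)
  moreover have "c t = ?l (s t)" if "t < k" for t
    using that c(2) f_inv_into_f[of "c t" ?l "{..<k}"] sorted_nth_image[OF S] by (auto simp: s_def)
  ultimately show ?thesis by blast
qed

section \<open>Exterior powers of subspaces\<close>

context finite_scalar_field
begin

abbreviation q :: nat where "q \<equiv> card (carrier F)"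

abbreviation vecs :: "'i set \<Rightarrow> ('i \<Rightarrow> 'a) set" where "vecs I \<equiv> I \<rightarrow>\<^sub>E carrier F"

lemma exterior_power_eq: "exterior_power F k N = func_space (ksubs N k)"
  by (simp add: exterior_power_def ksubs_def)

lemma coord_space_eq: "coord_space F N = func_space {..<N}"
  by (simp add: coord_space_def)

lemma wedge_eq: "wedge F k N v = (\<lambda>S\<in>ksubs N k. ring_det F k (\<lambda>i j. v i (sorted_list_of_set S ! j)))"
  by (simp add: wedge_def ksubs_def)

lemma lin_mapsD:
  assumes "T \<in> lin_maps I J"
  shows "\<And>x. x \<in> vecs I \<Longrightarrow> T x \<in> vecs J"
    "\<And>x y. x \<in> vecs I \<Longrightarrow> y \<in> vecs I \<Longrightarrow> T (\<lambda>i\<in>I. x i \<oplus> y i) = (\<lambda>j\<in>J. T x j \<oplus> T y j)"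
    "\<And>c x. c \<in> carrier F \<Longrightarrow> x \<in> vecs I \<Longrightarrow> T (\<lambda>i\<in>I. c \<otimes> x i) = (\<lambda>j\<in>J. c \<otimes> T x j)"
    "linear_map F (func_space I) (func_space J) T" "T (\<lambda>i\<in>I. \<zero>) = (\<lambda>j\<in>J. \<zero>)"
proof -
  have "T \<in> vecs I \<rightarrow>\<^sub>E vecs J" using assms[unfolded lin_maps_iff] by (elim conjE)
  then show "\<And>x. x \<in> vecs I \<Longrightarrow> T x \<in> vecs J" by (rule PiE_mem)
  show "\<And>x y. x \<in> vecs I \<Longrightarrow> y \<in> vecs I \<Longrightarrow> T (\<lambda>i\<in>I. x i \<oplus> y i) = (\<lambda>j\<in>J. T x j \<oplus> T y j)"
    "\<And>c x. c \<in> carrier F \<Longrightarrow> x \<in> vecs I \<Longrightarrow> T (\<lambda>i\<in>I. c \<otimes> x i) = (\<lambda>j\<in>J. c \<otimes> T x j)"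
    using assms unfolding lin_maps_iff by blast+
  show l: "linear_map F (func_space I) (func_space J) T" using assms by (simp add: lin_maps_def)
  interpret T: linear_map F "func_space I" "func_space J" T by (rule l)
  show "T (\<lambda>i\<in>I. \<zero>) = (\<lambda>j\<in>J. \<zero>)" using T.T0_is_0 by simp
qed

text \<open>Coordinates are removed from the support one at a time. With \<open>Z\<close> the set of
  vectors that have some linear property, this is an induction principle: the property need only be
  checked on unit vectors.\<close>

lemma supported_in_subspace:
  assumes fin: "finite I" and Z: "subspace F Z (func_space I)" and A: "A \<subseteq> I" "\<And>i. i \<in> A \<Longrightarrow> unit_vec I i \<in> Z"
    and x: "x \<in> vecs I" "\<And>i. i \<in> I - A \<Longrightarrow> x i = \<zero>"
  shows "x \<in> Z"
proof -
  interpret L: finite_vectorspace F "func_space I" using fin by (rule finite_vectorspace_func_space)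
  note z = L.subspaceD[OF Z]
  have "finite A" using A fin finite_subset by blast
  then show ?thesis using A x
  proof (induction A arbitrary: x rule: finite_induct)
    case empty
    then have "x = (\<lambda>i\<in>I. \<zero>)" by (intro PiE_ext[of x I "\<lambda>_. carrier F"]) auto
    then show ?case using z(2) by (simp only: func_space_simps)
  next
    case (insert i A)
    let ?y = "x(i := \<zero>)"
    have iI: "i \<in> I" using insert by auto
    have yc: "?y \<in> vecs I" using insert.prems(3) iI by (auto simp: PiE_iff extensional_def)
    have "?y \<in> Z"
    proof (rule insert.IH[OF _ _ yc])
      show "A \<subseteq> I" using insert.prems(1) by blast
      show "unit_vec I i' \<in> Z" if "i' \<in> A" for i' using insert.prems(2) that by blast
      show "?y i' = \<zero>" if "i' \<in> I - A" for i'
        using insert.prems(4)[of i'] that by (cases "i' = i") auto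
    qed
    moreover have xi: "x i \<in> carrier F" using insert.prems(3) iI by (rule PiE_mem)
    moreover have "x i \<odot>\<^bsub>func_space I\<^esub> unit_vec I i \<in> Z"
      by (rule z(4)[OF xi insert.prems(2)]) simp
    ultimately have "?y \<oplus>\<^bsub>func_space I\<^esub> (x i \<odot>\<^bsub>func_space I\<^esub> unit_vec I i) \<in> Z" by (intro z(3))
    moreover have "?y \<oplus>\<^bsub>func_space I\<^esub> (x i \<odot>\<^bsub>func_space I\<^esub> unit_vec I i) = x"
    proof (rule PiE_ext[of _ I "\<lambda>_. carrier F"])
      show "?y \<oplus>\<^bsub>func_space I\<^esub> (x i \<odot>\<^bsub>func_space I\<^esub> unit_vec I i) \<in> vecs I"
        using PiE_mem[OF yc] xi by (simp del: fun_upd_apply)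
      show "x \<in> vecs I" by (rule insert.prems(3))
      fix s assume "s \<in> I"
      then show "(?y \<oplus>\<^bsub>func_space I\<^esub> (x i \<odot>\<^bsub>func_space I\<^esub> unit_vec I i)) s = x s"
        using PiE_mem[OF insert.prems(3)] iI by (cases "s = i") simp_all
    qed
    ultimately show ?case by simp
  qed
qed

lemma entry_closed: "v \<in> {..<k} \<rightarrow> vecs {..<N} \<Longrightarrow> i < k \<Longrightarrow> j < N \<Longrightarrow> v i j \<in> carrier F"
  by fastforce

lemma wedge_closed:
  assumes "v \<in> {..<k} \<rightarrow> vecs {..<N}"
  shows "wedge F k N v \<in> vecs (ksubs N k)"
proof -
  have "ring_det F k (\<lambda>i j. v i (sorted_list_of_set S ! j)) \<in> carrier F" if "S \<in> ksubs N k" for S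
    by (rule ring_det_closed) (simp add: entry_closed[OF assms] sorted_nth_ksubs(2)[OF that])
  then show ?thesis unfolding wedge_eq by simp
qed

lemma wedge_cong:
  assumes "\<And>i. i < k \<Longrightarrow> v i = w i" "w \<in> {..<k} \<rightarrow> vecs {..<N}"
  shows "wedge F k N v = wedge F k N w"
  unfolding wedge_eq
  by (intro restrict_ext ring_det_cong)
    (simp_all add: assms(1) entry_closed[OF assms(2)] sorted_nth_ksubs(2))

lemma wedge_row_add:
  assumes "a < k" "v \<in> {..<k} \<rightarrow> vecs {..<N}" "x \<in> vecs {..<N}" "y \<in> vecs {..<N}"
  shows "wedge F k N (v(a := \<lambda>j\<in>{..<N}. x j \<oplus> y j)) =
    (\<lambda>S\<in>ksubs N k. wedge F k N (v(a := x)) S \<oplus> wedge F k N (v(a := y)) S)"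
  unfolding wedge_eq
proof (rule restrict_ext)
  fix S assume S: "S \<in> ksubs N k"
  let ?l = "\<lambda>j. sorted_list_of_set S ! j"
  let ?A = "\<lambda>i j. v i (?l j)"
  have u: "(\<lambda>i j. (v(a := z)) i (?l j)) = ?A(a := \<lambda>j. z (?l j))" for z by (auto simp: fun_eq_iff)
  have A: "?A i j \<in> carrier F" if "i < k" "j < k" for i j
    using entry_closed[OF assms(2)] sorted_nth_ksubs(2)[OF S] that by auto
  have xy: "x (?l j) \<in> carrier F" "y (?l j) \<in> carrier F" if "j < k" for j
    using assms sorted_nth_ksubs(2)[OF S that] by auto
  have "ring_det F k (?A(a := \<lambda>j. (\<lambda>j\<in>{..<N}. x j \<oplus> y j) (?l j)))
      = ring_det F k (?A(a := \<lambda>j. x (?l j) \<oplus> y (?l j)))"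
    using A xy sorted_nth_ksubs(2)[OF S] by (intro ring_det_cong) auto
  also have "\<dots> = ring_det F k (?A(a := \<lambda>j. x (?l j))) \<oplus> ring_det F k (?A(a := \<lambda>j. y (?l j)))"
    using A xy assms(1) by (intro ring_det_row_add) auto
  finally show "ring_det F k (\<lambda>i j. (v(a := \<lambda>j\<in>{..<N}. x j \<oplus> y j)) i (?l j)) =
      (\<lambda>S\<in>ksubs N k. ring_det F k (\<lambda>i j. (v(a := x)) i (sorted_list_of_set S ! j))) S \<oplus>
      (\<lambda>S\<in>ksubs N k. ring_det F k (\<lambda>i j. (v(a := y)) i (sorted_list_of_set S ! j))) S"
    using S by (simp only: u restrict_apply' )
qed

lemma wedge_row_smult:
  assumes "a < k" "v \<in> {..<k} \<rightarrow> vecs {..<N}" "x \<in> vecs {..<N}" "c \<in> carrier F"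
  shows "wedge F k N (v(a := \<lambda>j\<in>{..<N}. c \<otimes> x j)) =
    (\<lambda>S\<in>ksubs N k. c \<otimes> wedge F k N (v(a := x)) S)"
  unfolding wedge_eq
proof (rule restrict_ext)
  fix S assume S: "S \<in> ksubs N k"
  let ?l = "\<lambda>j. sorted_list_of_set S ! j"
  let ?A = "\<lambda>i j. v i (?l j)"
  have u: "(\<lambda>i j. (v(a := z)) i (?l j)) = ?A(a := \<lambda>j. z (?l j))" for z by (auto simp: fun_eq_iff)
  have A: "?A i j \<in> carrier F" if "i < k" "j < k" for i j
    using entry_closed[OF assms(2)] sorted_nth_ksubs(2)[OF S] that by auto
  have xy: "x (?l j) \<in> carrier F" if "j < k" for j
    using assms sorted_nth_ksubs(2)[OF S that] by auto
  have "ring_det F k (?A(a := \<lambda>j. (\<lambda>j\<in>{..<N}. c \<otimes> x j) (?l j)))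
      = ring_det F k (?A(a := \<lambda>j. c \<otimes> x (?l j)))"
    using A xy sorted_nth_ksubs(2)[OF S] assms(4) by (intro ring_det_cong) auto
  also have "\<dots> = c \<otimes> ring_det F k (?A(a := \<lambda>j. x (?l j)))"
    using A xy assms by (intro ring_det_row_smult) auto
  finally show "ring_det F k (\<lambda>i j. (v(a := \<lambda>j\<in>{..<N}. c \<otimes> x j)) i (?l j)) =
      c \<otimes> (\<lambda>S\<in>ksubs N k. ring_det F k (\<lambda>i j. (v(a := x)) i (sorted_list_of_set S ! j))) S"
    using S by (simp only: u restrict_apply')
qed

lemma wedge_permute:
  assumes "v \<in> {..<k} \<rightarrow> vecs {..<N}" "s permutes {..<k}"
  shows "wedge F k N (\<lambda>i. v (s i)) = (\<lambda>S\<in>ksubs N k. perm_sign s \<otimes> wedge F k N v S)"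
  unfolding wedge_eq
proof (rule restrict_ext)
  fix S assume S: "S \<in> ksubs N k"
  show "ring_det F k (\<lambda>i j. v (s i) (sorted_list_of_set S ! j)) =
    perm_sign s \<otimes> (\<lambda>S\<in>ksubs N k. ring_det F k (\<lambda>i j. v i (sorted_list_of_set S ! j))) S"
    using ring_det_permute_rows[of k "\<lambda>i j. v i (sorted_list_of_set S ! j)" s]
      entry_closed[OF assms(1)] sorted_nth_ksubs(2)[OF S] assms(2) S by simp
qed

lemma wedge_repeated:
  assumes "v \<in> {..<k} \<rightarrow> vecs {..<N}" "a < k" "b < k" "a \<noteq> b" "v a = v b"
  shows "wedge F k N v = (\<lambda>S\<in>ksubs N k. \<zero>)"
  unfolding wedge_eq
  by (intro restrict_ext ring_det_equal_rows[of k _ a b])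
    (simp_all add: assms(2-5) entry_closed[OF assms(1)] sorted_nth_ksubs(2))

text \<open>At the coordinate \<open>S\<close> the minor is that of an identity matrix. Another set
  of the same size contains an index outside \<open>S\<close>, and that column of the minor is
  zero.\<close>

lemma wedge_unit_vecs:
  assumes S: "S \<in> ksubs N k"
  shows "wedge F k N (\<lambda>i. unit_vec {..<N} (sorted_list_of_set S ! i)) = unit_vec (ksubs N k) S"
  unfolding wedge_eq unit_vec_def
proof (rule restrict_ext)
  fix S' assume S': "S' \<in> ksubs N k"
  note b = sorted_nth_ksubs(2)[OF S']
  show "ring_det F k (\<lambda>i j. (\<lambda>s\<in>{..<N}. if s = sorted_list_of_set S ! i then \<one> else \<zero>) (sorted_list_of_set S' ! j)) =
    (if S' = S then \<one> else \<zero>)"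
  proof (cases "S' = S")
    case True
    have "ring_det F k (\<lambda>i j. (\<lambda>s\<in>{..<N}. if s = sorted_list_of_set S ! i then \<one> else \<zero>) (sorted_list_of_set S' ! j))
      = ring_det F k (\<lambda>i j. if i = j then \<one> else \<zero>)"
      using b inj_on_eq_iff[OF sorted_nth_inj[OF S]] True by (intro ring_det_cong) auto
    then show ?thesis using True ring_det_one by simp
  next
    case False
    have "card S' = card S" using S S' by (simp add: ksubs_def)
    then have "\<not> S' \<subseteq> S" using False card_subset_eq[OF ksubs_finite[OF S], of S'] by blast
    then obtain x where x: "x \<in> S'" "x \<notin> S" by blast
    then have "x \<in> (\<lambda>i. sorted_list_of_set S' ! i) ` {..<k}" using sorted_nth_image[OF S'] by simp
    then obtain j where j: "j < k" "sorted_list_of_set S' ! j \<notin> S" using x by blast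
    then have "sorted_list_of_set S' ! j \<noteq> sorted_list_of_set S ! i" if "i < k" for i
      using sorted_nth_ksubs(1)[OF S that] by metis
    then show ?thesis using b j False by (subst ring_det_zero_column[of k _ j]) auto
  qed
qed

text \<open>The order of quantifiers matters: one sign serves all \<open>v\<close>, because it
  depends only on the order of the columns. This makes the contraction below linear.\<close>

lemma ring_det_sorted_columns:
  assumes S: "S \<in> ksubs N k" and c: "inj_on c {..<k}" "c ` {..<k} = S"
  shows "\<exists>s. \<forall>v\<in>{..<k} \<rightarrow> vecs {..<N}. ring_det F k (\<lambda>i t. v i (c t)) = perm_sign s \<otimes> wedge F k N v S"
proof -
  obtain s where s: "s permutes {..<k}" "\<forall>t<k. c t = sorted_list_of_set S ! s t"
    using enumeration_permutes[OF S c] by blast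
  have "ring_det F k (\<lambda>i t. v i (c t)) = perm_sign s \<otimes> wedge F k N v S"
    if v: "v \<in> {..<k} \<rightarrow> vecs {..<N}" for v
  proof -
    have "ring_det F k (\<lambda>i t. v i (c t)) = ring_det F k (\<lambda>i t. v i (sorted_list_of_set S ! s t))"
      using s entry_closed[OF v] sorted_nth_ksubs(2)[OF S] permutes_lessThan[OF s(1)]
      by (intro ring_det_cong) auto
    also have "\<dots> = perm_sign s \<otimes> ring_det F k (\<lambda>i t. v i (sorted_list_of_set S ! t))"
      using ring_det_permute_columns[of k "\<lambda>i t. v i (sorted_list_of_set S ! t)" s]
        s entry_closed[OF v] sorted_nth_ksubs(2)[OF S] by auto
    finally show ?thesis using S by (simp add: wedge_eq)
  qed
  then show ?thesis by blast
qed

text \<open>The \<open>k\<close>-th exterior power of the linear map \<open>g\<close>, prescribed on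
  the standard basis only; its compatibility with arbitrary wedges is the content of
  \<open>ext_map_wedge\<close>.\<close>

definition ext_map :: "nat \<Rightarrow> nat \<Rightarrow> ((nat \<Rightarrow> 'a) \<Rightarrow> (nat \<Rightarrow> 'a)) \<Rightarrow> ((nat set \<Rightarrow> 'a) \<Rightarrow> (nat set \<Rightarrow> 'a))" where
  "ext_map k N g = lin_ext (ksubs N k) (ksubs N k)
     (\<lambda>S. wedge F k N (\<lambda>i. g (unit_vec {..<N} (sorted_list_of_set S ! i))))"

context
  fixes g and k N :: nat
  assumes g: "g \<in> lin_maps {..<N} {..<N}"
begin

lemma map_rows: "w \<in> {..<k} \<rightarrow> vecs {..<N} \<Longrightarrow> (\<lambda>i. g (w i)) \<in> {..<k} \<rightarrow> vecs {..<N}"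
  by (simp add: Pi_iff lin_mapsD(1)[OF g])

lemma map_unit_rows: "(\<lambda>i. g (unit_vec {..<N} (c i))) \<in> {..<k} \<rightarrow> vecs {..<N}"
  by (simp add: Pi_iff lin_mapsD(1)[OF g])

lemma ext_map_lin_maps: "ext_map k N g \<in> lin_maps (ksubs N k) (ksubs N k)"
  unfolding ext_map_def by (intro lin_ext_in_lin_maps finite_ksubs Pi_I wedge_closed map_unit_rows)

lemma ext_map_unit_vec:
  assumes S: "S \<in> ksubs N k"
  shows "ext_map k N g (unit_vec (ksubs N k) S) = wedge F k N (\<lambda>i. g (unit_vec {..<N} (sorted_list_of_set S ! i)))"
  unfolding ext_map_def 
  by (rule lin_ext_unit_vec[OF finite_ksubs _ S], rule Pi_I, rule wedge_closed, rule map_unit_rows)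

text \<open>If a unit vector is repeated, both sides vanish. Otherwise sorting the indices changes
  both sides by the same sign, and the sorted case holds by construction.\<close>

lemma ext_map_wedge_basis:
  assumes c: "\<And>i. i < k \<Longrightarrow> c i < N \<and> v i = unit_vec {..<N} (c i)"
  shows "ext_map k N g (wedge F k N v) = wedge F k N (\<lambda>i. g (v i))"
proof (cases "inj_on c {..<k}")
  case False
  then obtain a b where ab: "a < k" "b < k" "a \<noteq> b" "c a = c b" by (auto simp: inj_on_def)
  have v: "v \<in> {..<k} \<rightarrow> vecs {..<N}" using c by (simp add: Pi_iff)
  have "v a = v b" using ab c by metis
  then show ?thesis
    using wedge_repeated[OF v ab(1-3)] wedge_repeated[OF map_rows[OF v] ab(1-3)] lin_mapsD(5)[OF ext_map_lin_maps] by simp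
next
  case True
  define S where "S = c ` {..<k}"
  let ?e = "unit_vec {..<N}"
  have S: "S \<in> ksubs N k" using c True by (auto simp: ksubs_def card_image S_def)
  obtain s where s: "s permutes {..<k}" "\<forall>t<k. c t = sorted_list_of_set S ! s t"
    using enumeration_permutes[OF S True S_def[symmetric]] by blast
  let ?w = "\<lambda>i. ?e (sorted_list_of_set S ! i)"
  have w: "?w \<in> {..<k} \<rightarrow> vecs {..<N}" "(\<lambda>i. g (?w i)) \<in> {..<k} \<rightarrow> vecs {..<N}"
    using map_unit_rows by (simp_all add: Pi_iff)
  have ws: "(\<lambda>i. ?w (s i)) \<in> {..<k} \<rightarrow> vecs {..<N}" "(\<lambda>i. g (?w (s i))) \<in> {..<k} \<rightarrow> vecs {..<N}"
    using map_unit_rows by (simp_all add: Pi_iff)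
  have vs: "v i = ?w (s i)" if "i < k" for i using c[OF that] s that by auto
  have "wedge F k N v = wedge F k N (\<lambda>i. ?w (s i))" by (rule wedge_cong[OF vs ws(1)])
  also have "\<dots> = (\<lambda>T\<in>ksubs N k. perm_sign s \<otimes> unit_vec (ksubs N k) S T)"
    unfolding wedge_unit_vecs[OF S, symmetric] by (rule wedge_permute[OF w(1) s(1)])
  finally have "ext_map k N g (wedge F k N v) =
      (\<lambda>T\<in>ksubs N k. perm_sign s \<otimes> ext_map k N g (unit_vec (ksubs N k) S) T)"
    using lin_mapsD(3)[OF ext_map_lin_maps perm_sign_closed unit_vec_closed, of s S] by (simp only:)
  also have "\<dots> = (\<lambda>T\<in>ksubs N k. perm_sign s \<otimes> wedge F k N (\<lambda>i. g (?w i)) T)"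
    unfolding ext_map_unit_vec[OF S] ..
  also have "\<dots> = wedge F k N (\<lambda>i. g (?w (s i)))" by (rule wedge_permute[OF w(2) s(1), symmetric])
  also have "\<dots> = wedge F k N (\<lambda>i. g (v i))"
    using vs ws(2) by (intro wedge_cong[symmetric]) simp_all
  finally show ?thesis .
qed

text \<open>Both sides are linear in every argument, so the arguments may be replaced by basis vectors one at a time.\<close>

lemma ext_map_wedge:
  assumes "v \<in> {..<k} \<rightarrow> vecs {..<N}"
  shows "ext_map k N g (wedge F k N v) = wedge F k N (\<lambda>i. g (v i))"
proof -
  \<comment> \<open>Here \<open>t\<close> counts the leading arguments that may be arbitrary; all
    arguments from position \<open>t\<close> on are unit vectors.\<close>
  have "ext_map k N g (wedge F k N v) = wedge F k N (\<lambda>i. g (v i))"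
    if "t \<le> k" "v \<in> {..<k} \<rightarrow> vecs {..<N}" "\<And>i. t \<le> i \<Longrightarrow> i < k \<Longrightarrow> \<exists>j<N. v i = unit_vec {..<N} j" for t v
    using that
  proof (induction t arbitrary: v)
    case 0
    then have "\<forall>i. \<exists>j. i < k \<longrightarrow> j < N \<and> v i = unit_vec {..<N} j" by auto
    then obtain c where "\<And>i. i < k \<Longrightarrow> c i < N \<and> v i = unit_vec {..<N} (c i)" by metis
    then show ?case by (rule ext_map_wedge_basis)
  next
    case (Suc t)
    interpret V: finite_vectorspace F "func_space {..<N}" by (rule finite_vectorspace_func_space) simp
    have tk: "t < k" using Suc.prems by simp
    let ?gv = "\<lambda>i. g (v i)"
    have gv: "?gv \<in> {..<k} \<rightarrow> vecs {..<N}" using Suc.prems(2) by (rule map_rows)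
    have up: "(\<lambda>i. g ((v(t := x)) i)) = ?gv(t := g x)" for x by (auto simp: fun_eq_iff)
    have cl: "v(t := x) \<in> {..<k} \<rightarrow> vecs {..<N}" "?gv(t := g x) \<in> {..<k} \<rightarrow> vecs {..<N}" if "x \<in> vecs {..<N}" for x
      using that Suc.prems(2) gv lin_mapsD(1)[OF g] by (simp_all add: Pi_iff)
    \<comment> \<open>The vectors for which the claim holds in position \<open>t\<close>. They form
      a subspace, and by induction it contains all unit vectors.\<close>
    let ?Z = "{x \<in> vecs {..<N}. ext_map k N g (wedge F k N (v(t := x))) = wedge F k N (?gv(t := g x))}"
    have add: "(\<lambda>j\<in>{..<N}. x j \<oplus> y j) \<in> ?Z" if xy: "x \<in> ?Z" "y \<in> ?Z" for x y
    proof -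
      have c: "x \<in> vecs {..<N}" "y \<in> vecs {..<N}" using xy by auto
      have "ext_map k N g (wedge F k N (v(t := \<lambda>j\<in>{..<N}. x j \<oplus> y j))) =
        (\<lambda>S\<in>ksubs N k. wedge F k N (?gv(t := g x)) S \<oplus> wedge F k N (?gv(t := g y)) S)"
        using wedge_row_add[OF tk Suc.prems(2) c] xy
          lin_mapsD(2)[OF ext_map_lin_maps wedge_closed[OF cl(1)[OF c(1)]] wedge_closed[OF cl(1)[OF c(2)]]] by simp
      also have "\<dots> = wedge F k N (?gv(t := g (\<lambda>j\<in>{..<N}. x j \<oplus> y j)))"
        using wedge_row_add[OF tk gv lin_mapsD(1)[OF g c(1)] lin_mapsD(1)[OF g c(2)]] lin_mapsD(2)[OF g c] by simp
      finally show ?thesis using c by auto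
    qed
    have smult: "(\<lambda>j\<in>{..<N}. a \<otimes> x j) \<in> ?Z" if a: "a \<in> carrier F" and x: "x \<in> ?Z" for a x
    proof -
      have c: "x \<in> vecs {..<N}" using x by auto
      have "ext_map k N g (wedge F k N (v(t := \<lambda>j\<in>{..<N}. a \<otimes> x j))) =
        (\<lambda>S\<in>ksubs N k. a \<otimes> wedge F k N (?gv(t := g x)) S)"
        using wedge_row_smult[OF tk Suc.prems(2) c a] x
          lin_mapsD(3)[OF ext_map_lin_maps a wedge_closed[OF cl(1)[OF c]]] by simp
      also have "\<dots> = wedge F k N (?gv(t := g (\<lambda>j\<in>{..<N}. a \<otimes> x j)))"
        using wedge_row_smult[OF tk gv lin_mapsD(1)[OF g c] a] lin_mapsD(3)[OF g a c] by simp
      finally show ?thesis using c a by auto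
    qed
    have unit: "unit_vec {..<N} j \<in> ?Z" if "j < N" for j
    proof -
      have "ext_map k N g (wedge F k N (v(t := unit_vec {..<N} j))) = wedge F k N (\<lambda>i. g ((v(t := unit_vec {..<N} j)) i))"
        using tk Suc.prems that by (intro Suc.IH) (auto simp: Pi_iff)
      then show ?thesis unfolding up by simp
    qed
    have ne: "(\<lambda>j\<in>{..<N}. \<zero>) \<in> ?Z"
    proof -
      have z: "(\<lambda>j\<in>{..<N}. \<zero>) \<in> vecs {..<N}" by auto
      have r: "(\<lambda>j\<in>{..<N}. \<zero> \<otimes> (\<lambda>j\<in>{..<N}. \<zero>) j) = (\<lambda>j\<in>{..<N}. \<zero>)" by (intro restrict_ext) auto
      have wz: "wedge F k N (w(t := \<lambda>j\<in>{..<N}. \<zero>)) = (\<lambda>S\<in>ksubs N k. \<zero>)" if w: "w \<in> {..<k} \<rightarrow> vecs {..<N}" for w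
      proof -
        let ?W = "wedge F k N (w(t := \<lambda>j\<in>{..<N}. \<zero>))"
        have W: "?W \<in> vecs (ksubs N k)" using w z by (intro wedge_closed) (simp add: Pi_iff)
        show ?thesis
        proof (rule PiE_ext[OF W])
          show "(\<lambda>S\<in>ksubs N k. \<zero>) \<in> vecs (ksubs N k)" by simp
          fix S assume S: "S \<in> ksubs N k"
          have "?W S = \<zero> \<otimes> ?W S"
            using fun_cong[OF wedge_row_smult[OF tk w z zero_closed, unfolded r], of S] S by simp
          also have "\<dots> = \<zero>" using PiE_mem[OF W S] by (rule l_null)
          finally show "?W S = (\<lambda>S\<in>ksubs N k. \<zero>) S" using S by simp
        qed
      qed
      show ?thesis using wz[OF Suc.prems(2)] wz[OF gv] lin_mapsD(5)[OF g] lin_mapsD(5)[OF ext_map_lin_maps] z by simp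
    qed
    have "subspace F ?Z (func_space {..<N})"
      using add smult ne by (intro V.subspaceI) auto
    then have "v t \<in> ?Z"
    proof (rule supported_in_subspace[OF finite_lessThan _ subset_refl])
      show "v t \<in> vecs {..<N}" using Suc.prems(2) tk by (simp add: Pi_iff)
    qed (use unit in simp_all)
    then have "ext_map k N g (wedge F k N (v(t := v t))) = wedge F k N (\<lambda>i. g ((v(t := v t)) i))"
      unfolding up by simp
    then show ?case by (simp only: fun_upd_triv)
  qed
  from this[of k v] show ?thesis using assms by simp
qed

end

end

section \<open>Coordinate subspaces and their exterior powers\<close>

context finite_scalar_field
begin

definition supp_space :: "'i set \<Rightarrow> 'i set \<Rightarrow> ('i \<Rightarrow> 'a) set" where
  "supp_space I A = {x \<in> vecs I. \<forall>i\<in>I - A. x i = \<zero>}"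

lemma unit_vec_supp_space: "i \<in> A \<Longrightarrow> unit_vec I i \<in> supp_space I A"
  by (auto simp: supp_space_def)

lemma subspace_supp_space:
  assumes "finite I" shows "subspace F (supp_space I A) (func_space I)"
proof -
  interpret L: finite_vectorspace F "func_space I" using assms by (rule finite_vectorspace_func_space)
  show ?thesis by (rule L.subspaceI) (auto simp: supp_space_def)
qed

lemma supp_space_subset:
  assumes "finite I" "subspace F Z (func_space I)" "A \<subseteq> I" "\<And>i. i \<in> A \<Longrightarrow> unit_vec I i \<in> Z"
  shows "supp_space I A \<subseteq> Z"
proof
  fix x assume "x \<in> supp_space I A"
  then show "x \<in> Z" by (intro supported_in_subspace[OF assms]) (simp_all add: supp_space_def)
qed

lemma card_supp_space:
  assumes "finite I" "A \<subseteq> I"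
  shows "card (supp_space I A) = q ^ card A"
proof -
  have "bij_betw (\<lambda>x. \<lambda>i\<in>I. if i \<in> A then x i else \<zero>) (vecs A) (supp_space I A)"
  proof (rule bij_betwI[where g = "\<lambda>x. restrict x A"])
    show "(\<lambda>x. \<lambda>i\<in>I. if i \<in> A then x i else \<zero>) \<in> vecs A \<rightarrow> supp_space I A"
      using assms by (auto simp: supp_space_def)
    show "(\<lambda>x. restrict x A) \<in> supp_space I A \<rightarrow> vecs A"
      using assms by (auto simp: supp_space_def)
    show "restrict (\<lambda>i\<in>I. if i \<in> A then x i else \<zero>) A = x" if "x \<in> vecs A" for x
      using that assms by (auto simp: fun_eq_iff PiE_iff extensional_def)
    show "(\<lambda>i\<in>I. if i \<in> A then restrict y A i else \<zero>) = y" if "y \<in> supp_space I A" for y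
      using that assms by (auto simp: supp_space_def fun_eq_iff PiE_iff extensional_def)
  qed
  then have "card (supp_space I A) = card (vecs A)" by (simp add: bij_betw_same_card)
  also have "\<dots> = q ^ card A" using finite_subset[OF assms(2,1)] by (simp add: card_PiE)
  finally show ?thesis .
qed

lemma span_unit_vecs:
  assumes "finite I" "A \<subseteq> I"
  shows "module.span F (func_space I) (unit_vec I ` A) = supp_space I A"
proof -
  interpret L: finite_vectorspace F "func_space I" using assms by (intro finite_vectorspace_func_space)
  have c: "unit_vec I ` A \<subseteq> carrier (func_space I)" by (simp add: image_subset_iff)
  show ?thesis
  proof
    show "L.module.span (unit_vec I ` A) \<subseteq> supp_space I A"
      by (intro L.span_minimal subspace_supp_space[OF assms(1)])
        (simp add: image_subset_iff unit_vec_supp_space)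
    show "supp_space I A \<subseteq> L.module.span (unit_vec I ` A)"
      using L.in_own_span[OF c] assms
      by (intro supp_space_subset L.span_is_subspace c) (simp_all add: image_subset_iff)
  qed
qed

lemma exterior_power_of_eq:
  "exterior_power_of F k N H = module.span F (func_space (ksubs N k)) (wedge F k N ` ({..<k} \<rightarrow> H))"
  by (simp add: exterior_power_of_def exterior_power_eq)

context
  fixes N k :: nat
begin

interpretation V: finite_vectorspace F "func_space {..<N}" by (rule finite_vectorspace_func_space) simp
interpretation L: finite_vectorspace F "func_space (ksubs N k)" by (rule finite_vectorspace_func_space) simp

abbreviation "E B \<equiv> supp_space {..<N} B"
abbreviation "ext H \<equiv> exterior_power_of F k N H"

lemma wedges_closed:
  assumes "H \<subseteq> vecs {..<N}" shows "wedge F k N ` ({..<k} \<rightarrow> H) \<subseteq> carrier (func_space (ksubs N k))"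
proof -
  have "v \<in> {..<k} \<rightarrow> vecs {..<N}" if "v \<in> {..<k} \<rightarrow> H" for v using that assms by (auto simp: Pi_iff)
  then show ?thesis using wedge_closed by (intro image_subsetI) simp
qed

lemma subspace_ext: "H \<subseteq> vecs {..<N} \<Longrightarrow> subspace F (ext H) (func_space (ksubs N k))"
  unfolding exterior_power_of_eq by (intro L.span_is_subspace wedges_closed)

lemma ext_subset_carrier: "H \<subseteq> vecs {..<N} \<Longrightarrow> ext H \<subseteq> vecs (ksubs N k)"
  using L.subspaceD(1)[OF subspace_ext] by simp

lemma wedge_in_ext: "H \<subseteq> vecs {..<N} \<Longrightarrow> v \<in> {..<k} \<rightarrow> H \<Longrightarrow> wedge F k N v \<in> ext H"
  unfolding exterior_power_of_eq using L.in_own_span[OF wedges_closed] by blast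

lemma ext_minimal:
  "subspace F Z (func_space (ksubs N k)) \<Longrightarrow> (\<And>v. v \<in> {..<k} \<rightarrow> H \<Longrightarrow> wedge F k N v \<in> Z) \<Longrightarrow> ext H \<subseteq> Z"
  unfolding exterior_power_of_eq by (intro L.span_minimal) auto

lemma ext_mono: "H \<subseteq> H' \<Longrightarrow> H' \<subseteq> vecs {..<N} \<Longrightarrow> ext H \<subseteq> ext H'"
  by (rule ext_minimal[OF subspace_ext]) (auto intro!: wedge_in_ext)

text \<open>A minor that uses a column outside \<open>B\<close> has a zero column; conversely the
  basis vectors with index set inside \<open>B\<close> are wedges of unit vectors of
  \<open>E B\<close>. This is the model to which general subspaces are moved by an
  automorphism.\<close>

lemma ext_supp_space:
  assumes "B \<subseteq> {..<N}"
  shows "ext (E B) = supp_space (ksubs N k) {S \<in> ksubs N k. S \<subseteq> B}"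
proof
  have EB: "E B \<subseteq> vecs {..<N}" by (auto simp: supp_space_def)
  show "ext (E B) \<subseteq> supp_space (ksubs N k) {S \<in> ksubs N k. S \<subseteq> B}"
  proof (rule ext_minimal[OF subspace_supp_space])
    fix v assume v: "v \<in> {..<k} \<rightarrow> E B"
    then have vc: "v \<in> {..<k} \<rightarrow> vecs {..<N}" using EB by (auto simp: Pi_iff)
    have "wedge F k N v S = \<zero>" if S: "S \<in> ksubs N k" "\<not> S \<subseteq> B" for S
    proof -
      obtain x where x: "x \<in> S" "x \<notin> B" using S by blast
      then have "x \<in> (\<lambda>i. sorted_list_of_set S ! i) ` {..<k}" using sorted_nth_image[OF S(1)] by simp
      then obtain j where j: "j < k" "sorted_list_of_set S ! j \<notin> B" using x by blast
      then have "v i (sorted_list_of_set S ! j) = \<zero>" if "i < k" for i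
        using v that sorted_nth_ksubs(2)[OF S(1) j(1)] by (auto simp: supp_space_def Pi_iff)
      then have "ring_det F k (\<lambda>i j. v i (sorted_list_of_set S ! j)) = \<zero>"
        using entry_closed[OF vc] sorted_nth_ksubs(2)[OF S(1)] j(1)
        by (intro ring_det_zero_column[of k _ j]) auto
      then show ?thesis using S by (simp add: wedge_eq)
    qed
    then show "wedge F k N v \<in> supp_space (ksubs N k) {S \<in> ksubs N k. S \<subseteq> B}"
      using wedge_closed[OF vc] by (auto simp: supp_space_def)
  qed simp
  show "supp_space (ksubs N k) {S \<in> ksubs N k. S \<subseteq> B} \<subseteq> ext (E B)"
  proof (rule supp_space_subset[OF _ subspace_ext[OF EB]])
    fix S assume "S \<in> {S \<in> ksubs N k. S \<subseteq> B}"
    then have S: "S \<in> ksubs N k" "S \<subseteq> B" by auto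
    have "(\<lambda>i. unit_vec {..<N} (sorted_list_of_set S ! i)) \<in> {..<k} \<rightarrow> E B"
      using sorted_nth_ksubs(1)[OF S(1)] S(2) by (intro Pi_I unit_vec_supp_space) auto
    from wedge_in_ext[OF EB this] show "unit_vec (ksubs N k) S \<in> ext (E B)"
      by (simp only: wedge_unit_vecs[OF S(1)])
  qed auto
qed

lemma supp_space_full: "supp_space I I = vecs I"
  by (auto simp: supp_space_def)

lemma ext_full: "ext (vecs {..<N}) = vecs (ksubs N k)"
proof -
  have "{S \<in> ksubs N k. S \<subseteq> {..<N}} = ksubs N k" by (auto simp: ksubs_def)
  then show ?thesis using ext_supp_space[of "{..<N}"] by (simp add: supp_space_full)
qed

lemma combination_in_subspace:
  assumes H: "subspace F H (func_space {..<N})" and A: "finite A"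
    and w: "\<And>p. p \<in> A \<Longrightarrow> w p \<in> H" "\<And>p. p \<in> A \<Longrightarrow> a p \<in> carrier F"
  shows "(\<lambda>j\<in>{..<N}. \<Oplus>p\<in>A. w p j \<otimes> a p) \<in> H"
  using A w
proof (induction A rule: finite_induct)
  case empty
  show ?case using V.subspaceD(2)[OF H] by (simp only: finsum_empty func_space_simps)
next
  case (insert p A)
  have wc: "w s j \<in> carrier F" if "s \<in> insert p A" "j < N" for s j
    using insert.prems(1)[OF that(1)] V.subspaceD(1)[OF H] that(2) by (auto simp: PiE_iff)
  have "a p \<odot>\<^bsub>func_space {..<N}\<^esub> w p \<oplus>\<^bsub>func_space {..<N}\<^esub> (\<lambda>j\<in>{..<N}. \<Oplus>p\<in>A. w p j \<otimes> a p) \<in> H"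
    using insert by (intro V.subspaceD(3,4)[OF H] insert.IH) auto
  also have "a p \<odot>\<^bsub>func_space {..<N}\<^esub> w p \<oplus>\<^bsub>func_space {..<N}\<^esub> (\<lambda>j\<in>{..<N}. \<Oplus>p\<in>A. w p j \<otimes> a p)
      = (\<lambda>j\<in>{..<N}. \<Oplus>p\<in>insert p A. w p j \<otimes> a p)"
    unfolding func_space_simps
  proof (rule restrict_ext)
    fix j assume j: "j \<in> {..<N}"
    have "(\<Oplus>p\<in>insert p A. w p j \<otimes> a p) = w p j \<otimes> a p \<oplus> (\<Oplus>p\<in>A. w p j \<otimes> a p)"
      using insert.hyps wc j insert.prems(2) by (intro finsum_insert) (auto intro!: Pi_I)
    then show "(\<lambda>i\<in>{..<N}. a p \<otimes> w p i) j \<oplus> (\<lambda>j\<in>{..<N}. \<Oplus>p\<in>A. w p j \<otimes> a p) j = (\<Oplus>p\<in>insert p A. w p j \<otimes> a p)"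
      using j wc[of p j] insert.prems(2)[of p] by (simp add: m_comm)
  qed
  finally show ?case .
qed

text \<open>
  The contraction of \<open>x\<close> with \<open>k - 1\<close> coordinates \<open>R\<close>, up to the signs of its entries. It lies in \<open>H\<close>
  because the minors with columns \<open>R\<close> and \<open>j\<close>, expanded along column \<open>j\<close>, are the entries of a
  combination of the rows.
\<close>

lemma contraction:
  assumes H: "subspace F H (func_space {..<N})" and x: "x \<in> ext H" and k: "1 \<le> k"
    and R: "R \<subseteq> {..<N}" "card R = k - 1"
  shows "\<exists>u\<in>H. (\<forall>j\<in>R. u j = \<zero>) \<and> (\<forall>j\<in>{..<N} - R. u j = \<zero> \<longleftrightarrow> x (insert j R) = \<zero>)"
proof -
  have Hc: "H \<subseteq> vecs {..<N}" using V.subspaceD(1)[OF H] by simp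
  have fR: "finite R" using R finite_subset by auto
  let ?l = "\<lambda>t. sorted_list_of_set R ! t"
  \<comment> \<open>The columns are those of \<open>R\<close> in increasing order, with
    \<open>j\<close> in the last position \<open>k - 1\<close>.\<close>
  define c where "c j t = (if t < k - 1 then ?l t else j)" for j t
  have Rk: "R \<in> ksubs N (k - 1)" using R by (simp add: ksubs_def)
  have kk: "{..<k} = insert (k - 1) {..<k - 1}" using k by auto
  have clt: "c j t < N" if "t < k" "j < N" for j t
    using sorted_nth_ksubs(2)[OF Rk] that by (auto simp: c_def)
  have ins: "insert j R \<in> ksubs N k" if "j \<in> {..<N} - R" for j
    using that R k fR by (auto simp: ksubs_def)
  have "\<exists>s. \<forall>v\<in>{..<k} \<rightarrow> vecs {..<N}. ring_det F k (\<lambda>i t. v i (c j t)) = perm_sign s \<otimes> wedge F k N v (insert j R)"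
    if j: "j \<in> {..<N} - R" for j
  proof (rule ring_det_sorted_columns[OF ins[OF j]])
    have im: "c j ` {..<k - 1} = R" using sorted_nth_image[OF Rk] by (auto simp: c_def image_def)
    then show "c j ` {..<k} = insert j R" unfolding kk by (auto simp: c_def)
    have "inj_on (c j) {..<k - 1}" using sorted_nth_inj[OF Rk] by (simp add: inj_on_def c_def)
    then show "inj_on (c j) {..<k}" unfolding kk using im j by (auto simp: c_def)
  qed
  then obtain s where s: "\<And>j v. j \<in> {..<N} - R \<Longrightarrow> v \<in> {..<k} \<rightarrow> vecs {..<N} \<Longrightarrow>
      ring_det F k (\<lambda>i t. v i (c j t)) = perm_sign (s j) \<otimes> wedge F k N v (insert j R)" by metis
  \<comment> \<open>The signs do not depend on \<open>x\<close>, so the contraction is linear in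
    \<open>x\<close>, and only wedges of vectors of \<open>H\<close> have to be checked.\<close>
  let ?u = "\<lambda>x. \<lambda>j\<in>{..<N}. if j \<in> R then \<zero> else perm_sign (s j) \<otimes> x (insert j R)"
  let ?Z = "{x \<in> vecs (ksubs N k). ?u x \<in> H}"
  have xc: "x (insert j R) \<in> carrier F" if "x \<in> vecs (ksubs N k)" "j < N" "j \<notin> R" for x j
    using that ins[of j] by auto
  have "subspace F ?Z (func_space (ksubs N k))"
  proof (rule L.subspaceI)
    have "?u (\<lambda>i\<in>ksubs N k. \<zero>) = (\<lambda>j\<in>{..<N}. \<zero>)" using ins by (intro restrict_ext) auto
    then show "\<zero>\<^bsub>func_space (ksubs N k)\<^esub> \<in> ?Z" using V.subspaceD(2)[OF H] by simp
  next
    fix y z assume yz: "y \<in> ?Z" "z \<in> ?Z"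
    have "?u (\<lambda>i\<in>ksubs N k. y i \<oplus> z i) = ?u y \<oplus>\<^bsub>func_space {..<N}\<^esub> ?u z"
      unfolding func_space_simps using ins yz xc by (intro restrict_ext) (auto simp: r_distr)
    then show "y \<oplus>\<^bsub>func_space (ksubs N k)\<^esub> z \<in> ?Z"
      using V.subspaceD(3)[OF H, of "?u y" "?u z"] yz by (auto simp del: restrict_apply)
  next
    fix a y assume ay: "a \<in> carrier F" "y \<in> ?Z"
    have "?u (\<lambda>i\<in>ksubs N k. a \<otimes> y i) = a \<odot>\<^bsub>func_space {..<N}\<^esub> ?u y"
      unfolding func_space_simps using ins ay xc by (intro restrict_ext) (auto simp: m_lcomm)
    then show "a \<odot>\<^bsub>func_space (ksubs N k)\<^esub> y \<in> ?Z"
      using V.subspaceD(4)[OF H ay(1), of "?u y"] ay by (auto simp del: restrict_apply)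
  qed auto
  moreover have "wedge F k N v \<in> ?Z" if v: "v \<in> {..<k} \<rightarrow> H" for v
  proof -
    have vc: "v \<in> {..<k} \<rightarrow> vecs {..<N}" using v Hc by (auto simp: Pi_iff)
    let ?a = "\<lambda>p. perm_sign p \<otimes> (\<Otimes>t\<in>{..<k} - {k - 1}. v (p t) (?l t))"
    have det: "ring_det F k (\<lambda>i t. v i (c j t)) = (\<Oplus>p\<in>{p. p permutes {..<k}}. v (p (k - 1)) j \<otimes> ?a p)"
      if j: "j < N" for j
    proof -
      have cl: "v i (c j t) \<in> carrier F" if "i < k" "t < k" for i t
        using entry_closed[OF vc that(1)] clt[OF that(2) j] by blast
      have "ring_det F k (\<lambda>i t. v i (c j t)) = ring_det F k (\<lambda>t i. v i (c j t))"
        using ring_det_transpose[of k "\<lambda>t i. v i (c j t)"] cl by simp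
      also have "\<dots> = (\<Oplus>p\<in>{p. p permutes {..<k}}. v (p (k - 1)) (c j (k - 1)) \<otimes>
          (perm_sign p \<otimes> (\<Otimes>t\<in>{..<k} - {k - 1}. v (p t) (c j t))))"
        using k cl by (intro ring_det_expand_row) auto
      also have "\<dots> = (\<Oplus>p\<in>{p. p permutes {..<k}}. v (p (k - 1)) j \<otimes> ?a p)"
      proof (rule finsum_cong'[OF refl])
        have tl: "?l t < N" if "t \<in> {..<k} - {k - 1}" for t using sorted_nth_ksubs(2)[OF Rk, of t] that by auto
        show "(\<lambda>p. v (p (k - 1)) j \<otimes> ?a p) \<in> {p. p permutes {..<k}} \<rightarrow> carrier F"
        proof (rule Pi_I)
          fix p assume "p \<in> {p. p permutes {..<k}}"
          then have p: "p permutes {..<k}" by simp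
          have "(\<Otimes>t\<in>{..<k} - {k - 1}. v (p t) (?l t)) \<in> carrier F"
            using entry_closed[OF vc permutes_lessThan[OF p]] tl by (intro finprod_closed) auto
          then show "v (p (k - 1)) j \<otimes> ?a p \<in> carrier F"
            using entry_closed[OF vc permutes_lessThan[OF p] j] k by simp
        qed
        fix p assume "p \<in> {p. p permutes {..<k}}"
        then have p: "p permutes {..<k}" by simp
        have "(\<Otimes>t\<in>{..<k} - {k - 1}. v (p t) (c j t)) = (\<Otimes>t\<in>{..<k} - {k - 1}. v (p t) (?l t))"
          using entry_closed[OF vc permutes_lessThan[OF p]] tl by (intro finprod_cong') (auto simp: c_def)
        then show "v (p (k - 1)) (c j (k - 1)) \<otimes> (perm_sign p \<otimes> (\<Otimes>t\<in>{..<k} - {k - 1}. v (p t) (c j t)))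
          = v (p (k - 1)) j \<otimes> ?a p" by (simp add: c_def)
      qed
      finally show ?thesis .
    qed
    have "(\<lambda>j\<in>{..<N}. \<Oplus>p\<in>{p. p permutes {..<k}}. v (p (k - 1)) j \<otimes> ?a p) \<in> H"
    proof (rule combination_in_subspace[OF H finite_perms])
      fix p assume "p \<in> {p. p permutes {..<k}}"
      then have p: "p permutes {..<k}" by simp
      show "v (p (k - 1)) \<in> H" using v permutes_lessThan[OF p, of "k - 1"] k by auto
      have tl: "?l t < N" if "t \<in> {..<k} - {k - 1}" for t using sorted_nth_ksubs(2)[OF Rk, of t] that by auto
      have "(\<Otimes>t\<in>{..<k} - {k - 1}. v (p t) (?l t)) \<in> carrier F"
        using entry_closed[OF vc permutes_lessThan[OF p]] tl by (intro finprod_closed) auto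
      then show "?a p \<in> carrier F" by simp
    qed
    also have "(\<lambda>j\<in>{..<N}. \<Oplus>p\<in>{p. p permutes {..<k}}. v (p (k - 1)) j \<otimes> ?a p) = ?u (wedge F k N v)"
    proof (rule restrict_ext)
      fix j assume j: "j \<in> {..<N}"
      have "ring_det F k (\<lambda>i t. v i (c j t)) = (if j \<in> R then \<zero> else perm_sign (s j) \<otimes> wedge F k N v (insert j R))"
      proof (cases "j \<in> R")
        case True
        then have "j \<in> ?l ` {..<k - 1}" using sorted_nth_image[OF Rk] by simp
        then obtain t where t: "t < k - 1" "j = ?l t" by auto
        \<comment> \<open>For \<open>j\<close> in \<open>R\<close> the last column repeats an
          earlier one, which is why the contraction vanishes on \<open>R\<close>.\<close>
        have "ring_det F k (\<lambda>i t. v i (c j t)) = \<zero>"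
          using t j entry_closed[OF vc] clt by (intro ring_det_equal_columns[of k _ t "k - 1"]) (auto simp: c_def)
        then show ?thesis using True by simp
      qed (use s[OF _ vc] j in simp)
      then show "(\<Oplus>p\<in>{p. p permutes {..<k}}. v (p (k - 1)) j \<otimes> ?a p) =
        (if j \<in> R then \<zero> else perm_sign (s j) \<otimes> wedge F k N v (insert j R))" using det j by simp
    qed
    finally show ?thesis using wedge_closed[OF vc] by blast
  qed
  ultimately have "ext H \<subseteq> ?Z" by (rule ext_minimal)
  then have u: "?u x \<in> H" "x \<in> vecs (ksubs N k)" using x by auto
  have sgn: "perm_sign p \<otimes> a = \<zero> \<longleftrightarrow> a = \<zero>" if "a \<in> carrier F" for p a
    using that by (metis perm_sign_closed integral_iff perm_sign_square one_not_zero r_null)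
  show ?thesis
    using u(1) R sgn xc[OF u(2)] by (intro bexI[of _ "?u x"]) auto
qed

text \<open>Some coordinate \<open>j\<close> is nonzero on a nonzero vector of \<open>A\<close>. The
  vectors of \<open>A\<close> that vanish at \<open>j\<close> form a subspace of smaller dimension;
  its pivots together with \<open>j\<close> suffice. A vector of \<open>A\<close> is thus determined
  by its pivot coordinates.\<close>

lemma pivots_exist:
  assumes "subspace F A (func_space {..<N})"
  shows "\<exists>P\<subseteq>{..<N}. card P \<le> V.sdim A \<and> (\<forall>u\<in>A. (\<forall>p\<in>P. u p = \<zero>) \<longrightarrow> u = (\<lambda>j\<in>{..<N}. \<zero>))"
  using assms
proof (induction "V.sdim A" arbitrary: A rule: less_induct)
  case less
  show ?case
  proof (cases "A = {\<lambda>j\<in>{..<N}. \<zero>}")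
    case True
    then show ?thesis by (intro exI[of _ "{}"]) auto
  next
    case False
    then obtain u where u: "u \<in> A" "u \<noteq> (\<lambda>j\<in>{..<N}. \<zero>)" using V.subspaceD(2)[OF less.prems] by auto
    have uc: "u \<in> vecs {..<N}" using u V.subspaceD(1)[OF less.prems] by auto
    have "\<exists>j<N. u j \<noteq> \<zero>"
    proof (rule ccontr)
      assume "\<not> ?thesis"
      then have "u = (\<lambda>j\<in>{..<N}. \<zero>)" by (intro PiE_ext[OF uc, of "\<lambda>j\<in>{..<N}. \<zero>"]) auto
      then show False using u by simp
    qed
    then obtain j where j: "j < N" "u j \<noteq> \<zero>" by auto
    let ?A = "{x \<in> A. x j = \<zero>}"
    note a = V.subspaceD[OF less.prems]
    have sA: "subspace F ?A (func_space {..<N})"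
      by (rule V.subspaceI) (use a j in auto)
    have "?A \<subset> A" using u j by auto
    then have lt: "V.sdim ?A < V.sdim A"
      using V.sdim_mono[OF sA less.prems] V.sdim_eq_imp_eq[OF sA less.prems] by (metis (lifting) le_neq_implies_less psubset_eq)
    obtain P where P: "P \<subseteq> {..<N}" "card P \<le> V.sdim ?A" "\<forall>u\<in>?A. (\<forall>p\<in>P. u p = \<zero>) \<longrightarrow> u = (\<lambda>j\<in>{..<N}. \<zero>)"
      using less.hyps[OF lt sA] by blast
    have "card (insert j P) \<le> V.sdim A" using P lt card_insert_le_m1[of "Suc (V.sdim ?A)" P j] by simp
    then show ?thesis using P j by (intro exI[of _ "insert j P"]) auto
  qed
qed

text \<open>
  Contractions show that an element of the intersection is determined by its coordinates inside the
  pivot sets of the subspaces \<open>H \<inter> E B\<close>: a coordinate outside is recovered by exchanging one index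
  for pivots.
\<close>

lemma card_ext_Int_le:
  assumes H: "subspace F H (func_space {..<N})" and k: "2 \<le> k"
    and \<B>: "finite \<B>" "\<And>B B'. B \<in> \<B> \<Longrightarrow> B' \<in> \<B> \<Longrightarrow> B \<noteq> B' \<Longrightarrow> B \<inter> B' = {}"
  shows "card (ext H \<inter> supp_space (ksubs N k) {S \<in> ksubs N k. \<exists>B\<in>\<B>. S \<subseteq> B})
    \<le> q ^ (\<Sum>B\<in>\<B>. V.sdim (H \<inter> E B) choose k)"
proof -
  let ?X = "ext H \<inter> supp_space (ksubs N k) {S \<in> ksubs N k. \<exists>B\<in>\<B>. S \<subseteq> B}"
  have Hc: "H \<subseteq> vecs {..<N}" using V.subspaceD(1)[OF H] by simp
  have sX: "subspace F ?X (func_space (ksubs N k))"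
    by (intro L.subspace_Int subspace_ext[OF Hc] subspace_supp_space) simp
  have sE: "subspace F (H \<inter> E B) (func_space {..<N})" for B
    by (intro V.subspace_Int H subspace_supp_space) simp
  obtain P where PN: "\<And>B. P B \<subseteq> {..<N}" and P: "\<And>B. finite (P B)" "\<And>B. card (P B) \<le> V.sdim (H \<inter> E B)"
    "\<And>B u. u \<in> H \<inter> E B \<Longrightarrow> (\<And>p. p \<in> P B \<Longrightarrow> u p = \<zero>) \<Longrightarrow> u = (\<lambda>j\<in>{..<N}. \<zero>)"
  proof -
    have "\<forall>B. \<exists>P\<subseteq>{..<N}. card P \<le> V.sdim (H \<inter> E B) \<and>
        (\<forall>u\<in>H \<inter> E B. (\<forall>p\<in>P. u p = \<zero>) \<longrightarrow> u = (\<lambda>j\<in>{..<N}. \<zero>))"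
      using pivots_exist[OF sE] by blast
    then obtain P where P: "\<And>B. P B \<subseteq> {..<N} \<and> card (P B) \<le> V.sdim (H \<inter> E B) \<and>
        (\<forall>u\<in>H \<inter> E B. (\<forall>p\<in>P B. u p = \<zero>) \<longrightarrow> u = (\<lambda>j\<in>{..<N}. \<zero>))" by metis
    show ?thesis by (rule that[of P]) (use P finite_subset[of "P _" "{..<N}"] in blast)+
  qed
  let ?K = "\<lambda>B. {S. S \<subseteq> P B \<and> card S = k}"
  let ?\<K> = "(\<Union>B\<in>\<B>. ?K B) \<inter> ksubs N k"
  have zero: "x S = \<zero>" if x: "x \<in> ?X" and xK: "\<And>S. S \<in> ?\<K> \<Longrightarrow> x S = \<zero>" and S: "S \<in> ksubs N k" for x S
    using S
  \<comment> \<open>The measure is the number of indices of \<open>S\<close> that are not pivots of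
    its block. The union merely names the pivot set of the block containing \<open>S\<close>, which
    is unique because the blocks are disjoint and \<open>S\<close> is nonempty.\<close>
  proof (induction "card (S - \<Union>(P ` {B \<in> \<B>. S \<subseteq> B}))" arbitrary: S rule: less_induct)
    case less
    show ?case
    proof (cases "\<exists>B\<in>\<B>. S \<subseteq> B")
      case False
      then show ?thesis using x less.prems by (auto simp: supp_space_def)
    next
      case True
      then obtain B where B: "B \<in> \<B>" "S \<subseteq> B" by blast
      have uniq: "B' = B" if "B' \<in> \<B>" "T \<subseteq> B'" "T \<inter> B \<noteq> {}" for B' T
        using \<B>(2)[OF that(1) B(1)] that(2,3) by blast
      have blk: "{B' \<in> \<B>. T \<subseteq> B'} = {B}" if "T \<subseteq> B" "T \<noteq> {}" for T
        using uniq[of _ T] that B by blast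
      have fS: "finite S" using ksubs_finite[OF less.prems] .
      have cS: "card S = k" "S \<subseteq> {..<N}" using less.prems by (auto simp: ksubs_def)
      have S0: "S \<noteq> {}" using cS k by auto
      show ?thesis
      proof (cases "S \<subseteq> P B")
        case True
        then show ?thesis using xK[of S] B less.prems cS by blast
      next
        case False
        then obtain j where j: "j \<in> S" "j \<notin> P B" by blast
        let ?R = "S - {j}"
        have R: "?R \<subseteq> {..<N}" "card ?R = k - 1" using cS fS j by auto
        have R0: "?R \<noteq> {}" using R(2) k by (metis card.empty One_nat_def Suc_1 diff_is_0_eq not_less_eq_eq)
        obtain u where u: "u \<in> H" "\<forall>j\<in>?R. u j = \<zero>"
          "\<forall>j\<in>{..<N} - ?R. u j = \<zero> \<longleftrightarrow> x (insert j ?R) = \<zero>"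
          using contraction[OF H _ _ R, of x] x k by auto
        have insk: "insert i ?R \<in> ksubs N k" if "i \<in> {..<N} - ?R" for i
          using that R fS k by (auto simp: ksubs_def)
        \<comment> \<open>The contraction is supported in \<open>B\<close>: since
          \<open>2 \<le> k\<close>, the set \<open>?R\<close> is a nonempty part of
          \<open>B\<close>, so adding an index outside \<open>B\<close> yields a set inside no
          block, where \<open>x\<close> vanishes.\<close>
        have uE: "u i = \<zero>" if i: "i \<in> {..<N} - B" for i
        proof -
          have iR: "i \<in> {..<N} - ?R" using i B by blast
          have "\<not> (\<exists>B'\<in>\<B>. insert i ?R \<subseteq> B')"
          proof
            assume "\<exists>B'\<in>\<B>. insert i ?R \<subseteq> B'"
            then obtain B' where B': "B' \<in> \<B>" "insert i ?R \<subseteq> B'" by blast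
            have "insert i ?R \<inter> B \<noteq> {}" using R0 B by blast
            from uniq[OF B' this] show False using B' i by blast
          qed
          then have "x (insert i ?R) = \<zero>" using x insk[OF iR] by (auto simp: supp_space_def)
          then show ?thesis using u(3) iR by blast
        qed
        then have uHE: "u \<in> H \<inter> E B" using u(1) Hc by (auto simp: supp_space_def)
        \<comment> \<open>Exchanging the non-pivot \<open>j\<close> for a pivot lowers the measure,
          so the induction hypothesis applies. Then \<open>u\<close> vanishes at all pivots of
          \<open>H \<inter> E B\<close>, hence everywhere, in particular at
          \<open>j\<close>.\<close>
        have "u p = \<zero>" if p: "p \<in> P B" for p
        proof (cases "p \<in> {..<N} - ?R")
          case pR: True
          show ?thesis
          proof (cases "p \<in> B")
            case True
            have ne: "insert p ?R \<subseteq> B" "insert p ?R \<noteq> {}" using True B by auto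
            have "insert p ?R - P B = (S - P B) - {j}" using p by auto
            then have ps: "insert p ?R - P B \<subset> S - P B" using j by (simp only:) blast
            have "card (insert p ?R - P B) < card (S - P B)"
              by (rule psubset_card_mono[OF finite_Diff[OF fS] ps])
            then have "x (insert p ?R) = \<zero>"
              using less.hyps[OF _ insk[OF pR]] blk[OF ne] blk[OF B(2) S0] by simp
            then show ?thesis using u(3) pR by blast
          next
            case False
            then show ?thesis using uE pR by blast
          qed
        next
          case False
          then show ?thesis using u(2) p PN by blast
        qed
        then have "u = (\<lambda>j\<in>{..<N}. \<zero>)" by (rule P(3)[OF uHE])
        then have "u j = \<zero>" using j cS by auto
        moreover have "j \<in> {..<N} - ?R" using j cS by auto
        ultimately have "x (insert j ?R) = \<zero>" using u(3) by blast
        then show ?thesis using j by (simp add: insert_absorb)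
      qed
    qed
  qed
  have "inj_on (\<lambda>x. restrict x ?\<K>) ?X"
  proof (rule inj_onI)
    fix x y assume x: "x \<in> ?X" and y: "y \<in> ?X" and e: "restrict x ?\<K> = restrict y ?\<K>"
    have xy: "x \<in> vecs (ksubs N k)" "y \<in> vecs (ksubs N k)" using x y by (auto simp: supp_space_def)
    let ?d = "\<lambda>S\<in>ksubs N k. x S \<oplus> (\<lambda>S\<in>ksubs N k. (\<ominus> \<one>) \<otimes> y S) S"
    have "(\<ominus> \<one>) \<odot>\<^bsub>func_space (ksubs N k)\<^esub> y \<in> ?X" using y by (intro L.subspaceD(4)[OF sX]) auto
    from L.subspaceD(3)[OF sX x this] have d: "?d \<in> ?X" unfolding func_space_simps .
    have ds: "?d S = x S \<ominus> y S" if "S \<in> ksubs N k" for S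
      using that PiE_mem[OF xy(2) that] by (simp add: l_minus a_minus_def)
    have "?d S = \<zero>" if "S \<in> ?\<K>" for S
    proof -
      have "x S = y S" using fun_cong[OF e, of S] that by simp
      moreover have Sk: "S \<in> ksubs N k" using that by blast
      ultimately show ?thesis using ds[OF Sk] PiE_mem[OF xy(2) Sk] by (simp add: a_minus_def r_neg)
    qed
    from zero[OF d this] have z: "x S \<ominus> y S = \<zero>" if "S \<in> ksubs N k" for S using ds[OF that] that by metis
    show "x = y"
    proof (rule PiE_ext[OF xy])
      fix S assume S: "S \<in> ksubs N k"
      show "x S = y S" using z[OF S] PiE_mem[OF xy(1) S] PiE_mem[OF xy(2) S] by simp
    qed
  qed
  moreover have "(\<lambda>x. restrict x ?\<K>) ` ?X \<subseteq> vecs ?\<K>"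
  proof
    fix z assume "z \<in> (\<lambda>x. restrict x ?\<K>) ` ?X"
    then obtain x where x: "x \<in> ?X" "z = restrict x ?\<K>" by blast
    have "x \<in> vecs (ksubs N k)" using x by (auto simp: supp_space_def)
    then show "z \<in> vecs ?\<K>" unfolding x(2) by (auto simp: PiE_iff)
  qed
  moreover have fK: "finite ?\<K>" by simp
  then have "finite (vecs ?\<K>)" using finite_scalars by (intro finite_PiE) auto
  ultimately have "card ?X \<le> card (vecs ?\<K>)" by (rule card_inj_on_le)
  also have "\<dots> = q ^ card ?\<K>" using fK by (simp add: card_PiE)
  also have "\<dots> \<le> q ^ (\<Sum>B\<in>\<B>. V.sdim (H \<inter> E B) choose k)"
  proof (rule power_increasing)
    have fKB: "finite (?K B)" for B by (rule finite_subset[of _ "Pow (P B)"]) (use P(1) in auto)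
    have "card ?\<K> \<le> card (\<Union>B\<in>\<B>. ?K B)" using \<B>(1) fKB by (intro card_mono) auto
    also have "\<dots> \<le> (\<Sum>B\<in>\<B>. card (?K B))" by (rule card_UN_le[OF \<B>(1)])
    also have "\<dots> \<le> (\<Sum>B\<in>\<B>. V.sdim (H \<inter> E B) choose k)"
      using P(1,2) by (intro sum_mono) (simp add: n_subsets binomial_right_mono)
    finally show "card ?\<K> \<le> (\<Sum>B\<in>\<B>. V.sdim (H \<inter> E B) choose k)" .
    show "1 \<le> q" using V.q_ge_2 by simp
  qed
  finally show ?thesis .
qed

end

end

section \<open>Subspaces in direct sum\<close>

context finite_vectorspace
begin

lemma subspace_image_linear:
  assumes "linear_map K V W T" "subspace K H V" "finite_vectorspace K W"
  shows "subspace K (T ` H) W"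
proof -
  interpret W: finite_vectorspace K W by fact
  interpret T: linear_map K V W T by fact
  have "T ` H = T ` span H" by (simp add: span_subspace[OF assms(2)])
  also have "\<dots> = W.module.span (T ` H)"
    by (rule span_image_linear[OF assms(1) subspaceD(1)[OF assms(2)] assms(3)])
  also have "subspace K \<dots> W" using subspaceD(1)[OF assms(2)] by (intro W.span_is_subspace) auto
  finally show ?thesis .
qed

text \<open>Directness of the sum is encoded by size: the span of \<open>card T\<close> subspaces of
  dimension \<open>r\<close> has at most \<open>q ^ (r * card T)\<close> elements, with equality
  exactly for direct sums.\<close>

definition direct :: "nat \<Rightarrow> 'c set set \<Rightarrow> bool" where
  "direct r T \<longleftrightarrow> finite T \<and> (\<forall>H\<in>T. subspace K H V \<and> sdim H = r) \<and> card (span (\<Union>T)) = q ^ (r * card T)"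

lemma direct_Union_carrier: "direct r T \<Longrightarrow> \<Union>T \<subseteq> carrier V"
  using subspaceD(1) by (fastforce simp: direct_def)

lemma span_insert_zero: "X \<subseteq> carrier V \<Longrightarrow> span (insert \<zero>\<^bsub>V\<^esub> X) = span X"
proof
  assume X: "X \<subseteq> carrier V"
  show "span (insert \<zero>\<^bsub>V\<^esub> X) \<subseteq> span X"
    using in_own_span[OF X] span_zero[of X] by (intro span_minimal span_is_subspace X) auto
  show "span X \<subseteq> span (insert \<zero>\<^bsub>V\<^esub> X)" by (intro span_is_monotone) auto
qed

lemma spanning_tuple_exists:
  assumes "subspace K H V"
  shows "\<exists>b. b \<in> {..<sdim H} \<rightarrow> H \<and> span (b ` {..<sdim H}) = H"
proof -
  obtain b where b: "b \<in> {..<sdim H} \<rightarrow> H" "span ({\<zero>\<^bsub>V\<^esub>} \<union> b ` {..<sdim H}) = H"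
    using spanning_family_exists[OF subspace_zero assms] subspaceD(2)[OF assms] by (auto simp: sdim_zero)
  moreover have "b ` {..<sdim H} \<subseteq> carrier V" using b(1) subspaceD(1)[OF assms] by auto
  ultimately show ?thesis using span_insert_zero by auto
qed

end

context finite_scalar_field
begin

lemma finite_vectorspace_coord: "finite_vectorspace F (func_space {..<N::nat})"
  by (rule finite_vectorspace_func_space[OF finite_lessThan])

lemma finite_vectorspace_ksubs: "finite_vectorspace F (func_space (ksubs N k))"
  by (rule finite_vectorspace_func_space[OF finite_ksubs])

lemma blocks_disjoint: "l \<noteq> l' \<Longrightarrow> {l * r..<Suc l * r} \<inter> {l' * r..<Suc l' * r} = {}" for l :: nat
proof (rule ccontr)
  assume ne: "l \<noteq> l'" and "{l * r..<Suc l * r} \<inter> {l' * r..<Suc l' * r} \<noteq> {}"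
  then obtain j where j: "j \<in> {l * r..<Suc l * r}" "j \<in> {l' * r..<Suc l' * r}" by blast
  then have "l * r < Suc l' * r" "l' * r < Suc l * r" unfolding atLeastLessThan_iff by linarith+
  then show False using ne by (simp only: mult_less_cancel2) linarith
qed

section \<open>Transport of exterior powers by an automorphism of the coordinate space\<close>

context
  fixes g and k N :: nat
  assumes g: "g \<in> lin_maps {..<N} {..<N}" and surj: "g ` vecs {..<N} = vecs {..<N}"
begin

interpretation V: finite_vectorspace F "func_space {..<N}" by (rule finite_vectorspace_coord)
interpretation L: finite_vectorspace F "func_space (ksubs N k)" by (rule finite_vectorspace_ksubs)

lemma map_inj: "inj_on g (vecs {..<N})"
  using finite_surj_inj[of "vecs {..<N}" g] V.finite_carrier surj by simp

text \<open>The wedges that generate the right side are the images of those that generate the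
  exterior power of \<open>H\<close>, because preimages in \<open>H\<close> can be chosen for each
  argument.\<close>

lemma ext_map_image:
  assumes H: "H \<subseteq> vecs {..<N}"
  shows "ext_map k N g ` exterior_power_of F k N H = exterior_power_of F k N (g ` H)"
proof -
  let ?G = "ext_map k N g"
  have "?G ` (wedge F k N ` ({..<k} \<rightarrow> H)) = wedge F k N ` ({..<k} \<rightarrow> g ` H)"
  proof
    have vc: "v \<in> {..<k} \<rightarrow> vecs {..<N}" if "v \<in> {..<k} \<rightarrow> H" for v using that H by (auto simp: Pi_iff)
    show "?G ` (wedge F k N ` ({..<k} \<rightarrow> H)) \<subseteq> wedge F k N ` ({..<k} \<rightarrow> g ` H)"
    proof
      fix y assume "y \<in> ?G ` (wedge F k N ` ({..<k} \<rightarrow> H))"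
      then obtain v where v: "v \<in> {..<k} \<rightarrow> H" "y = ?G (wedge F k N v)" by blast
      then have "(\<lambda>i. g (v i)) \<in> {..<k} \<rightarrow> g ` H" by (simp add: Pi_iff)
      then show "y \<in> wedge F k N ` ({..<k} \<rightarrow> g ` H)"
        unfolding v(2) ext_map_wedge[OF g vc[OF v(1)]] by (rule imageI)
    qed
    show "wedge F k N ` ({..<k} \<rightarrow> g ` H) \<subseteq> ?G ` (wedge F k N ` ({..<k} \<rightarrow> H))"
    proof (intro image_subsetI)
      fix u assume u: "u \<in> {..<k} \<rightarrow> g ` H"
      have "\<forall>i\<in>{..<k}. \<exists>x. x \<in> H \<and> u i = g x"
      proof
        fix i assume "i \<in> {..<k}"
        with u have "u i \<in> g ` H" by (rule Pi_mem)
        then show "\<exists>x. x \<in> H \<and> u i = g x" by blast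
      qed
      from bchoice[OF this] obtain v where v: "\<forall>i\<in>{..<k}. v i \<in> H \<and> u i = g (v i)" by blast
      then have vH: "v \<in> {..<k} \<rightarrow> H" by (simp add: Pi_iff)
      have "wedge F k N u = wedge F k N (\<lambda>i. g (v i))"
        by (rule wedge_cong[OF _ map_rows[OF g vc[OF vH]]]) (use v in simp)
      also have "\<dots> = ?G (wedge F k N v)" by (rule ext_map_wedge[OF g vc[OF vH], symmetric])
      finally show "wedge F k N u \<in> ?G ` (wedge F k N ` ({..<k} \<rightarrow> H))" using vH by blast
    qed
  qed
  then show ?thesis unfolding exterior_power_of_eq
    using L.span_image_linear[OF lin_mapsD(4)[OF ext_map_lin_maps[OF g]] wedges_closed[OF H] finite_vectorspace_ksubs]
    by simp
qed

lemma ext_map_surj: "ext_map k N g ` vecs (ksubs N k) = vecs (ksubs N k)"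
  using ext_map_image[of "vecs {..<N}"] surj by (simp add: ext_full)

text \<open>A surjective self-map of a finite set is injective; surjectivity holds because the
  exterior power of the whole space is everything.\<close>

lemma ext_map_inj: "inj_on (ext_map k N g) (vecs (ksubs N k))"
  using finite_surj_inj[of "vecs (ksubs N k)" "ext_map k N g"] L.finite_carrier ext_map_surj by simp

lemma card_span_ext_map:
  assumes "X \<subseteq> vecs (ksubs N k)"
  shows "card (L.module.span (ext_map k N g ` X)) = card (L.module.span X)"
proof -
  have X: "X \<subseteq> carrier (func_space (ksubs N k))" using assms by simp
  have "L.module.span (ext_map k N g ` X) = ext_map k N g ` L.module.span X"
    by (rule L.span_image_linear[OF lin_mapsD(4)[OF ext_map_lin_maps[OF g]] X finite_vectorspace_ksubs, symmetric])
  moreover have "inj_on (ext_map k N g) (L.module.span X)"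
    using ext_map_inj L.subspaceD(1)[OF L.span_is_subspace[OF X], simplified] by (rule inj_on_subset)
  ultimately show ?thesis by (simp add: card_image)
qed

end

section \<open>Exterior powers of direct families\<close>

context
  fixes N k :: nat
begin

interpretation V: finite_vectorspace F "func_space {..<N}" by (rule finite_vectorspace_coord)
interpretation L: finite_vectorspace F "func_space (ksubs N k)" by (rule finite_vectorspace_ksubs)

lemma sdim_coord: "V.sdim (vecs {..<N}) = N"
  using V.subspace_carrier by (intro V.sdim_eqI) (auto simp: card_PiE)

text \<open>Spanning tuples of the members, followed by vectors completing their span, are
  \<open>N\<close> vectors spanning the whole space. The linear map that sends the unit vectors to
  them is onto and carries consecutive blocks of \<open>r\<close> coordinates to the
  members.\<close>

lemma adapted_map_exists:
  assumes T: "V.direct r T" and r: "1 \<le> r"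
  obtains g e where "g \<in> lin_maps {..<N} {..<N}" "g ` vecs {..<N} = vecs {..<N}"
    "bij_betw e {..<card T} T" "r * card T \<le> N"
    "\<And>l. l < card T \<Longrightarrow> g ` supp_space {..<N} {l * r..<Suc l * r} = e l"
proof -
  have fT: "finite T" and sub: "\<And>H. H \<in> T \<Longrightarrow> subspace F H (func_space {..<N}) \<and> V.sdim H = r"
    and cT: "card (V.module.span (\<Union>T)) = q ^ (r * card T)" using T by (auto simp: V.direct_def)
  let ?i = "card T" and ?W = "V.module.span (\<Union>T)"
  obtain e where e: "bij_betw e {..<?i} T" using ex_bij_betw_nat_finite[OF fT] by (auto simp: lessThan_atLeast0)
  have eT: "e l \<in> T" if "l < ?i" for l using e that by (auto simp: bij_betw_def)
  note Uc = V.direct_Union_carrier[OF T]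
  have sW: "subspace F ?W (func_space {..<N})" by (rule V.span_is_subspace[OF Uc])
  have dW: "V.sdim ?W = r * ?i" by (rule V.sdim_eqI[OF sW cT])
  have iN: "r * ?i \<le> N" using V.sdim_mono[OF sW V.subspace_carrier] V.subspaceD(1)[OF sW] dW sdim_coord by simp
  have "\<forall>l. \<exists>b. l < ?i \<longrightarrow> b \<in> {..<r} \<rightarrow> e l \<and> V.module.span (b ` {..<r}) = e l"
    using V.spanning_tuple_exists sub eT by metis
  then obtain b where b: "\<And>l. l < ?i \<Longrightarrow> b l \<in> {..<r} \<rightarrow> e l \<and> V.module.span (b l ` {..<r}) = e l" by metis
  obtain c where c: "c \<in> {..<N - r * ?i} \<rightarrow> vecs {..<N}" "V.module.span (?W \<union> c ` {..<N - r * ?i}) = vecs {..<N}"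
    using V.spanning_family_exists[OF sW V.subspace_carrier V.subspaceD(1)[OF sW]] dW sdim_coord by auto
  \<comment> \<open>Position \<open>j\<close> receives vector number \<open>j mod r\<close> of
    member number \<open>j div r\<close>; the positions after the last block are filled by the
    completing vectors.\<close>
  define h where "h j = (if j < r * ?i then b (j div r) (j mod r) else c (j - r * ?i))" for j
  have blk: "h ` {l * r..<Suc l * r} = b l ` {..<r}" if l: "l < ?i" for l
  proof -
    have "Suc l * r \<le> ?i * r" using l by (intro mult_right_mono) auto
    then have "h j = b l (j - l * r)" if "l * r \<le> j" "j < Suc l * r" for j
    proof -
      have "j div r = l" using that r by (intro div_nat_eqI) (auto simp: mult.commute)
      moreover have "j mod r = j - l * r" using \<open>j div r = l\<close> by (metis minus_div_mult_eq_mod)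
      ultimately show ?thesis using that \<open>Suc l * r \<le> ?i * r\<close> by (simp add: h_def mult.commute)
    qed
    then have "h ` {l * r..<Suc l * r} = (\<lambda>j. b l (j - l * r)) ` {l * r..<Suc l * r}" by (intro image_cong) auto
    also have "\<dots> = b l ` ((\<lambda>j. j - l * r) ` {l * r..<Suc l * r})" by (simp add: image_image)
    also have "(\<lambda>j. j - l * r) ` {l * r..<Suc l * r} = {..<r}"
    proof
      show "{..<r} \<subseteq> (\<lambda>j. j - l * r) ` {l * r..<Suc l * r}"
      proof
        fix t assume "t \<in> {..<r}"
        then show "t \<in> (\<lambda>j. j - l * r) ` {l * r..<Suc l * r}" by (intro image_eqI[of _ _ "l * r + t"]) auto
      qed
    qed auto
    finally show ?thesis .
  qed
  have tail: "h ` {r * ?i..<N} = c ` {..<N - r * ?i}"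
  proof -
    have "h ` {r * ?i..<N} = (\<lambda>j. c (j - r * ?i)) ` {r * ?i..<N}" by (intro image_cong) (auto simp: h_def)
    also have "\<dots> = c ` ((\<lambda>j. j - r * ?i) ` {r * ?i..<N})" by (simp add: image_image)
    also have "(\<lambda>j. j - r * ?i) ` {r * ?i..<N} = {..<N - r * ?i}"
    proof
      show "{..<N - r * ?i} \<subseteq> (\<lambda>j. j - r * ?i) ` {r * ?i..<N}"
      proof
        fix t assume "t \<in> {..<N - r * ?i}"
        then show "t \<in> (\<lambda>j. j - r * ?i) ` {r * ?i..<N}" by (intro image_eqI[of _ _ "r * ?i + t"]) auto
      qed
    qed auto
    finally show ?thesis .
  qed
  have hc: "h j \<in> vecs {..<N}" if "j < N" for j
  proof (cases "j < r * ?i")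
    case True
    then have l: "j div r < ?i" using r by (simp add: less_mult_imp_div_less mult.commute)
    have "b (j div r) (j mod r) \<in> e (j div r)" using b[OF l] r by auto
    then show ?thesis using V.subspaceD(1)[of "e (j div r)"] sub[OF eT[OF l]] True by (auto simp: h_def)
  next
    case False
    then have "j - r * ?i < N - r * ?i" using that by simp
    then show ?thesis using c(1) False by (auto simp: h_def Pi_iff simp del: PiE_iff)
  qed
  let ?g = "lin_ext {..<N} {..<N} h"
  have hP: "h \<in> {..<N} \<rightarrow> vecs {..<N}" using hc by simp
  have g: "?g \<in> lin_maps {..<N} {..<N}" by (rule lin_ext_in_lin_maps[OF finite_lessThan hP])
  have gu: "?g (unit_vec {..<N} j) = h j" if "j < N" for j
    using lin_ext_unit_vec[OF finite_lessThan hP, of j] that by simp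
  have gE: "?g ` supp_space {..<N} B = V.module.span (h ` B)" if B: "B \<subseteq> {..<N}" for B
  proof -
    have "?g ` supp_space {..<N} B = ?g ` V.module.span (unit_vec {..<N} ` B)"
      using span_unit_vecs[OF finite_lessThan B] by simp
    also have "\<dots> = V.module.span (?g ` (unit_vec {..<N} ` B))"
      by (rule V.span_image_linear[OF lin_mapsD(4)[OF g] _ finite_vectorspace_coord]) (simp add: image_subset_iff)
    also have "?g ` (unit_vec {..<N} ` B) = h ` B"
      unfolding image_image using B gu by (intro image_cong) auto
    finally show ?thesis .
  qed
  have le: "Suc l * r \<le> N" if "l < ?i" for l
  proof -
    have "Suc l * r \<le> ?i * r" using that by (intro mult_right_mono) auto
    then show ?thesis using iN by (simp add: mult.commute)
  qed
  have gl: "?g ` supp_space {..<N} {l * r..<Suc l * r} = e l" if "l < ?i" for l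
  proof -
    have "{l * r..<Suc l * r} \<subseteq> {..<N}" using le[OF that] by auto
    then show ?thesis using gE blk[OF that] b[OF that] by simp
  qed
  have "vecs {..<N} \<subseteq> ?g ` vecs {..<N}"
  proof -
    have im: "subspace F (?g ` vecs {..<N}) (func_space {..<N})"
      using V.subspace_image_linear[OF lin_mapsD(4)[OF g] V.subspace_carrier finite_vectorspace_coord] by simp
    have "H \<subseteq> ?g ` vecs {..<N}" if "H \<in> T" for H
    proof -
      obtain l where l: "l < ?i" "H = e l" using e \<open>H \<in> T\<close> by (auto simp: bij_betw_def)
      then show ?thesis using gl[OF l(1)] by (auto simp: supp_space_def)
    qed
    then have 1: "?W \<subseteq> ?g ` vecs {..<N}" by (intro V.span_minimal im) blast
    have "c ` {..<N - r * ?i} \<subseteq> ?g ` vecs {..<N}"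
      unfolding tail[symmetric] using gu by (intro image_subsetI) (metis atLeastLessThan_iff imageI unit_vec_closed)
    then show ?thesis using 1 c(2) V.span_minimal[OF _ im, of "?W \<union> c ` {..<N - r * ?i}"] by simp
  qed
  moreover have "?g ` vecs {..<N} \<subseteq> vecs {..<N}" using lin_mapsD(1)[OF g] by (intro image_subsetI)
  ultimately have "?g ` vecs {..<N} = vecs {..<N}" by blast
  then show thesis by (rule that[OF g _ e iN gl])
qed

text \<open>The basis vectors obtained are those whose index set lies inside one block. Since
  \<open>1 \<le> k\<close>, no such set lies in two disjoint blocks, so the numbers
  \<open>r choose k\<close> of the blocks add up.\<close>

lemma card_span_ext_blocks:
  assumes i: "r * i \<le> N" and k: "1 \<le> k"
  defines "\<S> \<equiv> {S \<in> ksubs N k. \<exists>B\<in>(\<lambda>l. {l * r..<Suc l * r}) ` {..<i}. S \<subseteq> B}"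
  shows "L.module.span (\<Union>l<i. exterior_power_of F k N (supp_space {..<N} {l * r..<Suc l * r})) = supp_space (ksubs N k) \<S>"
    and "card (supp_space (ksubs N k) \<S>) = q ^ (i * (r choose k))"
proof -
  let ?B = "\<lambda>l. {l * r..<Suc l * r}"
  have BN: "?B l \<subseteq> {..<N}" if "l < i" for l
  proof -
    have "Suc l * r \<le> i * r" using that by (intro mult_right_mono) auto
    then show ?thesis using i by (auto simp: mult.commute)
  qed
  have S_eq: "\<S> = (\<Union>l<i. {S \<in> ksubs N k. S \<subseteq> ?B l})" by (auto simp: \<S>_def)
  have ext_l: "exterior_power_of F k N (supp_space {..<N} (?B l)) = supp_space (ksubs N k) {S \<in> ksubs N k. S \<subseteq> ?B l}"
    if "l < i" for l using ext_supp_space[OF BN[OF that]] .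
  let ?X = "\<Union>l<i. exterior_power_of F k N (supp_space {..<N} (?B l))"
  have Xc: "?X \<subseteq> carrier (func_space (ksubs N k))"
    using ext_l by (auto simp: supp_space_def)
  show "L.module.span ?X = supp_space (ksubs N k) \<S>"
  proof
    show "L.module.span ?X \<subseteq> supp_space (ksubs N k) \<S>"
    proof (intro L.span_minimal subspace_supp_space finite_ksubs UN_least)
      fix l assume l: "l \<in> {..<i}"
      then show "exterior_power_of F k N (supp_space {..<N} (?B l)) \<subseteq> supp_space (ksubs N k) \<S>"
        using ext_l[of l] by (auto simp: supp_space_def S_eq)
    qed
    show "supp_space (ksubs N k) \<S> \<subseteq> L.module.span ?X"
    proof (rule supp_space_subset[OF finite_ksubs L.span_is_subspace[OF Xc]])
      show "\<S> \<subseteq> ksubs N k" by (auto simp: \<S>_def)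
      fix S assume "S \<in> \<S>"
      then obtain l where l: "l < i" "S \<in> {S \<in> ksubs N k. S \<subseteq> ?B l}" unfolding S_eq by blast
      then have "unit_vec (ksubs N k) S \<in> exterior_power_of F k N (supp_space {..<N} (?B l))"
        unfolding ext_l[OF l(1)] by (intro unit_vec_supp_space)
      then show "unit_vec (ksubs N k) S \<in> L.module.span ?X" using L.in_own_span[OF Xc] l(1) by blast
    qed
  qed
  have "card \<S> = (\<Sum>l<i. card {S \<in> ksubs N k. S \<subseteq> ?B l})"
    unfolding S_eq
  proof (rule card_UN_disjoint)
    show "\<forall>l\<in>{..<i}. \<forall>l'\<in>{..<i}. l \<noteq> l' \<longrightarrow> {S \<in> ksubs N k. S \<subseteq> ?B l} \<inter> {S \<in> ksubs N k. S \<subseteq> ?B l'} = {}"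
    proof (intro ballI impI)
      fix l l' :: nat assume ne: "l \<noteq> l'"
      have "?B l \<inter> ?B l' = {}" by (rule blocks_disjoint[OF ne])
      moreover have "S \<noteq> {}" if "S \<in> ksubs N k" for S using that k by (auto simp: ksubs_def)
      ultimately show "{S \<in> ksubs N k. S \<subseteq> ?B l} \<inter> {S \<in> ksubs N k. S \<subseteq> ?B l'} = {}" by blast
    qed
  qed auto
  also have "\<dots> = (\<Sum>l<i. r choose k)"
  proof (rule sum.cong[OF refl])
    fix l assume "l \<in> {..<i}"
    then have "{S \<in> ksubs N k. S \<subseteq> ?B l} = {S. S \<subseteq> ?B l \<and> card S = k}" using BN[of l] by (auto simp: ksubs_def)
    then show "card {S \<in> ksubs N k. S \<subseteq> ?B l} = (r choose k)" by (simp add: n_subsets)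
  qed
  finally show "card (supp_space (ksubs N k) \<S>) = q ^ (i * (r choose k))"
    by (subst card_supp_space) (auto simp: \<S>_def)
qed

text \<open>An adapted map reduces the claim to coordinate blocks. The exterior powers of the
  members add up without loss of dimension, which is what makes their nullity events
  independent.\<close>

lemma card_span_ext_direct:
  assumes T: "V.direct r T" and r: "1 \<le> r" and k: "1 \<le> k"
  shows "card (L.module.span (\<Union>H\<in>T. exterior_power_of F k N H)) = q ^ (card T * (r choose k))"
proof -
  obtain g e where g: "g \<in> lin_maps {..<N} {..<N}" "g ` vecs {..<N} = vecs {..<N}"
    and e: "bij_betw e {..<card T} T" and i: "r * card T \<le> N"
    and ge: "\<And>l. l < card T \<Longrightarrow> g ` supp_space {..<N} {l * r..<Suc l * r} = e l"
    by (rule adapted_map_exists[OF T r], rule that)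
  let ?E = "\<lambda>l. supp_space {..<N} {l * r..<Suc l * r}"
  let ?X = "\<Union>l<card T. exterior_power_of F k N (?E l)"
  have Ec: "?E l \<subseteq> vecs {..<N}" for l by (auto simp: supp_space_def)
  have "(\<Union>H\<in>e ` {..<card T}. exterior_power_of F k N H) = (\<Union>l<card T. exterior_power_of F k N (e l))"
    by blast
  then have "(\<Union>H\<in>T. exterior_power_of F k N H) = (\<Union>l<card T. exterior_power_of F k N (e l))"
    unfolding bij_betw_imp_surj_on[OF e] .
  also have "\<dots> = (\<Union>l<card T. ext_map k N g ` exterior_power_of F k N (?E l))"
    using ge ext_map_image[OF g Ec] by (intro SUP_cong) auto
  also have "\<dots> = ext_map k N g ` ?X" by (rule image_UN[symmetric])
  finally have "card (L.module.span (\<Union>H\<in>T. exterior_power_of F k N H)) = card (L.module.span (ext_map k N g ` ?X))"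
    by simp
  also have "\<dots> = card (L.module.span ?X)"
    using ext_subset_carrier[OF Ec] by (intro card_span_ext_map[OF g]) blast
  also have "\<dots> = q ^ (card T * (r choose k))" using card_span_ext_blocks[OF i k] by simp
  finally show ?thesis .
qed

lemma direct_singleton:
  assumes "subspace F H (func_space {..<N})" "V.sdim H = r" shows "V.direct r {H}"
  using assms V.card_subspace V.span_subspace by (simp add: V.direct_def)

lemma card_ext:
  assumes "subspace F H (func_space {..<N})" "V.sdim H = r" "1 \<le> r" "1 \<le> k"
  shows "card (exterior_power_of F k N H) = q ^ (r choose k)"
proof -
  have Hc: "H \<subseteq> vecs {..<N}" using V.subspaceD(1)[OF assms(1)] by simp
  show ?thesis using card_span_ext_direct[OF direct_singleton[OF assms(1,2)] assms(3,4)]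
      L.span_subspace[OF subspace_ext[OF Hc]] by simp
qed

text \<open>After transport to blocks, the dimension formula leaves only the intersection of the
  exterior power of \<open>H\<close> with the sum of those of the blocks, and
  \<open>card_ext_Int_le\<close> bounds it through the individual intersections. The power of
  \<open>q\<close> on the right measures the loss of independence.\<close>

lemma card_span_ext_joint:
  assumes T: "V.direct r T" and r: "1 \<le> r" and k: "2 \<le> k"
    and H: "subspace F H (func_space {..<N})" "V.sdim H = r"
  shows "q ^ (Suc (card T) * (r choose k)) \<le>
    card (L.module.span (\<Union>H'\<in>insert H T. exterior_power_of F k N H')) * q ^ (\<Sum>H'\<in>T. V.sdim (H \<inter> H') choose k)"
proof -
  obtain g e where g: "g \<in> lin_maps {..<N} {..<N}" "g ` vecs {..<N} = vecs {..<N}"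
    and e: "bij_betw e {..<card T} T" and i: "r * card T \<le> N"
    and ge: "\<And>l. l < card T \<Longrightarrow> g ` supp_space {..<N} {l * r..<Suc l * r} = e l"
    by (rule adapted_map_exists[OF T r], rule that)
  let ?i = "card T"
  let ?B = "\<lambda>l. {l * r..<Suc l * r}"
  let ?E = "\<lambda>l. supp_space {..<N} (?B l)"
  let ?X = "\<Union>l<?i. exterior_power_of F k N (?E l)"
  interpret g: linear_map F "func_space {..<N}" "func_space {..<N}" g by (rule lin_mapsD(4)[OF g(1)])
  note Hc = V.subspaceD(1)[OF H(1), simplified]
  \<comment> \<open>The adapted map sends blocks to members, so \<open>H\<close> has to be pulled
    back; by injectivity all intersection dimensions are preserved.\<close>
  define H0 where "H0 = {x \<in> vecs {..<N}. g x \<in> H}"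
  have H0c: "H0 \<subseteq> vecs {..<N}" by (auto simp: H0_def)
  have gH0: "g ` H0 = H"
  proof
    show "H \<subseteq> g ` H0"
    proof
      fix x assume x: "x \<in> H"
      then have "x \<in> vecs {..<N}" by (rule subsetD[OF Hc])
      then have "x \<in> g ` vecs {..<N}" by (simp only: g(2))
      then obtain y where "y \<in> vecs {..<N}" "x = g y" by blast
      then show "x \<in> g ` H0" using x unfolding H0_def by blast
    qed
  qed (auto simp: H0_def)
  have sH0: "subspace F H0 (func_space {..<N})"
  proof (rule V.subspaceI)
    note h = V.subspaceD[OF H(1)]
    show "\<zero>\<^bsub>func_space {..<N}\<^esub> \<in> H0" using h(2) lin_mapsD(5)[OF g(1)] by (simp add: H0_def)
    show "u \<oplus>\<^bsub>func_space {..<N}\<^esub> v \<in> H0" if "u \<in> H0" "v \<in> H0" for u v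
      using that h(3)[of "g u" "g v"] lin_mapsD(2)[OF g(1), of u v] V.module.M.a_closed[of u v] by (simp add: H0_def)
    show "c \<odot>\<^bsub>func_space {..<N}\<^esub> v \<in> H0" if "c \<in> carrier F" "v \<in> H0" for c v
      using that h(4)[of c "g v"] lin_mapsD(3)[OF g(1), of c v] V.module.smult_closed[of c v] by (simp add: H0_def)
  qed (use H0c in simp)
  have inj: "inj_on g A" if "A \<subseteq> vecs {..<N}" for A using map_inj[OF g] that by (rule inj_on_subset)
  have dH0: "V.sdim H0 = r"
  proof (rule V.sdim_eqI[OF sH0])
    have "card H = card H0" using card_image[OF inj[OF H0c]] gH0 by simp
    then show "card H0 = q ^ r" using V.card_subspace[OF H(1)] H(2) by simp
  qed
  have Ec: "?E l \<subseteq> vecs {..<N}" for l by (auto simp: supp_space_def)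
  have Xc: "?X \<subseteq> vecs (ksubs N k)" using ext_subset_carrier[OF Ec] by blast
  note X0c = ext_subset_carrier[OF H0c, of k]
  have int: "V.sdim (H \<inter> e l) = V.sdim (H0 \<inter> ?E l)" if l: "l < ?i" for l
  proof -
    have s: "subspace F (H0 \<inter> ?E l) (func_space {..<N})"
      by (intro V.subspace_Int sH0 subspace_supp_space) simp
    have "g ` (H0 \<inter> ?E l) = g ` H0 \<inter> g ` ?E l"
      using map_inj[OF g] H0c Ec by (rule inj_on_image_Int)
    then have "g ` (H0 \<inter> ?E l) = H \<inter> e l" using gH0 ge[OF l] by simp
    then have "card (H \<inter> e l) = card (H0 \<inter> ?E l)" using card_image[OF inj, of "H0 \<inter> ?E l"] H0c by auto
    moreover have "subspace F (e l) (func_space {..<N})" using e l T by (auto simp: V.direct_def bij_betw_def)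
    ultimately show ?thesis using V.card_subspace[OF s] by (intro V.sdim_eqI V.subspace_Int H(1)) auto
  qed
  have "(\<Sum>H'\<in>T. V.sdim (H \<inter> H') choose k) = (\<Sum>l<?i. V.sdim (H \<inter> e l) choose k)"
    by (rule sum.reindex_bij_betw[OF e, symmetric])
  also have "\<dots> = (\<Sum>l<?i. V.sdim (H0 \<inter> ?E l) choose k)" using int by (intro sum.cong) auto
  finally have sumeq: "(\<Sum>H'\<in>T. V.sdim (H \<inter> H') choose k) = (\<Sum>l<?i. V.sdim (H0 \<inter> ?E l) choose k)" .
  have "(\<Union>H\<in>e ` {..<?i}. exterior_power_of F k N H) = (\<Union>l<?i. exterior_power_of F k N (e l))"
    by blast
  then have "(\<Union>H\<in>T. exterior_power_of F k N H) = (\<Union>l<?i. exterior_power_of F k N (e l))"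
    unfolding bij_betw_imp_surj_on[OF e] .
  then have "(\<Union>H'\<in>insert H T. exterior_power_of F k N H') = exterior_power_of F k N (g ` H0) \<union> (\<Union>l<?i. exterior_power_of F k N (e l))"
    using gH0 by simp
  also have "\<dots> = ext_map k N g ` exterior_power_of F k N H0 \<union> (\<Union>l<?i. ext_map k N g ` exterior_power_of F k N (?E l))"
    using ge ext_map_image[OF g Ec] ext_map_image[OF g H0c] by (intro arg_cong2[where f = "(\<union>)"] SUP_cong) auto
  also have "\<dots> = ext_map k N g ` (exterior_power_of F k N H0 \<union> ?X)" by (simp add: image_Un image_UN)
  finally have c1: "card (L.module.span (\<Union>H'\<in>insert H T. exterior_power_of F k N H')) =
      card (L.module.span (exterior_power_of F k N H0 \<union> ?X))"
    using card_span_ext_map[OF g, of "exterior_power_of F k N H0 \<union> ?X"] Xc X0c by simp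
  let ?S = "{S \<in> ksubs N k. \<exists>B\<in>?B ` {..<?i}. S \<subseteq> B}"
  let ?U = "supp_space (ksubs N k) ?S"
  have spX: "L.module.span ?X = ?U" and cU: "card ?U = q ^ (?i * (r choose k))"
    using card_span_ext_blocks[OF i] k by auto
  have sU: "subspace F ?U (func_space (ksubs N k))" by (rule subspace_supp_space) simp
  have "L.module.span (exterior_power_of F k N H0 \<union> ?X) = L.module.span (?U \<union> exterior_power_of F k N H0)"
    using L.span_span_Un[of ?X "exterior_power_of F k N H0"] Xc X0c spX by (simp add: Un_commute)
  then have m1: "card (L.module.span (exterior_power_of F k N H0 \<union> ?X)) * card (?U \<inter> exterior_power_of F k N H0)
      = q ^ (?i * (r choose k)) * q ^ (r choose k)"
    using L.card_span_Un[OF sU subspace_ext[OF H0c]] cU card_ext[OF sH0 dH0 r] k by simp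
  have disj: "B \<inter> B' = {}" if "B \<in> ?B ` {..<?i}" "B' \<in> ?B ` {..<?i}" "B \<noteq> B'" for B B'
  proof -
    obtain l l' where l: "B = ?B l" "B' = ?B l'" using \<open>B \<in> ?B ` {..<?i}\<close> \<open>B' \<in> ?B ` {..<?i}\<close> by (elim imageE)
    then have "l \<noteq> l'" using \<open>B \<noteq> B'\<close> by metis
    then show ?thesis unfolding l by (rule blocks_disjoint)
  qed
  have m2: "card (?U \<inter> exterior_power_of F k N H0) \<le> q ^ (\<Sum>B\<in>?B ` {..<?i}. V.sdim (H0 \<inter> supp_space {..<N} B) choose k)"
  proof (subst Int_commute, rule card_ext_Int_le[OF sH0 k])
    show "finite (?B ` {..<?i})" by simp
    show "B \<inter> B' = {}" if "B \<in> ?B ` {..<?i}" "B' \<in> ?B ` {..<?i}" "B \<noteq> B'" for B B'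
      by (rule disj[OF that])
  qed
  have m3: "(\<Sum>B\<in>?B ` {..<?i}. V.sdim (H0 \<inter> supp_space {..<N} B) choose k) = (\<Sum>l<?i. V.sdim (H0 \<inter> ?E l) choose k)"
  proof (rule sum.reindex_cong[where l = ?B, OF _ refl refl])
    show "inj_on ?B {..<?i}"
    proof (rule inj_onI)
      fix l l' assume eq: "?B l = ?B l'"
      have "l * r \<in> ?B l" "l' * r \<in> ?B l'" using r by auto
      then have "l * r \<in> ?B l'" "l' * r \<in> ?B l" by (simp_all only: eq)
      then have "l' * r \<le> l * r" "l * r \<le> l' * r" unfolding atLeastLessThan_iff by linarith+
      then show "l = l'" using r by simp
    qed
  qed
  have "q ^ (Suc ?i * (r choose k)) = q ^ (?i * (r choose k)) * q ^ (r choose k)"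
    by (simp add: power_add mult.commute)
  also have "\<dots> \<le> card (L.module.span (exterior_power_of F k N H0 \<union> ?X)) * q ^ (\<Sum>l<?i. V.sdim (H0 \<inter> ?E l) choose k)"
    unfolding m1[symmetric] using m2 unfolding m3 by (rule mult_le_mono2)
  finally show ?thesis unfolding c1 sumeq .
qed

end

end

section \<open>Bonferroni inequalities for hereditary families\<close>

definition hereditary :: "('s set \<Rightarrow> bool) \<Rightarrow> bool" where
  "hereditary D \<longleftrightarrow> D {} \<and> (\<forall>T T'. D T \<longrightarrow> T' \<subseteq> T \<longrightarrow> D T')"

definition fam :: "('s set \<Rightarrow> bool) \<Rightarrow> 's set \<Rightarrow> nat \<Rightarrow> 's set set" where
  "fam D X i = {T. T \<subseteq> X \<and> card T = i \<and> D T}"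

definition bad_ext :: "('s set \<Rightarrow> bool) \<Rightarrow> 's set \<Rightarrow> 's set \<Rightarrow> 's set" where
  "bad_ext D X T = {H \<in> X - T. \<not> D (insert H T)}"

lemma finite_fam: "finite X \<Longrightarrow> finite (fam D X i)"
  by (rule finite_subset[of _ "Pow X"]) (auto simp: fam_def)

lemma card_fam_le: "finite X \<Longrightarrow> card (fam D X i) \<le> card X choose i"
  using card_mono[of "{T. T \<subseteq> X \<and> card T = i}" "fam D X i"] n_subsets[of X i]
  by (auto simp: fam_def intro: finite_subset[of _ "Pow X"])

text \<open>For positive \<open>n\<close> the alternating partial sum telescopes by Pascal's rule to
  a single binomial coefficient with \<open>n - 1\<close> on top, which is at most
  \<open>n choose L\<close>.\<close>

lemma bonferroni_binomial:
  assumes "1 \<le> L"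
  shows "\<bar>of_bool (n = 0) - (\<Sum>i<L. (-1) ^ i * real (n choose i))\<bar> \<le> real (n choose L)"
proof (cases n)
  case 0
  have "(\<Sum>i<L. (-1) ^ i * real (0 choose i)) = 1"
    using assms by (subst sum.remove[of _ 0]) (auto simp: binomial_eq_0)
  then show ?thesis using 0 by simp
next
  case (Suc m)
  have "(\<Sum>i\<le>l. (-1) ^ i * real (Suc m choose i)) = (-1) ^ l * real (m choose l)" for l
    by (induction l) (auto simp: algebra_simps)
  from this[of "L - 1"] have "(\<Sum>i<L. (-1) ^ i * real (Suc m choose i)) = (-1) ^ (L - 1) * real (m choose (L - 1))"
    using assms by (simp flip: lessThan_Suc_atMost)
  moreover have "m choose (L - 1) \<le> Suc m choose L" using assms by (cases L) auto
  ultimately show ?thesis using Suc by (simp add: abs_mult)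
qed

lemma sum_UNION_le:
  fixes g :: "'s \<Rightarrow> nat"
  assumes "finite I" "\<And>j. j \<in> I \<Longrightarrow> finite (A j)"
  shows "sum g (\<Union>j\<in>I. A j) \<le> (\<Sum>j\<in>I. sum g (A j))"
  using assms
proof (induction I rule: finite_induct)
  case (insert j I)
  have "sum g (A j \<union> \<Union> (A ` I)) + sum g (A j \<inter> \<Union> (A ` I)) = sum g (A j) + sum g (\<Union> (A ` I))"
    using insert by (intro sum.union_inter) auto
  then have "sum g (A j \<union> \<Union> (A ` I)) \<le> sum g (A j) + sum g (\<Union> (A ` I))" by linarith
  then show ?case using insert by fastforce
qed simp

text \<open>
  If some set of size at most \<open>L\<close> fails \<open>D\<close>, then each \<open>T\<close> with \<open>D T\<close> has a maximal good superset
  inside \<open>T \<union> T\<^sub>0\<close>, which has a bad extension.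
\<close>

lemma card_fam_le_bad:
  assumes X: "finite X" and D: "hereditary D" and i: "i < L"
    and T0: "T0 \<subseteq> X" "card T0 \<le> L" "\<not> D T0"
  shows "card (fam D X i) \<le> (\<Sum>j<2 * L. 2 ^ j * (\<Sum>T\<in>fam D X j. card (bad_ext D X T)))"
proof -
  let ?Q = "\<Union>j<2 * L. {T \<in> fam D X j. bad_ext D X T \<noteq> {}}"
  have fin: "finite T" if "T \<subseteq> X" for T using that X finite_subset by blast
  have "fam D X i \<subseteq> (\<Union>T'\<in>?Q. Pow T')"
  proof
    fix T assume T: "T \<in> fam D X i"
    then have TX: "T \<subseteq> X" "D T" "card T = i" by (auto simp: fam_def)
    let ?C = "{T'. T \<subseteq> T' \<and> T' \<subseteq> T \<union> T0 \<and> D T'}"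
    have "finite ?C" by (rule finite_subset[of _ "Pow (T \<union> T0)"]) (use fin TX T0 in auto)
    moreover have "?C \<noteq> {}" using TX by auto
    ultimately obtain T' where T': "T' \<in> ?C" and max: "\<And>T''. T'' \<in> ?C \<Longrightarrow> T' \<subseteq> T'' \<Longrightarrow> T'' = T'"
      using finite_has_maximal[of ?C] by (metis (lifting))
    have "\<not> T0 \<subseteq> T'" using T' T0(3) D by (auto simp: hereditary_def)
    then obtain H where H: "H \<in> T0" "H \<notin> T'" by blast
    have "\<not> D (insert H T')"
    proof
      assume "D (insert H T')"
      then have "insert H T' \<in> ?C" using T' H by auto
      from max[OF this] show False using H by auto
    qed
    moreover have "H \<in> X" using H T0 by blast
    ultimately have "H \<in> bad_ext D X T'" using H by (simp add: bad_ext_def)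
    \<comment> \<open>The element \<open>H\<close> of \<open>T \<union> T0\<close> is missing from
      \<open>T'\<close>, so \<open>T'\<close> has fewer than \<open>i + L\<close> elements.\<close>
    moreover have "card T' < 2 * L"
    proof -
      have fT': "finite T'" using T' TX T0 by (intro fin) blast
      have "card (insert H T') \<le> card (T \<union> T0)" using T' H TX T0 fin by (intro card_mono) auto
      also have "\<dots> \<le> i + L" using card_Un_le[of T T0] TX T0 by simp
      finally show ?thesis using H i fT' by (simp add: card_insert_if)
    qed
    moreover have "T' \<in> fam D X (card T')" using T' TX T0 by (auto simp: fam_def)
    ultimately have "T' \<in> ?Q" by blast
    then show "T \<in> (\<Union>T'\<in>?Q. Pow T')" using T' by blast
  qed
  moreover have fQj: "finite {T \<in> fam D X j. bad_ext D X T \<noteq> {}}" for j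
    by (rule finite_subset[OF _ finite_fam[OF X, of D j]]) blast
  then have fQ: "finite ?Q" by simp
  moreover have "finite (Pow T')" if "T' \<in> ?Q" for T'
    using that fin by (auto simp: fam_def)
  then have "finite (\<Union>T'\<in>?Q. Pow T')" using fQ by (rule finite_UN_I[rotated])
  ultimately have "card (fam D X i) \<le> card (\<Union>T'\<in>?Q. Pow T')"
    by (intro card_mono)
  also have "\<dots> \<le> (\<Sum>T'\<in>?Q. card (Pow T'))" by (rule card_UN_le[OF fQ])
  also have "\<dots> \<le> (\<Sum>j<2 * L. \<Sum>T'\<in>{T \<in> fam D X j. bad_ext D X T \<noteq> {}}. card (Pow T'))"
    using fQj by (intro sum_UNION_le) auto
  also have "\<dots> \<le> (\<Sum>j<2 * L. 2 ^ j * (\<Sum>T\<in>fam D X j. card (bad_ext D X T)))"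
  proof (rule sum_mono)
    fix j assume "j \<in> {..<2 * L}"
    \<comment> \<open>The factor \<open>2 ^ j\<close> counts the subsets \<open>T\<close> that may
      have led to \<open>T'\<close>; the number of bad extensions is at least one and replaces the
      indicator of having one.\<close>
    have "(\<Sum>T'\<in>{T \<in> fam D X j. bad_ext D X T \<noteq> {}}. card (Pow T'))
        \<le> (\<Sum>T'\<in>{T \<in> fam D X j. bad_ext D X T \<noteq> {}}. 2 ^ j * card (bad_ext D X T'))"
    proof (rule sum_mono)
      fix T' assume T': "T' \<in> {T \<in> fam D X j. bad_ext D X T \<noteq> {}}"
      then have "finite T'" "card T' = j" using fin by (auto simp: fam_def)
      moreover have "1 \<le> card (bad_ext D X T')"
        using T' X by (auto simp: bad_ext_def Suc_le_eq card_gt_0_iff)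
      ultimately show "card (Pow T') \<le> 2 ^ j * card (bad_ext D X T')" by (simp add: card_Pow)
    qed
    also have "\<dots> \<le> (\<Sum>T'\<in>fam D X j. 2 ^ j * card (bad_ext D X T'))"
      using finite_fam[OF X] by (intro sum_mono2) auto
    finally show "(\<Sum>T'\<in>{T \<in> fam D X j. bad_ext D X T \<noteq> {}}. card (Pow T')) \<le> 2 ^ j * (\<Sum>T\<in>fam D X j. card (bad_ext D X T))"
      by (simp add: sum_distrib_left)
  qed
  finally show ?thesis .
qed

text \<open>If every subset of size at most \<open>L\<close> is good, the restricted sums are the
  ordinary ones and the classical inequality applies. Otherwise bad extensions exist, and they bound
  each of the \<open>L\<close> terms separately.\<close>

lemma truncated_bonferroni:
  assumes X: "finite X" and D: "hereditary D" and L: "1 \<le> L"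
  shows "\<bar>of_bool (X = {}) - (\<Sum>i<L. (-1) ^ i * real (card (fam D X i)))\<bar>
    \<le> card (fam D X L) + L * (\<Sum>j<2 * L. 2 ^ j * (\<Sum>T\<in>fam D X j. real (card (bad_ext D X T))))"
    (is "?lhs \<le> _ + real L * ?B")
proof (cases "\<forall>T\<subseteq>X. card T \<le> L \<longrightarrow> D T")
  case True
  have "fam D X i = {T. T \<subseteq> X \<and> card T = i}" if "i \<le> L" for i using True that by (auto simp: fam_def)
  then have c: "card (fam D X i) = card X choose i" if "i \<le> L" for i using n_subsets[OF X] that by simp
  have "?lhs = \<bar>of_bool (card X = 0) - (\<Sum>i<L. (-1) ^ i * real (card X choose i))\<bar>"
    using X c by simp
  also have "\<dots> \<le> card (fam D X L)" using bonferroni_binomial[OF L, of "card X"] c by simp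
  also have "\<dots> \<le> card (fam D X L) + L * ?B" by (simp add: sum_nonneg)
  finally show ?thesis .
next
  case False
  then obtain T0 where T0: "T0 \<subseteq> X" "card T0 \<le> L" "\<not> D T0" by blast
  have ne: "X \<noteq> {}" using T0 D by (auto simp: hereditary_def)
  have "?lhs \<le> (\<Sum>i<L. \<bar>(-1) ^ i * real (card (fam D X i))\<bar>)" using ne sum_abs by (simp del: abs_mult)
  also have "\<dots> = (\<Sum>i<L. real (card (fam D X i)))" by (simp add: abs_mult)
  also have "\<dots> \<le> (\<Sum>i<L. ?B)"
  proof (rule sum_mono)
    fix i assume "i \<in> {..<L}"
    then have "real (card (fam D X i)) \<le> real (\<Sum>j<2 * L. 2 ^ j * (\<Sum>T\<in>fam D X j. card (bad_ext D X T)))"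
      using card_fam_le_bad[OF X D _ T0] by (simp only: of_nat_le_iff lessThan_iff)
    then show "real (card (fam D X i)) \<le> ?B" by simp
  qed
  also have "\<dots> = L * ?B" by simp
  finally show ?thesis by simp
qed

text \<open>Double counting of pairs of a good \<open>T\<close> of size \<open>j\<close> and an
  element that extends it: each \<open>T\<close> has at least \<open>card S * (1 - d)\<close> good
  extensions, and each good set of size \<open>j + 1\<close> arises \<open>j + 1\<close> times,
  whence the factorial.\<close>

lemma card_fam_lower:
  fixes d :: real
  assumes S: "finite S" and D: "hereditary D" and i: "i \<le> L" and d: "0 \<le> d" "d \<le> 1"
    and bad: "\<And>j T. j < L \<Longrightarrow> T \<in> fam D S j \<Longrightarrow> real (card T + card (bad_ext D S T)) \<le> d * card S"
  shows "(card S * (1 - d)) ^ i \<le> fact i * real (card (fam D S i))"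
  using i
proof (induction i)
  case 0
  have "fam D S 0 = {{}}" using D S by (auto simp: fam_def hereditary_def dest: finite_subset)
  then show ?case by simp
next
  case (Suc j)
  let ?g = "\<lambda>T. {H \<in> S - T. D (insert H T)}"
  have fT: "finite T" if "T \<subseteq> S" for T using that S finite_subset by blast
  have g: "card S * (1 - d) \<le> card (?g T)" if T: "T \<in> fam D S j" for T
  proof -
    have "S = T \<union> bad_ext D S T \<union> ?g T" using T by (auto simp: fam_def bad_ext_def)
    then have "card S \<le> card T + card (bad_ext D S T) + card (?g T)"
      by (metis (no_types, lifting) card_Un_le le_trans add_le_mono order_refl)
    then show ?thesis using bad[OF _ T] Suc.prems by (simp add: algebra_simps)
  qed
  have "card (Sigma (fam D S j) ?g) = card (SIGMA U:fam D S (Suc j). U)"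
  proof (rule bij_betw_same_card, rule bij_betwI[where f = "\<lambda>(T, H). (insert H T, H)" and g = "\<lambda>(U, H). (U - {H}, H)"])
    show "(\<lambda>(T, H). (insert H T, H)) \<in> Sigma (fam D S j) ?g \<rightarrow> (SIGMA U:fam D S (Suc j). U)"
      using fT by (auto simp: fam_def)
    show "(\<lambda>(U, H). (U - {H}, H)) \<in> (SIGMA U:fam D S (Suc j). U) \<rightarrow> Sigma (fam D S j) ?g"
    proof (rule funcsetI)
      fix p assume "p \<in> (SIGMA U:fam D S (Suc j). U)"
      then obtain U H where p: "p = (U, H)" and U: "U \<in> fam D S (Suc j)" "H \<in> U" by blast
      then have "U - {H} \<in> fam D S j" using fT[of U] D by (auto simp: fam_def hereditary_def)
      moreover have "H \<in> ?g (U - {H})" using U by (auto simp: fam_def insert_absorb)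
      ultimately show "(case p of (U, H) \<Rightarrow> (U - {H}, H)) \<in> Sigma (fam D S j) ?g" unfolding p prod.case by (intro SigmaI)
    qed
  qed (auto simp: insert_absorb)
  moreover have "card (SIGMA U:fam D S (Suc j). U) = card (fam D S (Suc j)) * Suc j"
    using fT finite_fam[OF S] by (subst card_SigmaI) (auto simp: fam_def)
  moreover have "card (Sigma (fam D S j) ?g) = (\<Sum>T\<in>fam D S j. card (?g T))"
    using finite_fam[OF S] S by (intro card_SigmaI) auto
  ultimately have "real (card (fam D S (Suc j)) * Suc j) = (\<Sum>T\<in>fam D S j. real (card (?g T)))" by simp
  also have "\<dots> \<ge> (\<Sum>T\<in>fam D S j. card S * (1 - d))" by (intro sum_mono g)
  finally have 1: "card (fam D S j) * (card S * (1 - d)) \<le> card (fam D S (Suc j)) * real (Suc j)"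
    by (simp add: algebra_simps)
  have "(card S * (1 - d)) ^ Suc j \<le> (fact j * real (card (fam D S j))) * (card S * (1 - d))"
    using mult_right_mono[OF Suc.IH, of "card S * (1 - d)"] Suc.prems d by (simp add: mult_ac)
  also have "\<dots> \<le> fact j * (card (fam D S (Suc j)) * real (Suc j))"
    using mult_left_mono[OF 1, of "fact j"] by (simp add: mult_ac)
  finally show ?case by (simp add: algebra_simps)
qed

definition prob_all :: "'w set \<Rightarrow> ('w \<Rightarrow> 's \<Rightarrow> bool) \<Rightarrow> 's set \<Rightarrow> real" where
  "prob_all A nul T = card {w \<in> A. \<forall>H\<in>T. nul w H} / card A"

lemma sum_card_double_count:
  assumes "finite A" "finite B"
  shows "(\<Sum>w\<in>A. real (card {x \<in> B. P w x})) = (\<Sum>x\<in>B. real (card {w \<in> A. P w x}))"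
proof -
  have "(\<Sum>w\<in>A. card {x \<in> B. P w x}) = (\<Sum>x\<in>B. card {w \<in> A. P w x})"
    unfolding card_eq_sum by (rule sum.swap_restrict[OF assms])
  from arg_cong[OF this, of real] show ?thesis by simp
qed

text \<open>The deterministic inequality is averaged over the sample space, with \<open>X w\<close>
  the set of events that occur at \<open>w\<close>; interchanging sums turns the counts into joint
  probabilities.\<close>

lemma prob_none_bonferroni:
  assumes A: "finite A" "A \<noteq> {}" and S: "finite S" and D: "hereditary D" and L: "1 \<le> L"
  shows "\<bar>card {w \<in> A. \<forall>H\<in>S. \<not> nul w H} / card A - (\<Sum>i<L. (-1) ^ i * (\<Sum>T\<in>fam D S i. prob_all A nul T))\<bar>
    \<le> (\<Sum>T\<in>fam D S L. prob_all A nul T)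
      + L * (\<Sum>j<2 * L. 2 ^ j * (\<Sum>T\<in>fam D S j. \<Sum>H\<in>bad_ext D S T. prob_all A nul (insert H T)))"
proof -
  define X where "X w = {H \<in> S. nul w H}" for w
  have fX: "finite (X w)" for w using S by (simp add: X_def)
  have XT: "T \<subseteq> X w \<longleftrightarrow> T \<subseteq> S \<and> (\<forall>H\<in>T. nul w H)" for T w by (auto simp: X_def)
  have cA: "real (card A) > 0" using A by (simp add: card_gt_0_iff)
  have E_fam: "(\<Sum>w\<in>A. real (card (fam D (X w) i))) = card A * (\<Sum>T\<in>fam D S i. prob_all A nul T)" for i
  proof -
    have "fam D (X w) i = {T \<in> fam D S i. \<forall>H\<in>T. nul w H}" for w by (auto simp: fam_def XT)
    then show ?thesis
      using sum_card_double_count[OF A(1) finite_fam[OF S, of D i], where P = "\<lambda>w T. \<forall>H\<in>T. nul w H"] cA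
      by (simp add: prob_all_def sum_divide_distrib[symmetric])
  qed
  have E_bad: "(\<Sum>w\<in>A. \<Sum>T\<in>fam D (X w) j. real (card (bad_ext D (X w) T)))
      = card A * (\<Sum>T\<in>fam D S j. \<Sum>H\<in>bad_ext D S T. prob_all A nul (insert H T))" for j
  proof -
    \<comment> \<open>Bad extensions inside \<open>X w\<close> are bad extensions inside
      \<open>S\<close> all of whose members occur, so one fixed set of pairs serves every
      \<open>w\<close>.\<close>
    let ?Z = "Sigma (fam D S j) (bad_ext D S)"
    have fb: "finite (bad_ext D Y T)" if "finite Y" for Y T using that by (simp add: bad_ext_def)
    have "(\<Sum>T\<in>fam D (X w) j. card (bad_ext D (X w) T)) = card {p \<in> ?Z. \<forall>H\<in>insert (snd p) (fst p). nul w H}" for w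
    proof -
      have "Sigma (fam D (X w) j) (bad_ext D (X w)) = {p \<in> ?Z. \<forall>H\<in>insert (snd p) (fst p). nul w H}"
        by (auto simp: fam_def bad_ext_def XT) (auto simp: X_def)
      then show ?thesis using card_SigmaI[of "fam D (X w) j" "bad_ext D (X w)"] finite_fam[OF fX] fb[OF fX] by simp
    qed
    then have "(\<Sum>w\<in>A. \<Sum>T\<in>fam D (X w) j. real (card (bad_ext D (X w) T)))
        = (\<Sum>w\<in>A. real (card {p \<in> ?Z. \<forall>H\<in>insert (snd p) (fst p). nul w H}))"
      by (metis (no_types, lifting) of_nat_sum sum.cong)
    also have "\<dots> = (\<Sum>p\<in>?Z. real (card {w \<in> A. \<forall>H\<in>insert (snd p) (fst p). nul w H}))"
      using finite_fam[OF S] fb[OF S] by (intro sum_card_double_count A(1) finite_SigmaI) auto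
    also have "\<dots> = card A * (\<Sum>p\<in>?Z. prob_all A nul (insert (snd p) (fst p)))"
      using cA by (simp add: prob_all_def sum_divide_distrib[symmetric])
    also have "(\<Sum>p\<in>?Z. prob_all A nul (insert (snd p) (fst p)))
        = (\<Sum>T\<in>fam D S j. \<Sum>H\<in>bad_ext D S T. prob_all A nul (insert H T))"
      using finite_fam[OF S] fb[OF S] by (subst sum.Sigma) (auto simp: split_def)
    finally show ?thesis .
  qed
  let ?f = "\<lambda>w. of_bool (X w = {}) - (\<Sum>i<L. (-1) ^ i * real (card (fam D (X w) i)))"
  have "(\<Sum>w\<in>A. of_bool (X w = {})) = real (card {w \<in> A. X w = {}})"
    using A(1) by (simp add: of_bool_def sum.If_cases Int_def)
  moreover have "X w = {} \<longleftrightarrow> (\<forall>H\<in>S. \<not> nul w H)" for w by (auto simp: X_def)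
  ultimately have n0: "(\<Sum>w\<in>A. of_bool (X w = {})) = real (card {w \<in> A. \<forall>H\<in>S. \<not> nul w H})" by simp
  have "(\<Sum>w\<in>A. \<Sum>i<L. (-1) ^ i * real (card (fam D (X w) i)))
      = (\<Sum>i<L. (-1) ^ i * (card A * (\<Sum>T\<in>fam D S i. prob_all A nul T)))"
    by (subst sum.swap) (simp add: sum_distrib_left[symmetric] E_fam)
  then have "card {w \<in> A. \<forall>H\<in>S. \<not> nul w H} - card A * (\<Sum>i<L. (-1) ^ i * (\<Sum>T\<in>fam D S i. prob_all A nul T)) = (\<Sum>w\<in>A. ?f w)"
    by (simp add: sum_subtractf n0 sum_distrib_left mult.left_commute)
  also have "\<bar>\<dots>\<bar> \<le> (\<Sum>w\<in>A. \<bar>?f w\<bar>)" by (rule sum_abs)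
  also have "\<dots> \<le> (\<Sum>w\<in>A. card (fam D (X w) L) + L * (\<Sum>j<2 * L. 2 ^ j * (\<Sum>T\<in>fam D (X w) j. real (card (bad_ext D (X w) T)))))"
    by (intro sum_mono truncated_bonferroni fX D L)
  also have "\<dots> = (\<Sum>w\<in>A. real (card (fam D (X w) L)))
      + L * (\<Sum>j<2 * L. 2 ^ j * (\<Sum>w\<in>A. \<Sum>T\<in>fam D (X w) j. real (card (bad_ext D (X w) T))))"
  proof -
    have "(\<Sum>w\<in>A. \<Sum>j<2 * L. 2 ^ j * (\<Sum>T\<in>fam D (X w) j. real (card (bad_ext D (X w) T))))
      = (\<Sum>j<2 * L. 2 ^ j * (\<Sum>w\<in>A. \<Sum>T\<in>fam D (X w) j. real (card (bad_ext D (X w) T))))"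
      by (subst sum.swap) (simp add: sum_distrib_left)
    then show ?thesis by (simp add: sum.distrib sum_distrib_left[symmetric])
  qed
  also have "\<dots> = card A * ((\<Sum>T\<in>fam D S L. prob_all A nul T)
      + L * (\<Sum>j<2 * L. 2 ^ j * (\<Sum>T\<in>fam D S j. \<Sum>H\<in>bad_ext D S T. prob_all A nul (insert H T))))"
    unfolding E_fam E_bad by (simp add: algebra_simps sum_distrib_left)
  finally have b: "\<bar>card {w \<in> A. \<forall>H\<in>S. \<not> nul w H} - card A * (\<Sum>i<L. (-1) ^ i * (\<Sum>T\<in>fam D S i. prob_all A nul T))\<bar>
      \<le> card A * ((\<Sum>T\<in>fam D S L. prob_all A nul T)
      + L * (\<Sum>j<2 * L. 2 ^ j * (\<Sum>T\<in>fam D S j. \<Sum>H\<in>bad_ext D S T. prob_all A nul (insert H T))))" (is "\<bar>?x - _ * ?y\<bar> \<le> _ * ?z") .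
  have "\<bar>?x / card A - ?y\<bar> = \<bar>?x - card A * ?y\<bar> / card A" using cA by (simp add: field_simps)
  also have "\<dots> \<le> ?z" using b cA by (simp add: field_simps)
  finally show ?thesis .
qed

text \<open>Chebyshev's inequality: where no event occurs, the count is zero and its squared
  deviation equals the squared mean.\<close>

lemma prob_none_second_moment:
  assumes A: "finite A" "A \<noteq> {}" and S: "finite S"
  shows "card {w \<in> A. \<forall>H\<in>S. \<not> nul w H} / card A * (\<Sum>H\<in>S. prob_all A nul {H})\<^sup>2
    \<le> (\<Sum>H\<in>S. \<Sum>H'\<in>S. prob_all A nul {H, H'}) - (\<Sum>H\<in>S. prob_all A nul {H})\<^sup>2"
proof -
  define X where "X w = real (card {H \<in> S. nul w H})" for w
  define mu where "mu = (\<Sum>H\<in>S. prob_all A nul {H})"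
  have cA: "real (card A) > 0" using A by (simp add: card_gt_0_iff)
  have m1: "(\<Sum>w\<in>A. X w) = card A * mu"
    unfolding X_def mu_def using sum_card_double_count[OF A(1) S, of nul] cA
    by (simp add: prob_all_def sum_divide_distrib[symmetric])
  have m2: "(\<Sum>w\<in>A. (X w)\<^sup>2) = card A * (\<Sum>H\<in>S. \<Sum>H'\<in>S. prob_all A nul {H, H'})"
  proof -
    have "(X w)\<^sup>2 = real (card {p \<in> S \<times> S. nul w (fst p) \<and> nul w (snd p)})" for w
    proof -
      have "{p \<in> S \<times> S. nul w (fst p) \<and> nul w (snd p)} = {H \<in> S. nul w H} \<times> {H \<in> S. nul w H}" by auto
      then show ?thesis by (simp add: X_def power2_eq_square card_cartesian_product)
    qed
    then have "(\<Sum>w\<in>A. (X w)\<^sup>2) = (\<Sum>p\<in>S \<times> S. real (card {w \<in> A. nul w (fst p) \<and> nul w (snd p)}))"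
      using sum_card_double_count[OF A(1), of "S \<times> S" "\<lambda>w p. nul w (fst p) \<and> nul w (snd p)"] S by simp
    also have "\<dots> = card A * (\<Sum>p\<in>S \<times> S. prob_all A nul {fst p, snd p})"
      using cA by (simp add: prob_all_def sum_divide_distrib[symmetric])
    finally show ?thesis using S by (simp add: sum.cartesian_product split_def)
  qed
  have "card {w \<in> A. \<forall>H\<in>S. \<not> nul w H} * mu\<^sup>2 = (\<Sum>w\<in>{w \<in> A. \<forall>H\<in>S. \<not> nul w H}. (X w - mu)\<^sup>2)"
  proof -
    have "X w = 0" if "w \<in> {w \<in> A. \<forall>H\<in>S. \<not> nul w H}" for w
    proof -
      have e: "{H \<in> S. nul w H} = {}" using that by auto
      show ?thesis unfolding X_def e by simp
    qed
    then show ?thesis by simp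
  qed
  also have "\<dots> \<le> (\<Sum>w\<in>A. (X w - mu)\<^sup>2)" using A by (intro sum_mono2) auto
  also have "\<dots> = (\<Sum>w\<in>A. (X w)\<^sup>2) - 2 * mu * (\<Sum>w\<in>A. X w) + card A * mu\<^sup>2"
    by (simp add: power2_diff sum.distrib sum_subtractf sum_distrib_left sum_distrib_right algebra_simps)
  also have "\<dots> = card A * ((\<Sum>H\<in>S. \<Sum>H'\<in>S. prob_all A nul {H, H'}) - mu\<^sup>2)"
    unfolding m1 m2 by (simp add: algebra_simps power2_eq_square)
  finally show ?thesis using cA unfolding mu_def[symmetric] by (simp add: field_simps)
qed

section \<open>Moments of the number of null subspaces\<close>

context finite_vectorspace
begin

text \<open>Enlarging \<open>A\<close> to \<open>B\<close> enlarges the span with \<open>Z\<close>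
  by at most the ratio of their sizes, because the intersection with \<open>Z\<close> can only
  grow.\<close>

lemma card_span_exchange:
  assumes A: "subspace K A V" and B: "subspace K B V" and Z: "subspace K Z V" and AB: "A \<subseteq> B"
  shows "card (span (Z \<union> B)) * card A \<le> card (span (Z \<union> A)) * card B"
proof -
  note fin = subspaceD(7)
  have p: "0 < card (Z \<inter> B)" using fin[OF Z] subspaceD(2)[OF Z] subspaceD(2)[OF B] by (auto simp: card_gt_0_iff)
  have le: "card (Z \<inter> A) \<le> card (Z \<inter> B)" using fin[OF Z] AB by (intro card_mono) auto
  have "card (Z \<inter> B) * (card (span (Z \<union> B)) * card A) = (card Z * card A) * card B"
    using card_span_Un[OF Z B] by (simp add: algebra_simps)
  also have "\<dots> = (card (span (Z \<union> A)) * card (Z \<inter> A)) * card B" using card_span_Un[OF Z A] by simp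
  also have "\<dots> \<le> card (Z \<inter> B) * (card (span (Z \<union> A)) * card B)"
    using le by (simp add: algebra_simps mult_le_mono2)
  finally show ?thesis using p by simp
qed

text \<open>The exchange inequality for one member after another; the additional set
  \<open>X\<close> absorbs the members already exchanged.\<close>

lemma card_span_Un_family:
  assumes "finite R" "X \<subseteq> carrier V"
    "\<And>H. H \<in> R \<Longrightarrow> subspace K (A H) V \<and> subspace K (B H) V \<and> A H \<subseteq> B H"
  shows "card (span (X \<union> (\<Union>H\<in>R. B H))) * (\<Prod>H\<in>R. card (A H))
    \<le> card (span (X \<union> (\<Union>H\<in>R. A H))) * (\<Prod>H\<in>R. card (B H))"
  using assms
proof (induction R arbitrary: X rule: finite_induct)
  case (insert H R)
  have H: "subspace K (A H) V" "subspace K (B H) V" "A H \<subseteq> B H" using insert.prems(2) by auto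
  have Bc: "B H \<subseteq> carrier V" using subspaceD(1)[OF H(2)] .
  have AR: "(\<Union>H\<in>R. A H) \<subseteq> carrier V"
    using insert.prems(2) subspaceD(1) by blast
  let ?Z = "span (X \<union> (\<Union>H\<in>R. A H))"
  have Zc: "X \<union> (\<Union>H\<in>R. A H) \<subseteq> carrier V" using AR insert.prems(1) by auto
  have sp: "span (?Z \<union> C) = span ((X \<union> C) \<union> (\<Union>H\<in>R. A H))" if "C \<subseteq> carrier V" for C
    using span_span_Un[OF Zc that] by (simp add: Un_ac)
  have "card (span ((X \<union> B H) \<union> (\<Union>H\<in>R. B H))) * (\<Prod>H\<in>R. card (A H))
      \<le> card (span ((X \<union> B H) \<union> (\<Union>H\<in>R. A H))) * (\<Prod>H\<in>R. card (B H))"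
    using insert.prems Bc by (intro insert.IH) auto
  then have "card (span ((X \<union> B H) \<union> (\<Union>H\<in>R. B H))) * (\<Prod>H\<in>R. card (A H)) * card (A H)
      \<le> (card (span (?Z \<union> B H)) * card (A H)) * (\<Prod>H\<in>R. card (B H))"
    unfolding sp[OF Bc] by (simp add: mult_le_mono1 algebra_simps)
  also have "\<dots> \<le> (card (span (?Z \<union> A H)) * card (B H)) * (\<Prod>H\<in>R. card (B H))"
    by (intro mult_le_mono1 card_span_exchange H span_is_subspace Zc)
  also have "\<dots> = card (span ((X \<union> A H) \<union> (\<Union>H\<in>R. A H))) * (card (B H) * (\<Prod>H\<in>R. card (B H)))"
    using sp[of "A H"] Bc H(3) by (simp add: algebra_simps)
  finally show ?case using insert.hyps by (simp add: algebra_simps Un_assoc)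
qed simp

text \<open>Each member enlarges a span by a factor of at most \<open>q ^ r\<close>. The whole
  family attains the largest possible size, so every subfamily must attain its own.\<close>

lemma direct_hereditary: "hereditary (direct r)"
  unfolding hereditary_def
proof (intro conjI allI impI)
  have "card (span {}) = 1" by (simp add: span_empty)
  then show "direct r {}" by (simp add: direct_def)
next
  fix T T' assume T: "direct r T" and T': "T' \<subseteq> T"
  have sub: "\<And>H. H \<in> T \<Longrightarrow> subspace K H V \<and> sdim H = r" and fT: "finite T"
    and cT: "card (span (\<Union>T)) = q ^ (r * card T)" using T by (auto simp: direct_def)
  note Tc = direct_Union_carrier[OF T]
  have cH: "card H = q ^ r" if "H \<in> T" for H using sub[OF that] card_subspace by auto
  have bound: "card (span (X \<union> \<Union>R)) \<le> card (span X) * q ^ (r * card R)" if R: "R \<subseteq> T" and X: "X \<subseteq> carrier V" for R X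
  proof -
    have fR: "finite R" using R fT finite_subset by auto
    have "card (span (X \<union> (\<Union>H\<in>R. H))) * (\<Prod>H\<in>R. card {\<zero>\<^bsub>V\<^esub>})
        \<le> card (span (X \<union> (\<Union>H\<in>R. {\<zero>\<^bsub>V\<^esub>}))) * (\<Prod>H\<in>R. card H)"
      using R X sub subspace_zero subspaceD(2) by (intro card_span_Un_family fR) auto
    moreover have "span (X \<union> (\<Union>H\<in>R. {\<zero>\<^bsub>V\<^esub>})) = span X"
      using span_insert_zero[OF X] by (cases "R = {}") auto
    moreover have "(\<Prod>H\<in>R. card H) = (q ^ r) ^ card R" using cH R by (subst prod.cong[OF refl, of _ _ "\<lambda>_. q ^ r"]) auto
    ultimately show ?thesis by (simp add: power_mult)
  qed
  have "card (span (\<Union>T')) \<le> q ^ (r * card T')" using bound[OF T', of "{}"] by (simp add: span_empty)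
  moreover have "q ^ (r * card T') \<le> card (span (\<Union>T'))"
  proof -
    have "q ^ (r * card T') * q ^ (r * card (T - T')) = q ^ (r * card T)"
      using card_Diff_subset[OF finite_subset[OF T' fT] T'] card_mono[OF fT T']
      by (simp flip: power_add distrib_left)
    also have "\<dots> = card (span (\<Union>T' \<union> \<Union>(T - T')))" using cT T' by (metis Un_Diff_cancel Union_Un_distrib sup.absorb2)
    also have "\<dots> \<le> card (span (\<Union>T')) * q ^ (r * card (T - T'))" using Tc T' by (intro bound) auto
    finally show ?thesis using q_ge_2 by simp
  qed
  ultimately show "direct r T'" using T' sub finite_subset[OF T' fT] by (auto simp: direct_def)
qed

lemma direct_insert:
  assumes T: "direct r T" and H: "subspace K H V" "sdim H = r" "H \<notin> T" and i: "H \<inter> span (\<Union>T) \<subseteq> {\<zero>\<^bsub>V\<^esub>}"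
  shows "direct r (insert H T)"
proof -
  have fT: "finite T" using T by (simp add: direct_def)
  note Tc = direct_Union_carrier[OF T]
  have sW: "subspace K (span (\<Union>T)) V" by (rule span_is_subspace[OF Tc])
  have "H \<inter> span (\<Union>T) = {\<zero>\<^bsub>V\<^esub>}" using i subspaceD(2)[OF H(1)] subspaceD(2)[OF sW] by auto
  then have "card (span (span (\<Union>T) \<union> H)) = q ^ (r * card T) * q ^ r"
    using card_span_Un[OF sW H(1)] card_subspace[OF H(1)] H(2) T by (simp add: direct_def Int_commute)
  moreover have "span (span (\<Union>T) \<union> H) = span (\<Union>(insert H T))"
    using span_span_Un[OF Tc subspaceD(1)[OF H(1)]] by (simp add: Un_commute)
  ultimately show ?thesis using T H fT by (auto simp: direct_def power_add mult.commute)
qed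

text \<open>Replacing every \<open>A H\<close> by \<open>H\<close> enlarges the span by at most the
  product of the ratios of sizes, and the resulting span has the maximal size; hence the span of the
  \<open>A H\<close> cannot be too small.\<close>

lemma direct_sdim_sum:
  assumes T: "direct r T" and A: "\<And>H. H \<in> T \<Longrightarrow> subspace K (A H) V \<and> A H \<subseteq> H"
  shows "(\<Sum>H\<in>T. sdim (A H)) \<le> sdim (span (\<Union>H\<in>T. A H))"
proof -
  have sub: "\<And>H. H \<in> T \<Longrightarrow> subspace K H V \<and> sdim H = r" and fT: "finite T"
    and cT: "card (span (\<Union>T)) = q ^ (r * card T)" using T by (auto simp: direct_def)
  have Ac: "(\<Union>H\<in>T. A H) \<subseteq> carrier V" using A subspaceD(1) by blast
  have "card (span ({} \<union> (\<Union>H\<in>T. H))) * (\<Prod>H\<in>T. card (A H)) \<le> card (span ({} \<union> (\<Union>H\<in>T. A H))) * (\<Prod>H\<in>T. card H)"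
    using A sub by (intro card_span_Un_family fT) auto
  moreover have "(\<Prod>H\<in>T. card H) = q ^ (r * card T)"
    using sub card_subspace by (subst prod.cong[OF refl, of _ _ "\<lambda>_. q ^ r"]) (auto simp: power_mult)
  moreover have "(\<Prod>H\<in>T. card (A H)) = q ^ (\<Sum>H\<in>T. sdim (A H))"
    using A card_subspace by (subst prod.cong[OF refl, of _ _ "\<lambda>H. q ^ sdim (A H)"]) (auto simp: power_sum)
  moreover have "card (span (\<Union>H\<in>T. A H)) = q ^ sdim (span (\<Union>H\<in>T. A H))"
    by (rule card_subspace[OF span_is_subspace[OF Ac]])
  ultimately have "q ^ (r * card T) * q ^ (\<Sum>H\<in>T. sdim (A H)) \<le> q ^ (r * card T) * q ^ sdim (span (\<Union>H\<in>T. A H))"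
    using cT by (simp add: mult.commute)
  then have "q ^ (\<Sum>H\<in>T. sdim (A H)) \<le> q ^ sdim (span (\<Union>H\<in>T. A H))" using q_ge_2 by simp
  then show ?thesis using q_ge_2 by (simp add: power_increasing_iff)
qed

text \<open>A union bound over the nonzero vectors of \<open>W\<close>: requiring \<open>H\<close>
  to contain a given line lowers the exponent \<open>r * (N - r)\<close> by \<open>N - r\<close>,
  where \<open>N\<close> is the dimension of the space.\<close>

lemma card_meeting_le:
  assumes W: "subspace K W V" and r: "1 \<le> r" "r \<le> sdim (carrier V)"
  shows "real (card {H. subspace K H V \<and> sdim H = r \<and> \<not> H \<inter> W \<subseteq> {\<zero>\<^bsub>V\<^esub>}})
    \<le> card W * (4 * real q ^ ((r - 1) * (sdim (carrier V) - r)))"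
proof -
  let ?b = "\<lambda>w. between (span {w}) (carrier V) r"
  let ?W = "W - {\<zero>\<^bsub>V\<^esub>}"
  have fW: "finite W" using W by (rule subspaceD)
  have Wc: "W \<subseteq> carrier V" using W by (rule subspaceD)
  have "{H. subspace K H V \<and> sdim H = r \<and> \<not> H \<inter> W \<subseteq> {\<zero>\<^bsub>V\<^esub>}} \<subseteq> (\<Union>w\<in>?W. ?b w)"
  proof
    fix H assume "H \<in> {H. subspace K H V \<and> sdim H = r \<and> \<not> H \<inter> W \<subseteq> {\<zero>\<^bsub>V\<^esub>}}"
    then obtain w where w: "w \<in> H" "w \<in> W" "w \<noteq> \<zero>\<^bsub>V\<^esub>" and H: "subspace K H V" "sdim H = r" by blast
    then have "H \<in> ?b w" using span_minimal[of "{w}" H] subspaceD(1)[OF H(1)] by (auto simp: between_def)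
    then show "H \<in> (\<Union>w\<in>?W. ?b w)" using w by blast
  qed
  then have "card {H. subspace K H V \<and> sdim H = r \<and> \<not> H \<inter> W \<subseteq> {\<zero>\<^bsub>V\<^esub>}} \<le> card (\<Union>w\<in>?W. ?b w)"
    using fW finite_between by (intro card_mono) auto
  also have "\<dots> \<le> (\<Sum>w\<in>?W. card (?b w))" using fW by (intro card_UN_le) auto
  finally have "real (card {H. subspace K H V \<and> sdim H = r \<and> \<not> H \<inter> W \<subseteq> {\<zero>\<^bsub>V\<^esub>}}) \<le> real (\<Sum>w\<in>?W. card (?b w))"
    by (rule of_nat_mono)
  also have "\<dots> = (\<Sum>w\<in>?W. real (card (?b w)))" by (rule of_nat_sum)
  also have "\<dots> \<le> (\<Sum>w\<in>?W. 4 * real q ^ ((r - 1) * (sdim (carrier V) - r)))"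
  proof (rule sum_mono)
    fix w assume w: "w \<in> ?W"
    then have wc: "w \<in> carrier V" using Wc by auto
    have sw: "subspace K (span {w}) V" using wc by (intro span_is_subspace) auto
    have "sdim (span (insert w {\<zero>\<^bsub>V\<^esub>})) = Suc (sdim {\<zero>\<^bsub>V\<^esub>})"
      using w wc by (intro sdim_span_insert subspace_zero) auto
    moreover have "span (insert w {\<zero>\<^bsub>V\<^esub>}) = span {w}"
      using span_insert_zero[of "{w}"] wc by (simp add: insert_commute)
    ultimately have "sdim (span {w}) = 1" using sdim_zero by simp
    then show "real (card (?b w)) \<le> 4 * real q ^ ((r - 1) * (sdim (carrier V) - r))"
      using card_between_bounds(2)[OF sw subspace_carrier subspaceD(1)[OF sw], of r] r by simp
  qed
  also have "\<dots> = real (card ?W) * (4 * real q ^ ((r - 1) * (sdim (carrier V) - r)))" by simp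
  also have "\<dots> \<le> card W * (4 * real q ^ ((r - 1) * (sdim (carrier V) - r)))"
    using fW by (intro mult_right_mono) (auto simp: card_mono)
  finally show ?thesis .
qed

text \<open>The subspaces are grouped by dimension. The zero subspace is kept apart so that it
  contributes exactly \<open>g 0\<close>, without the factor 4; later this 1 is subtracted off in
  \<open>(1 + eta) ^ i - 1\<close>.\<close>

lemma proper_subspace_sum_le:
  fixes g :: "nat \<Rightarrow> real"
  assumes H: "subspace K H V" "sdim H = r" and r: "1 \<le> r" and g: "\<And>a. 0 \<le> g a"
  shows "(\<Sum>A\<in>{A. subspace K A V \<and> A \<subseteq> H \<and> A \<noteq> H}. g (sdim A))
    \<le> g 0 + (\<Sum>a\<in>{1..<r}. 4 * real q ^ (a * (r - a)) * g a)"
proof -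
  let ?b = "\<lambda>a. between {\<zero>\<^bsub>V\<^esub>} H a"
  let ?S = "{A. subspace K A V \<and> A \<subseteq> H \<and> A \<noteq> H}"
  have z: "{\<zero>\<^bsub>V\<^esub>} \<subseteq> H" using subspaceD(2)[OF H(1)] by simp
  have S: "?S = (\<Union>a\<in>{0..<r}. ?b a)"
  proof (intro equalityI subsetI)
    fix A assume A: "A \<in> ?S"
    then have "sdim A < r" using sdim_mono[of A H] sdim_eq_imp_eq[of A H] H by (metis (lifting) mem_Collect_eq le_neq_implies_less)
    then show "A \<in> (\<Union>a\<in>{0..<r}. ?b a)" using A subspaceD(2)[of A] by (auto simp: between_def)
  qed (use H in \<open>auto simp: between_def\<close>)
  have "(\<Sum>A\<in>?S. g (sdim A)) = (\<Sum>a\<in>{0..<r}. \<Sum>A\<in>?b a. g (sdim A))"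
    unfolding S
  proof (intro sum.UNION_disjoint ballI impI)
    show "finite (?b a)" for a by (rule finite_between)
    show "?b a \<inter> ?b a' = {}" if "a \<noteq> a'" for a a' using that by (auto simp: between_def)
  qed simp
  also have "\<dots> = (\<Sum>a\<in>{0..<r}. card (?b a) * g a)" by (intro sum.cong) (auto simp: between_def)
  also have "\<dots> = card (?b 0) * g 0 + (\<Sum>a\<in>{1..<r}. card (?b a) * g a)"
    using r by (simp add: sum.atLeast_Suc_lessThan)
  also have "?b 0 = {{\<zero>\<^bsub>V\<^esub>}}"
  proof (intro equalityI subsetI)
    fix A assume "A \<in> ?b 0"
    then have "subspace K A V" "sdim A = 0" by (simp_all add: between_def)
    then show "A \<in> {{\<zero>\<^bsub>V\<^esub>}}" using sdim_eq_0D by blast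
  qed (use subspace_zero z sdim_zero in \<open>simp add: between_def\<close>)
  also have "real (card {{\<zero>\<^bsub>V\<^esub>}}) * g 0 + (\<Sum>a\<in>{1..<r}. card (?b a) * g a)
      \<le> g 0 + (\<Sum>a\<in>{1..<r}. 4 * real q ^ (a * (r - a)) * g a)"
  proof -
    have "card (?b a) * g a \<le> 4 * real q ^ (a * (r - a)) * g a" if "a \<in> {1..<r}" for a
      using card_between_bounds(2)[OF subspace_zero H(1) z, of a] that H(2) g
      by (intro mult_right_mono) (simp_all add: sdim_zero)
    then have "(\<Sum>a\<in>{1..<r}. card (?b a) * g a) \<le> (\<Sum>a\<in>{1..<r}. 4 * real q ^ (a * (r - a)) * g a)"
      by (rule sum_mono)
    then show ?thesis by simp
  qed
  finally show ?thesis .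
qed

end

section \<open>Probability that given subspaces are simultaneously null\<close>

context finite_scalar_field
begin

definition subs :: "nat \<Rightarrow> nat \<Rightarrow> (nat \<Rightarrow> 'a) set set" where
  "subs N r = {H. subspace F H (func_space {..<N}) \<and>
     finite_vectorspace.sdim F (func_space {..<N}) H = r}"

context
  fixes N k m :: nat
  assumes k: "2 \<le> k"
begin

interpretation V: finite_vectorspace F "func_space {..<N}" by (rule finite_vectorspace_coord)
interpretation L: finite_vectorspace F "func_space (ksubs N k)" by (rule finite_vectorspace_ksubs)

abbreviation "homs \<equiv> exterior_hom F k N m"
abbreviation "nul \<equiv> null_subspace F k N m"
abbreviation "null_prob r \<equiv> 1 / real q ^ (m * (r choose k))"

lemma exterior_hom_eq: "homs = lin_maps (ksubs N k) {..<m}"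
  by (simp add: exterior_hom_def lin_maps_def exterior_power_eq coord_space_eq)

lemma null_subspace_iff:
  assumes "subspace F H (func_space {..<N})"
  shows "nul \<Theta> H \<longleftrightarrow> (\<forall>y\<in>exterior_power_of F k N H. \<Theta> y = (\<lambda>j\<in>{..<m}. \<zero>))"
proof -
  have "H \<subseteq> vecs {..<N}" using V.subspaceD(1)[OF assms] by simp
  then have "exterior_power_of F k N H \<noteq> {}" using L.subspaceD(2)[OF subspace_ext] by blast
  then show ?thesis using assms by (auto simp: null_subspace_def coord_space_eq)
qed

text \<open>All members are null precisely when the map vanishes on the span of their exterior
  powers, and \<open>card_annihilator\<close> counts such maps.\<close>

lemma prob_all_null:
  assumes T: "\<And>H. H \<in> T \<Longrightarrow> subspace F H (func_space {..<N})"
  shows "prob_all homs nul T = 1 / real (card (L.module.span (\<Union>H\<in>T. exterior_power_of F k N H))) ^ m"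
proof -
  let ?X = "\<Union>H\<in>T. exterior_power_of F k N H"
  have Xc: "?X \<subseteq> vecs (ksubs N k)"
    using T V.subspaceD(1) ext_subset_carrier by (intro UN_least) (metis func_space_simps(1))
  have sX: "subspace F (L.module.span ?X) (func_space (ksubs N k))"
    using Xc by (intro L.span_is_subspace) simp
  have "{\<Theta> \<in> homs. \<forall>H\<in>T. nul \<Theta> H} = annihilator (ksubs N k) {..<m} ?X"
    using null_subspace_iff[OF T] unfolding annihilator_def exterior_hom_eq by blast
  also have "\<dots> = annihilator (ksubs N k) {..<m} (L.module.span ?X)"
    by (rule annihilator_span[OF Xc finite_ksubs, symmetric])
  finally have e: "{\<Theta> \<in> homs. \<forall>H\<in>T. nul \<Theta> H} = annihilator (ksubs N k) {..<m} (L.module.span ?X)" .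
  have "card (annihilator (ksubs N k) {..<m} (L.module.span ?X)) * card (L.module.span ?X) ^ m = card homs"
    using card_annihilator[OF finite_ksubs finite_lessThan sX, of m] by (simp add: exterior_hom_eq)
  moreover have "0 < card homs"
    using exterior_hom_finite_nonempty[OF field_axioms finite_scalars] by (simp add: card_gt_0_iff)
  ultimately show ?thesis unfolding prob_all_def e
    by (metis (no_types, lifting) divide_divide_eq_left divide_self_if mult.commute mult_eq_0_iff nonzero_divide_mult_cancel_left of_nat_0_eq_iff of_nat_mult of_nat_power less_irrefl)
qed

text \<open>Independence of the nullity events of a direct family: the joint probability is the
  product of the individual ones.\<close>

lemma prob_all_direct:
  assumes "V.direct r T" "1 \<le> r"
  shows "prob_all homs nul T = null_prob r ^ card T"
proof -
  have "prob_all homs nul T = 1 / real (q ^ (card T * (r choose k))) ^ m"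
    using prob_all_null[of T] card_span_ext_direct[OF assms, of k] assms(1) k by (auto simp: V.direct_def)
  then show ?thesis by (simp add: power_divide mult_ac flip: power_mult)
qed

text \<open>The product over \<open>T\<close> is the price of dependence; it factors over the
  members of \<open>T\<close> because \<open>card_span_ext_joint\<close> involves only pairwise
  intersections.\<close>

lemma prob_all_insert:
  assumes T: "V.direct r T" and r: "1 \<le> r" and H: "H \<in> subs N r"
  shows "prob_all homs nul (insert H T)
    \<le> null_prob r ^ Suc (card T) * (\<Prod>H'\<in>T. real q ^ (m * (V.sdim (H \<inter> H') choose k)))"
proof -
  let ?c = "card (L.module.span (\<Union>H'\<in>insert H T. exterior_power_of F k N H'))"
  let ?s = "\<Sum>H'\<in>T. V.sdim (H \<inter> H') choose k"
  have H': "subspace F H (func_space {..<N})" "V.sdim H = r" using H by (auto simp: subs_def)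
  have q0: "0 < real q" using V.q_ge_2 by simp
  have le: "q ^ (Suc (card T) * (r choose k)) \<le> ?c * q ^ ?s" by (rule card_span_ext_joint[OF T r k H'])
  then have c0: "0 < ?c" using V.q_ge_2 by (cases "?c = 0") auto
  have "real q ^ (Suc (card T) * (r choose k)) \<le> real ?c * real q ^ ?s"
    using le by (metis of_nat_le_iff of_nat_mult of_nat_power)
  then have "(real q ^ (Suc (card T) * (r choose k))) ^ m \<le> (real ?c * real q ^ ?s) ^ m"
    using q0 by (intro power_mono) auto
  then have "1 / real ?c ^ m \<le> (real q ^ ?s) ^ m / (real q ^ (Suc (card T) * (r choose k))) ^ m"
    using c0 q0 by (simp add: field_simps power_mult_distrib)
  also have "(real q ^ ?s) ^ m = real q ^ (\<Sum>H'\<in>T. m * (V.sdim (H \<inter> H') choose k))"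
    by (simp add: sum_distrib_left mult.commute flip: power_mult)
  also have "\<dots> = (\<Prod>H'\<in>T. real q ^ (m * (V.sdim (H \<inter> H') choose k)))" by (rule power_sum)
  also have "(real q ^ (Suc (card T) * (r choose k))) ^ m = (real q ^ (m * (r choose k))) ^ Suc (card T)"
    by (simp only: power_mult[symmetric] mult_ac)
  finally have b: "1 / real ?c ^ m \<le> (\<Prod>H'\<in>T. real q ^ (m * (V.sdim (H \<inter> H') choose k))) / (real q ^ (m * (r choose k))) ^ Suc (card T)" .
  have "prob_all homs nul (insert H T) = 1 / real ?c ^ m"
    using T H' by (intro prob_all_null) (auto simp: V.direct_def)
  also note b
  also have "(\<Prod>H'\<in>T. real q ^ (m * (V.sdim (H \<inter> H') choose k))) / (real q ^ (m * (r choose k))) ^ Suc (card T)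
      = null_prob r ^ Suc (card T) * (\<Prod>H'\<in>T. real q ^ (m * (V.sdim (H \<inter> H') choose k)))"
    by (simp add: power_divide)
  finally show ?thesis .
qed

end

end

context finite_scalar_field
begin

text \<open>
  \<open>lam\<close> is the expected number of null subspaces of dimension \<open>r\<close>. Given a family of \<open>i\<close> of them in
  direct sum, \<open>lam * eps\<close> bounds the conditional expected number of further ones that break directness:
  the first term of \<open>eps\<close> counts those that meet every member trivially, and the summands of \<open>eta\<close> account
  for an \<open>a\<close>-dimensional intersection with one member.
\<close>

definition eta :: "nat \<Rightarrow> nat \<Rightarrow> nat \<Rightarrow> nat \<Rightarrow> real" where
  "eta N k m r = (\<Sum>a\<in>{1..<r}. 4 * real q ^ (a * (r - a)) * (real q ^ (m * (a choose k)) / real q ^ (a * (N - r))))"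

definition eps :: "nat \<Rightarrow> nat \<Rightarrow> nat \<Rightarrow> nat \<Rightarrow> nat \<Rightarrow> real" where
  "eps N k m r i = 4 * (real q ^ (i * r) / real q ^ (N - r)) + 4 * ((1 + eta N k m r) ^ i - 1)"

definition lam :: "nat \<Rightarrow> nat \<Rightarrow> nat \<Rightarrow> nat \<Rightarrow> real" where
  "lam N k m r = card (subs N r) * (1 / real q ^ (m * (r choose k)))"

definition prob_none :: "nat \<Rightarrow> nat \<Rightarrow> nat \<Rightarrow> nat \<Rightarrow> real" where
  "prob_none N k m r = card {\<Theta> \<in> exterior_hom F k N m. \<forall>H\<in>subs N r. \<not> null_subspace F k N m \<Theta> H}
     / card (exterior_hom F k N m)"

lemma q_real: "2 \<le> real q" "0 < real q" "1 \<le> real q"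
  using finite_vectorspace.q_ge_2[OF finite_vectorspace_coord] by auto

lemma eta_nonneg: "0 \<le> eta N k m r"
  unfolding eta_def by (intro sum_nonneg) simp

lemma eps_nonneg: "0 \<le> eps N k m r i"
  using eta_nonneg one_le_power[of "1 + eta N k m r" i] by (simp add: eps_def)

lemma lam_nonneg: "0 \<le> lam N k m r"
  by (simp add: lam_def)

lemma prob_none_nonneg: "0 \<le> prob_none N k m r"
  by (simp add: prob_none_def)

section \<open>Counting bounds and moments for fixed parameters\<close>

context
  fixes N k m r :: nat
  assumes k: "2 \<le> k" and r: "1 \<le> r" "r \<le> N"
begin

interpretation V: finite_vectorspace F "func_space {..<N}" by (rule finite_vectorspace_coord)
interpretation L: finite_vectorspace F "func_space (ksubs N k)" by (rule finite_vectorspace_ksubs)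

abbreviation "Sr \<equiv> subs N r"
abbreviation "Pr \<equiv> prob_all (exterior_hom F k N m) (null_subspace F k N m)"
abbreviation "np \<equiv> 1 / real q ^ (m * (r choose k))"
abbreviation "D \<equiv> V.direct r"

lemma subs_between: "Sr = V.between {\<zero>\<^bsub>func_space {..<N}\<^esub>} (carrier (func_space {..<N})) r"
proof (intro equalityI subsetI)
  fix H assume "H \<in> Sr"
  then have H: "subspace F H (func_space {..<N})" "V.sdim H = r" by (simp_all add: subs_def)
  then show "H \<in> V.between {\<zero>\<^bsub>func_space {..<N}\<^esub>} (carrier (func_space {..<N})) r"
    using V.subspaceD(1,2)[OF H(1)] unfolding V.between_def by blast
qed (simp add: subs_def V.between_def)

lemma sdim_carrier: "V.sdim (carrier (func_space {..<N})) = N"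
  using sdim_coord[of N] by simp

lemma finite_subs: "finite Sr"
  unfolding subs_between by (rule V.finite_between)

lemma zero_subset: "{\<zero>\<^bsub>func_space {..<N}\<^esub>} \<subseteq> carrier (func_space {..<N})"
  using V.subspaceD(1)[OF V.subspace_zero] .

lemma card_subs_ge: "real q ^ (r * (N - r)) \<le> card Sr"
  using V.card_between_bounds(1)[OF V.subspace_zero V.subspace_carrier zero_subset, of r] r
  unfolding subs_between sdim_carrier V.sdim_zero by simp

lemma card_subs_le: "card Sr \<le> 4 * real q ^ (r * (N - r))"
  using V.card_between_bounds(2)[OF V.subspace_zero V.subspace_carrier zero_subset, of r] r
  unfolding subs_between sdim_carrier V.sdim_zero by simp

lemma card_subs: "real (card Sr) = (\<Prod>i=0..<r. (real q ^ N - real q ^ i) / (real q ^ r - real q ^ i))"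
  using V.card_between_real[OF V.subspace_zero V.subspace_carrier zero_subset, of r] r
  unfolding subs_between sdim_carrier V.sdim_zero by simp

text \<open>The factor by which meeting a member of a direct family in \<open>A\<close> may raise
  the probability bound of \<open>prob_all_insert\<close>.\<close>

definition weight :: "(nat \<Rightarrow> 'a) set \<Rightarrow> real" where
  "weight A = real q ^ (m * (V.sdim A choose k))"

context
  fixes T and i :: nat
  assumes T: "T \<in> fam D Sr i"
begin

lemma T_direct: "D T" "card T = i" "finite T" "T \<subseteq> Sr"
  using T by (auto simp: fam_def V.direct_def)

lemma span_T: "subspace F (V.module.span (\<Union>T)) (func_space {..<N})" "card (V.module.span (\<Union>T)) = q ^ (i * r)"
  using V.span_is_subspace[OF V.direct_Union_carrier[OF T_direct(1)]] T_direct
  by (auto simp: V.direct_def mult.commute)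

text \<open>Members and bad extensions alike meet the span of \<open>T\<close> in a nonzero vector.
  The members are included because \<open>card_fam_lower\<close> excludes them together with the bad
  extensions.\<close>

lemma card_meeting_T:
  "real (card (T \<union> bad_ext D Sr T)) \<le> 4 * real q ^ (i * r) * real q ^ ((r - 1) * (N - r))"
proof -
  let ?W = "V.module.span (\<Union>T)"
  let ?M = "{H. subspace F H (func_space {..<N}) \<and> V.sdim H = r \<and> \<not> H \<inter> ?W \<subseteq> {\<zero>\<^bsub>func_space {..<N}\<^esub>}}"
  have "T \<union> bad_ext D Sr T \<subseteq> ?M"
  proof
    fix H assume H: "H \<in> T \<union> bad_ext D Sr T"
    then have HS: "subspace F H (func_space {..<N})" "V.sdim H = r"
      using T_direct(4) by (auto simp: bad_ext_def subs_def)
    have "\<not> H \<inter> ?W \<subseteq> {\<zero>\<^bsub>func_space {..<N}\<^esub>}"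
    proof (cases "H \<in> T")
      case True
      then have "H \<subseteq> ?W" using V.in_own_span[OF V.direct_Union_carrier[OF T_direct(1)]] by blast
      moreover have "H \<noteq> {\<zero>\<^bsub>func_space {..<N}\<^esub>}" using HS(2) V.sdim_zero r by (metis not_one_le_zero)
      ultimately show ?thesis using V.subspaceD(2)[OF HS(1)] by blast
    next
      case False
      then have "\<not> D (insert H T)" using H by (simp add: bad_ext_def)
      then show ?thesis using V.direct_insert[OF T_direct(1) HS False] by blast
    qed
    then show "H \<in> ?M" using HS by blast
  qed
  moreover have "finite ?M" by (rule finite_subset[OF _ finite_subs]) (auto simp: subs_def)
  ultimately have "card (T \<union> bad_ext D Sr T) \<le> card ?M" by (intro card_mono)
  then have "real (card (T \<union> bad_ext D Sr T)) \<le> real (card ?M)" by (rule of_nat_mono)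
  also have "\<dots> \<le> card ?W * (4 * real q ^ ((r - 1) * (N - r)))"
    using V.card_meeting_le[OF span_T(1) r(1)] r(2) unfolding sdim_carrier by simp
  also have "\<dots> = 4 * real q ^ (i * r) * real q ^ ((r - 1) * (N - r))" by (simp add: span_T(2))
  finally show ?thesis .
qed

definition trace :: "(nat \<Rightarrow> 'a) set \<Rightarrow> (nat \<Rightarrow> 'a) set \<Rightarrow> (nat \<Rightarrow> 'a) set" where
  "trace H = (\<lambda>H'\<in>T. H \<inter> H')"

definition proper :: "(nat \<Rightarrow> 'a) set \<Rightarrow> (nat \<Rightarrow> 'a) set set" where
  "proper H' = {A. subspace F A (func_space {..<N}) \<and> A \<subseteq> H' \<and> A \<noteq> H'}"

lemma T_subspace: "H' \<in> T \<Longrightarrow> subspace F H' (func_space {..<N}) \<and> V.sdim H' = r"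
  using T_direct(4) by (auto simp: subs_def)

lemma bad_subspace: "H \<in> bad_ext D Sr T \<Longrightarrow> subspace F H (func_space {..<N}) \<and> V.sdim H = r \<and> H \<notin> T"
  by (auto simp: bad_ext_def subs_def)

text \<open>A member contained in \<open>H\<close> would equal \<open>H\<close> by dimension, but
  \<open>H\<close> is not in \<open>T\<close>. Hence only dimensions \<open>a < r\<close> occur in
  \<open>eta\<close>.\<close>

lemma trace_proper: "H \<in> bad_ext D Sr T \<Longrightarrow> trace H \<in> PiE T proper"
proof -
  assume H: "H \<in> bad_ext D Sr T"
  have "H \<inter> H' \<in> proper H'" if H': "H' \<in> T" for H'
  proof -
    have "H \<inter> H' \<noteq> H'"
    proof
      assume "H \<inter> H' = H'"
      then have "H' = H" using V.sdim_eq_imp_eq[of H' H] bad_subspace[OF H] T_subspace[OF H'] by (metis inf.absorb_iff2 inf_commute)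
      then show False using bad_subspace[OF H] H' by blast
    qed
    then show ?thesis using V.subspace_Int bad_subspace[OF H] T_subspace[OF H'] by (auto simp: proper_def)
  qed
  then show ?thesis by (simp add: trace_def)
qed

text \<open>Every \<open>H\<close> with trace \<open>P\<close> contains the span of the
  \<open>P H'\<close>. By directness of \<open>T\<close> its dimension is at least the sum of
  theirs, and each dimension prescribed in this way costs a factor \<open>q ^ (N - r)\<close> in the
  count.\<close>

lemma card_trace_fibre:
  assumes P: "P \<in> PiE T proper"
  shows "card {H \<in> bad_ext D Sr T. trace H = P} * (\<Prod>H'\<in>T. real q ^ (V.sdim (P H') * (N - r))) \<le> 4 * real q ^ (r * (N - r))"
proof (cases "{H \<in> bad_ext D Sr T. trace H = P} = {}")
  case False
  then obtain H0 where H0: "H0 \<in> bad_ext D Sr T" "trace H0 = P" by blast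
  have PH: "subspace F (P H') (func_space {..<N}) \<and> P H' \<subseteq> H'" if "H' \<in> T" for H'
    using PiE_mem[OF P that] by (simp add: proper_def)
  let ?U = "V.module.span (\<Union>H'\<in>T. P H')"
  have Uc: "(\<Union>H'\<in>T. P H') \<subseteq> carrier (func_space {..<N})" using PH V.subspaceD(1) by blast
  have sU: "subspace F ?U (func_space {..<N})" by (rule V.span_is_subspace[OF Uc])
  have sub: "?U \<subseteq> H" if H: "H \<in> bad_ext D Sr T" "trace H = P" for H
  proof (rule V.span_minimal)
    show "(\<Union>H'\<in>T. P H') \<subseteq> H" unfolding H(2)[symmetric] by (auto simp: trace_def)
  qed (use bad_subspace[OF H(1)] in blast)
  have s: "(\<Sum>H'\<in>T. V.sdim (P H')) \<le> V.sdim ?U" by (rule V.direct_sdim_sum[OF T_direct(1) PH])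
  have ur: "V.sdim ?U \<le> r" using V.sdim_mono[OF sU _ sub[OF H0]] bad_subspace[OF H0(1)] by auto
  have "{H \<in> bad_ext D Sr T. trace H = P} \<subseteq> V.between ?U (carrier (func_space {..<N})) r"
    using sub bad_subspace V.subspaceD(1) unfolding V.between_def by blast
  then have "card {H \<in> bad_ext D Sr T. trace H = P} \<le> card (V.between ?U (carrier (func_space {..<N})) r)"
    by (rule card_mono[OF V.finite_between])
  then have "real (card {H \<in> bad_ext D Sr T. trace H = P}) \<le> real (card (V.between ?U (carrier (func_space {..<N})) r))"
    by (rule of_nat_mono)
  also have "\<dots> \<le> 4 * real q ^ ((r - V.sdim ?U) * (N - r))"
    using V.card_between_bounds(2)[OF sU V.subspace_carrier V.subspaceD(1)[OF sU] ur] r(2) unfolding sdim_carrier by simp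
  finally have le: "card {H \<in> bad_ext D Sr T. trace H = P} * (\<Prod>H'\<in>T. real q ^ (V.sdim (P H') * (N - r)))
      \<le> 4 * real q ^ ((r - V.sdim ?U) * (N - r)) * (\<Prod>H'\<in>T. real q ^ (V.sdim (P H') * (N - r)))"
    by (intro mult_right_mono prod_nonneg) auto
  have pe: "(\<Prod>H'\<in>T. real q ^ (V.sdim (P H') * (N - r))) = real q ^ ((\<Sum>H'\<in>T. V.sdim (P H')) * (N - r))"
    by (simp add: power_sum sum_distrib_right)
  note le
  also have "4 * real q ^ ((r - V.sdim ?U) * (N - r)) * (\<Prod>H'\<in>T. real q ^ (V.sdim (P H') * (N - r)))
      = 4 * real q ^ (((r - V.sdim ?U) + (\<Sum>H'\<in>T. V.sdim (P H'))) * (N - r))"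
    unfolding pe by (simp add: power_add add_mult_distrib)
  also have "\<dots> \<le> 4 * real q ^ (r * (N - r))"
    using s ur q_real by (intro mult_left_mono power_increasing mult_le_mono1) auto
  finally show ?thesis .
next
  case True
  show ?thesis unfolding True by simp
qed

text \<open>The bad extensions are grouped by trace. Those with trivial trace are bounded by
  \<open>card_meeting_T\<close>. For the others the fibre bound is a product over the members of
  \<open>T\<close>, so the sum over all traces factors into \<open>i\<close> sums, each at most
  \<open>1 + eta\<close>; removing the trivial trace subtracts 1.\<close>

lemma sum_weights_le: "(\<Sum>H\<in>bad_ext D Sr T. \<Prod>H'\<in>T. weight (H \<inter> H'))
    \<le> 4 * real q ^ (i * r) * real q ^ ((r - 1) * (N - r)) + 4 * real q ^ (r * (N - r)) * ((1 + eta N k m r) ^ i - 1)"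
proof -
  let ?B = "bad_ext D Sr T"
  let ?z = "\<lambda>H'\<in>T. {\<zero>\<^bsub>func_space {..<N}\<^esub>}"
  let ?g = "\<lambda>A. weight A / real q ^ (V.sdim A * (N - r))"
  let ?w = "\<lambda>P. \<Prod>H'\<in>T. weight (P H')"
  have fB: "finite ?B" using finite_subs by (simp add: bad_ext_def)
  have fproper: "finite (proper H')" for H'
    by (rule finite_subset[of _ "Pow (carrier (func_space {..<N}))"])
      (use V.finite_carrier V.subspaceD(1) in \<open>auto simp: proper_def simp del: func_space_simps\<close>)
  have fP: "finite (PiE T proper)" using T_direct(3) fproper by (intro finite_PiE)
  have w_trace: "(\<Prod>H'\<in>T. weight (H \<inter> H')) = ?w (trace H)" for H
    by (intro prod.cong) (auto simp: trace_def)
  have w0: "weight {\<zero>\<^bsub>func_space {..<N}\<^esub>} = 1" unfolding weight_def V.sdim_zero using k by (simp add: binomial_eq_0)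
  have g0: "?g {\<zero>\<^bsub>func_space {..<N}\<^esub>} = 1" unfolding w0 V.sdim_zero by simp
  have wz: "?w ?z = 1" "(\<Prod>H'\<in>T. ?g (?z H')) = 1" using w0 g0 by (simp_all del: func_space_simps)
  have zP: "?z \<in> PiE T proper"
  proof -
    have "{\<zero>\<^bsub>func_space {..<N}\<^esub>} \<in> proper H'" if "H' \<in> T" for H'
    proof -
      have "{\<zero>\<^bsub>func_space {..<N}\<^esub>} \<noteq> H'" using V.sdim_zero T_subspace[OF that] r by (metis not_one_le_zero)
      then show ?thesis using V.subspace_zero V.subspaceD(2)[of H'] T_subspace[OF that] unfolding proper_def by blast
    qed
    then show ?thesis by (simp del: func_space_simps)
  qed
  have "(\<Sum>H\<in>?B. \<Prod>H'\<in>T. weight (H \<inter> H')) = (\<Sum>H\<in>?B. ?w (trace H))" by (simp add: w_trace)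
  also have "\<dots> = (\<Sum>P\<in>PiE T proper. \<Sum>H\<in>{H \<in> ?B. trace H = P}. ?w (trace H))"
    using trace_proper by (intro sum.group[symmetric] fB fP) blast
  also have "\<dots> = (\<Sum>P\<in>PiE T proper. card {H \<in> ?B. trace H = P} * ?w P)"
    by (intro sum.cong) auto
  also have "\<dots> = card {H \<in> ?B. trace H = ?z} * ?w ?z + (\<Sum>P\<in>PiE T proper - {?z}. card {H \<in> ?B. trace H = P} * ?w P)"
    by (rule sum.remove[OF fP zP])
  also have "\<dots> \<le> 4 * real q ^ (i * r) * real q ^ ((r - 1) * (N - r))
      + (\<Sum>P\<in>PiE T proper - {?z}. 4 * real q ^ (r * (N - r)) * (\<Prod>H'\<in>T. ?g (P H')))"
  proof (intro add_mono sum_mono)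
    have "card {H \<in> ?B. trace H = ?z} \<le> card (T \<union> ?B)" using T_direct(3) fB by (intro card_mono) auto
    then have "real (card {H \<in> ?B. trace H = ?z}) \<le> real (card (T \<union> ?B))" by (rule of_nat_mono)
    then show "real (card {H \<in> ?B. trace H = ?z}) * ?w ?z \<le> 4 * real q ^ (i * r) * real q ^ ((r - 1) * (N - r))"
      unfolding wz(1) using card_meeting_T by linarith
  next
    fix P assume "P \<in> PiE T proper - {?z}"
    then have P: "P \<in> PiE T proper" by blast
    let ?c = "real (card {H \<in> ?B. trace H = P})" and ?Q = "\<Prod>H'\<in>T. real q ^ (V.sdim (P H') * (N - r))"
    have Q0: "0 < ?Q" using q_real by (intro prod_pos) auto
    have W0: "0 \<le> ?w P" by (intro prod_nonneg) (simp add: weight_def)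
    have "?c * ?w P = (?c * ?Q) * (?w P / ?Q)" using Q0 by simp
    also have "\<dots> \<le> 4 * real q ^ (r * (N - r)) * (?w P / ?Q)"
      using card_trace_fibre[OF P] Q0 W0 by (intro mult_right_mono) auto
    also have "?w P / ?Q = (\<Prod>H'\<in>T. ?g (P H'))" by (rule prod_dividef[symmetric])
    finally show "?c * ?w P \<le> 4 * real q ^ (r * (N - r)) * (\<Prod>H'\<in>T. ?g (P H'))" .
  qed
  also have "(\<Sum>P\<in>PiE T proper - {?z}. 4 * real q ^ (r * (N - r)) * (\<Prod>H'\<in>T. ?g (P H')))
      = 4 * real q ^ (r * (N - r)) * ((\<Sum>P\<in>PiE T proper. \<Prod>H'\<in>T. ?g (P H')) - 1)"
    using sum.remove[OF fP zP, of "\<lambda>P. \<Prod>H'\<in>T. ?g (P H')"] wz(2) by (simp add: sum_distrib_left del: func_space_simps)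
  finally have le: "(\<Sum>H\<in>?B. \<Prod>H'\<in>T. weight (H \<inter> H')) \<le> 4 * real q ^ (i * r) * real q ^ ((r - 1) * (N - r))
      + 4 * real q ^ (r * (N - r)) * ((\<Sum>P\<in>PiE T proper. \<Prod>H'\<in>T. ?g (P H')) - 1)" .
  have "(\<Sum>P\<in>PiE T proper. \<Prod>H'\<in>T. ?g (P H')) = (\<Prod>H'\<in>T. \<Sum>A\<in>proper H'. ?g A)"
    using prod_sum_PiE[OF T_direct(3) fproper, where f = "\<lambda>_. ?g"] by simp
  also have "(\<Prod>H'\<in>T. \<Sum>A\<in>proper H'. ?g A) \<le> (\<Prod>H'\<in>T. 1 + eta N k m r)"
  proof (intro prod_mono conjI)
    fix H' assume H': "H' \<in> T"
    let ?h = "\<lambda>a. real q ^ (m * (a choose k)) / real q ^ (a * (N - r))"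
    have "(\<Sum>A\<in>proper H'. ?h (V.sdim A)) \<le> ?h 0 + (\<Sum>a\<in>{1..<r}. 4 * real q ^ (a * (r - a)) * ?h a)"
      unfolding proper_def using T_subspace[OF H'] by (intro V.proper_subspace_sum_le r) auto
    then show "(\<Sum>A\<in>proper H'. ?g A) \<le> 1 + eta N k m r" using k by (simp add: weight_def eta_def binomial_eq_0)
    show "0 \<le> (\<Sum>A\<in>proper H'. ?g A)" by (intro sum_nonneg) (simp add: weight_def)
  qed
  also have "(\<Prod>H'\<in>T. 1 + eta N k m r) = (1 + eta N k m r) ^ i" using T_direct(2) by simp
  finally have "(\<Sum>P\<in>PiE T proper. \<Prod>H'\<in>T. ?g (P H')) - 1 \<le> (1 + eta N k m r) ^ i - 1" by simp
  then have "4 * real q ^ (r * (N - r)) * ((\<Sum>P\<in>PiE T proper. \<Prod>H'\<in>T. ?g (P H')) - 1)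
      \<le> 4 * real q ^ (r * (N - r)) * ((1 + eta N k m r) ^ i - 1)"
    by (rule mult_left_mono) simp
  then show ?thesis using le by linarith
qed

end

lemma split_power: "real q ^ ((r - 1) * (N - r)) = real q ^ (r * (N - r)) / real q ^ (N - r)"
proof -
  have "r * (N - r) = (r - 1) * (N - r) + (N - r)" using r by (cases r) simp_all
  then show ?thesis using q_real by (simp add: power_add)
qed

text \<open>The bound of \<open>sum_weights_le\<close> is \<open>q ^ (r * (N - r)) * eps\<close>.
  That power of \<open>q\<close> is at most the number of \<open>r\<close>-dimensional subspaces,
  which together with one factor \<open>np\<close> gives \<open>lam\<close>.\<close>

lemma sum_bad_le:
  assumes T: "T \<in> fam D Sr i"
  shows "(\<Sum>H\<in>bad_ext D Sr T. Pr (insert H T)) \<le> np ^ i * (lam N k m r * eps N k m r i)"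
proof -
  note Td = T_direct[OF T]
  have "(\<Sum>H\<in>bad_ext D Sr T. Pr (insert H T)) \<le> (\<Sum>H\<in>bad_ext D Sr T. np ^ Suc i * (\<Prod>H'\<in>T. weight (H \<inter> H')))"
    using prob_all_insert[OF k Td(1) r(1)] Td(2) unfolding weight_def
    by (intro sum_mono) (auto simp: bad_ext_def)
  also have "\<dots> = np ^ Suc i * (\<Sum>H\<in>bad_ext D Sr T. \<Prod>H'\<in>T. weight (H \<inter> H'))" by (simp only: sum_distrib_left)
  also have "\<dots> \<le> np ^ Suc i * (4 * real q ^ (i * r) * real q ^ ((r - 1) * (N - r)) + 4 * real q ^ (r * (N - r)) * ((1 + eta N k m r) ^ i - 1))"
    by (intro mult_left_mono sum_weights_le[OF T]) simp
  also have "\<dots> = np ^ Suc i * (real q ^ (r * (N - r)) * eps N k m r i)"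
    unfolding split_power eps_def by (simp add: algebra_simps)
  also have "\<dots> \<le> np ^ Suc i * (card Sr * eps N k m r i)"
    using card_subs_ge eps_nonneg by (intro mult_left_mono mult_right_mono) auto
  finally show ?thesis by (simp add: lam_def algebra_simps)
qed

lemma sum_sum_bad_le:
  "(\<Sum>T\<in>fam D Sr i. \<Sum>H\<in>bad_ext D Sr T. Pr (insert H T)) \<le> (lam N k m r) ^ Suc i * eps N k m r i"
proof -
  have "(\<Sum>T\<in>fam D Sr i. \<Sum>H\<in>bad_ext D Sr T. Pr (insert H T)) \<le> (\<Sum>T\<in>fam D Sr i. np ^ i * (lam N k m r * eps N k m r i))"
    by (intro sum_mono sum_bad_le)
  also have "\<dots> = card (fam D Sr i) * (np ^ i * (lam N k m r * eps N k m r i))" by simp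
  also have "\<dots> \<le> real (card Sr) ^ i * (np ^ i * (lam N k m r * eps N k m r i))"
  proof (rule mult_right_mono)
    have "card (fam D Sr i) \<le> card Sr choose i" by (rule card_fam_le[OF finite_subs])
    also have "\<dots> \<le> card Sr ^ i"
      by (cases "i \<le> card Sr") (simp_all add: binomial_le_pow binomial_eq_0)
    finally have "real (card (fam D Sr i)) \<le> real (card Sr ^ i)" by (rule of_nat_mono)
    then show "real (card (fam D Sr i)) \<le> real (card Sr) ^ i" by simp
    show "0 \<le> np ^ i * (lam N k m r * eps N k m r i)" using lam_nonneg eps_nonneg by simp
  qed
  also have "\<dots> = (lam N k m r) ^ Suc i * eps N k m r i" by (simp add: lam_def power_divide algebra_simps)
  finally show ?thesis .
qed

lemma sum_direct: "(\<Sum>T\<in>fam D Sr i. Pr T) = card (fam D Sr i) * np ^ i"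
proof -
  have "Pr T = np ^ i" if "T \<in> fam D Sr i" for T
    using prob_all_direct[OF k T_direct(1)[OF that] r(1)] T_direct(2)[OF that] by simp
  then show ?thesis by simp
qed

lemma fam_upper: "card (fam D Sr i) * np ^ i \<le> (lam N k m r) ^ i / fact i"
proof -
  have "fact i * card (fam D Sr i) \<le> fact i * (card Sr choose i)"
    using card_fam_le[OF finite_subs] by (intro mult_le_mono2)
  also have "\<dots> \<le> card Sr ^ i"
  proof (cases "i \<le> card Sr")
    case True
    then show ?thesis using binomial_fact_pow[of "card Sr" i] by (simp add: mult.commute)
  qed (simp add: binomial_eq_0)
  finally have "real (fact i * card (fam D Sr i)) \<le> real (card Sr ^ i)" by (rule of_nat_mono)
  then have "real (card (fam D Sr i)) \<le> card Sr ^ i / fact i" by (simp add: field_simps)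
  then have "card (fam D Sr i) * np ^ i \<le> card Sr ^ i / fact i * np ^ i" by (intro mult_right_mono) auto
  then show ?thesis by (simp add: lam_def power_divide mult.commute)
qed

text \<open>By \<open>card_meeting_T\<close> the fraction of subspaces that are members or bad
  extensions of a direct family of size below \<open>n\<close> is at most \<open>d\<close>.\<close>

lemma fam_lower:
  assumes i: "i \<le> n" and d: "4 * (real q ^ (n * r) / real q ^ (N - r)) \<le> d" "d \<le> 1"
  shows "(lam N k m r) ^ i * (1 - d) ^ i / fact i \<le> card (fam D Sr i) * np ^ i"
proof -
  have d0: "0 \<le> d" using d(1) q_real by (smt (verit) divide_nonneg_nonneg zero_le_power)
  have "(card Sr * (1 - d)) ^ i \<le> fact i * real (card (fam D Sr i))"
  proof (rule card_fam_lower[OF finite_subs V.direct_hereditary i d0 d(2)])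
    fix j T assume j: "j < n" and T: "T \<in> fam D Sr j"
    have "card T + card (bad_ext D Sr T) = card (T \<union> bad_ext D Sr T)"
      using T_direct(3)[OF T] finite_subs by (intro card_Un_disjoint[symmetric]) (auto simp: bad_ext_def)
    then have "real (card T + card (bad_ext D Sr T)) \<le> 4 * real q ^ (j * r) * real q ^ ((r - 1) * (N - r))"
      using card_meeting_T[OF T] by simp
    also have "\<dots> \<le> 4 * real q ^ (n * r) * real q ^ ((r - 1) * (N - r))"
      using j q_real by (intro mult_right_mono mult_left_mono power_increasing) auto
    also have "\<dots> = 4 * (real q ^ (n * r) / real q ^ (N - r)) * real q ^ (r * (N - r))"
      unfolding split_power by simp
    also have "\<dots> \<le> d * card Sr" using d(1) d0 card_subs_ge q_real by (intro mult_mono) auto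
    finally show "real (card T + card (bad_ext D Sr T)) \<le> d * card Sr" .
  qed
  then have "(card Sr * (1 - d)) ^ i / fact i * np ^ i \<le> card (fam D Sr i) * np ^ i"
    by (intro mult_right_mono) (auto simp: field_simps)
  then show ?thesis by (simp add: lam_def power_mult_distrib power_divide mult_ac)
qed

lemma prob_none_approx:
  assumes n: "1 \<le> n"
  shows "\<bar>prob_none N k m r - (\<Sum>i<n. (-1) ^ i * (card (fam D Sr i) * np ^ i))\<bar>
    \<le> (lam N k m r) ^ n / fact n + n * (\<Sum>j<2 * n. 2 ^ j * ((lam N k m r) ^ Suc j * eps N k m r j))"
proof -
  note h = exterior_hom_finite_nonempty[OF field_axioms finite_scalars, of k N m]
  have "\<bar>prob_none N k m r - (\<Sum>i<n. (-1) ^ i * (\<Sum>T\<in>fam D Sr i. Pr T))\<bar>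
    \<le> (\<Sum>T\<in>fam D Sr n. Pr T) + n * (\<Sum>j<2 * n. 2 ^ j * (\<Sum>T\<in>fam D Sr j. \<Sum>H\<in>bad_ext D Sr T. Pr (insert H T)))"
    unfolding prob_none_def by (rule prob_none_bonferroni[OF h finite_subs V.direct_hereditary n])
  also have "\<dots> \<le> (lam N k m r) ^ n / fact n + n * (\<Sum>j<2 * n. 2 ^ j * ((lam N k m r) ^ Suc j * eps N k m r j))"
    using fam_upper[of n] unfolding sum_direct
    by (intro add_mono mult_left_mono sum_mono sum_sum_bad_le) auto
  finally show ?thesis unfolding sum_direct .
qed

text \<open>The first moment bound: a union bound over all \<open>r\<close>-dimensional
  subspaces.\<close>

lemma prob_some_le: "1 - prob_none N k m r \<le> lam N k m r"
proof -
  let ?A = "exterior_hom F k N m" and ?nul = "null_subspace F k N m"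
  note h = exterior_hom_finite_nonempty[OF field_axioms finite_scalars, of k N m]
  have cA: "0 < real (card ?A)" using h by (simp add: card_gt_0_iff)
  have "?A = {\<Theta> \<in> ?A. \<forall>H\<in>Sr. \<not> ?nul \<Theta> H} \<union> (\<Union>H\<in>Sr. {\<Theta> \<in> ?A. \<forall>H'\<in>{H}. ?nul \<Theta> H'})" by blast
  then have "card ?A \<le> card {\<Theta> \<in> ?A. \<forall>H\<in>Sr. \<not> ?nul \<Theta> H} + card (\<Union>H\<in>Sr. {\<Theta> \<in> ?A. \<forall>H'\<in>{H}. ?nul \<Theta> H'})"
    by (metis (no_types, lifting) card_Un_le)
  also have "\<dots> \<le> card {\<Theta> \<in> ?A. \<forall>H\<in>Sr. \<not> ?nul \<Theta> H} + (\<Sum>H\<in>Sr. card {\<Theta> \<in> ?A. \<forall>H'\<in>{H}. ?nul \<Theta> H'})"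
    using card_UN_le[OF finite_subs] by (intro add_left_mono)
  finally have "real (card ?A) \<le> real (card {\<Theta> \<in> ?A. \<forall>H\<in>Sr. \<not> ?nul \<Theta> H} + (\<Sum>H\<in>Sr. card {\<Theta> \<in> ?A. \<forall>H'\<in>{H}. ?nul \<Theta> H'}))"
    by (rule of_nat_mono)
  then have "1 \<le> prob_none N k m r + (\<Sum>H\<in>Sr. Pr {H})"
    using cA unfolding prob_none_def prob_all_def sum_divide_distrib[symmetric]
    by (simp add: add_divide_distrib[symmetric] le_divide_eq)
  moreover have "Pr {H} = np" if "H \<in> Sr" for H
  proof -
    have "D {H}" using that by (intro direct_singleton) (simp_all add: subs_def)
    from prob_all_direct[OF k this r(1)] show ?thesis by simp
  qed
  ultimately show ?thesis by (simp add: lam_def)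
qed

text \<open>The second moment bound. In the variance, pairs in direct sum are covered by the square
  of the mean, the diagonal contributes \<open>lam\<close>, and the remaining pairs at most
  \<open>lam ^ 2 * eps N k m r 1\<close>.\<close>

lemma prob_none_le:
  assumes "0 < lam N k m r"
  shows "prob_none N k m r \<le> 1 / lam N k m r + eps N k m r 1"
proof -
  let ?A = "exterior_hom F k N m" and ?nul = "null_subspace F k N m"
  note h = exterior_hom_finite_nonempty[OF field_axioms finite_scalars, of k N m]
  have P1: "Pr {H} = np" if "H \<in> Sr" for H
  proof -
    have "D {H}" using that by (intro direct_singleton) (simp_all add: subs_def)
    from prob_all_direct[OF k this r(1)] show ?thesis by simp
  qed
  have m1: "(\<Sum>H\<in>Sr. Pr {H}) = lam N k m r" using P1 by (simp add: lam_def)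
  have single: "{H} \<in> fam D Sr 1" if "H \<in> Sr" for H
  proof -
    have "D {H}" using that by (intro direct_singleton) (simp_all add: subs_def)
    then show ?thesis using that by (simp add: fam_def)
  qed
  have "(\<Sum>H'\<in>Sr. Pr {H, H'}) \<le> np + card Sr * np ^ 2 + np * (lam N k m r * eps N k m r 1)" if H: "H \<in> Sr" for H
  proof -
    let ?B = "bad_ext D Sr {H}"
    have bS: "?B \<subseteq> Sr - {H}" by (auto simp: bad_ext_def)
    have "(\<Sum>H'\<in>Sr. Pr {H, H'}) = Pr {H} + (\<Sum>H'\<in>Sr - {H}. Pr {H, H'})"
      using sum.remove[OF finite_subs H, of "\<lambda>H'. Pr {H, H'}"] by simp
    also have "(\<Sum>H'\<in>Sr - {H}. Pr {H, H'}) = (\<Sum>H'\<in>?B. Pr {H, H'}) + (\<Sum>H'\<in>Sr - {H} - ?B. Pr {H, H'})"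
      using finite_subs by (subst sum.subset_diff[OF bS]) auto
    also have "(\<Sum>H'\<in>?B. Pr {H, H'}) \<le> np * (lam N k m r * eps N k m r 1)"
      using sum_bad_le[OF single[OF H]] by (simp add: insert_commute)
    also have "(\<Sum>H'\<in>Sr - {H} - ?B. Pr {H, H'}) = (\<Sum>H'\<in>Sr - {H} - ?B. np ^ 2)"
    proof (rule sum.cong[OF refl])
      fix H' assume H': "H' \<in> Sr - {H} - ?B"
      then have d: "D {H', H}" by (auto simp: bad_ext_def)
      have c: "card {H', H} = 2" using H' by auto
      show "Pr {H, H'} = np ^ 2"
        unfolding insert_commute[of H H'] prob_all_direct[OF k d r(1)] c ..
    qed
    also have "\<dots> \<le> card Sr * np ^ 2"
    proof -
      have "card (Sr - {H} - ?B) \<le> card Sr" using finite_subs by (intro card_mono) auto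
      then show ?thesis by (simp add: mult_right_mono del: card_Diff_insert)
    qed
    finally show ?thesis using P1[OF H] by linarith
  qed
  then have "(\<Sum>H\<in>Sr. \<Sum>H'\<in>Sr. Pr {H, H'}) \<le> (\<Sum>H\<in>Sr. np + card Sr * np ^ 2 + np * (lam N k m r * eps N k m r 1))" by (rule sum_mono)
  also have "\<dots> = lam N k m r + (lam N k m r) ^ 2 + (lam N k m r) ^ 2 * eps N k m r 1" by (simp add: lam_def algebra_simps power2_eq_square)
  finally have "prob_none N k m r * (lam N k m r)\<^sup>2 \<le> lam N k m r + (lam N k m r) ^ 2 * eps N k m r 1"
    using prob_none_second_moment[OF h finite_subs, of ?nul] unfolding m1 prob_none_def by linarith
  then have "lam N k m r * (prob_none N k m r * lam N k m r) \<le> lam N k m r * (1 + lam N k m r * eps N k m r 1)"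
    by (simp add: algebra_simps power2_eq_square)
  then have "prob_none N k m r * lam N k m r \<le> 1 + lam N k m r * eps N k m r 1" using assms by simp
  then show ?thesis using assms by (simp add: field_simps)
qed

end

end

section \<open>Numerical estimates\<close>

lemma le_binomial_add:
  fixes n j :: nat
  assumes "1 \<le> j"
  shows "n \<le> (n choose j) + j"
proof (induction n)
  case (Suc n)
  show ?case
  proof (cases "j \<le> Suc n")
    case True
    obtain j' where j: "j = Suc j'" using assms by (cases j) auto
    have "1 \<le> n choose j'" using True j by (simp add: Suc_le_eq)
    then show ?thesis using Suc unfolding j by simp
  qed simp
qed simp

text \<open>From \<open>B = j + 1\<close> on, each step of \<open>B\<close> raises the binomial
  coefficient by at least \<open>(j + 1) choose 2\<close>, hence by at least \<open>j + 1\<close> as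
  \<open>2 \<le> j\<close>. The earlier steps are absorbed by the slack
  \<open>(j + 1) ^ 2\<close>.\<close>

lemma binomial_diff_ge:
  fixes A B j :: nat
  assumes j: "2 \<le> j" and "A \<le> B"
  shows "(j + 1) * (B - A) + (A choose j) \<le> (B choose j) + (j + 1) ^ 2"
  using \<open>A \<le> B\<close>
proof (induction B rule: dec_induct)
  case (step B)
  obtain j' where j': "j = Suc j'" using j by (cases j) auto
  show ?case
  proof (cases "j + 1 \<le> B")
    case True
    have "j + 1 \<le> (j + 1) choose 2"
    proof -
      have "(j + 1) * 2 \<le> (j + 1) * j" using j by (rule mult_le_mono2)
      then have "(j + 1) * 2 div 2 \<le> (j + 1) * j div 2" by (rule div_le_mono)
      then show ?thesis by (simp add: choose_two)
    qed
    also have "\<dots> = (j + 1) choose (j - 1)" using binomial_symmetric[of 2 "j + 1"] j by simp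
    also have "\<dots> \<le> B choose (j - 1)" by (rule binomial_right_mono[OF True])
    finally have "j + 1 \<le> B choose j'" using j' by simp
    moreover have "(j + 1) * (Suc B - A) = (j + 1) * (B - A) + (j + 1)"
      using step(1) by (simp add: Suc_diff_le)
    moreover have "Suc B choose j = (B choose j) + (B choose j')" unfolding j' by simp
    ultimately show ?thesis using step(3) by linarith
  next
    case False
    have "A choose j \<le> Suc B choose j" using step(1) by (intro binomial_right_mono) simp
    moreover have "(j + 1) * (Suc B - A) \<le> (j + 1) ^ 2"
      unfolding power2_eq_square using False by (intro mult_le_mono2) simp
    ultimately show ?thesis by linarith
  qed
qed simp

text \<open>Pascal's rule splits the binomial coefficient on the right: the part over
  \<open>k - 2\<close> supplies the extra \<open>r\<close>, the part over \<open>k - 1\<close> the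
  slope \<open>k * (r - a)\<close>. Both need \<open>3 \<le> k\<close>. The constant collects
  \<open>k ^ 2\<close> from the slack of \<open>binomial_diff_ge\<close> and \<open>k\<close> from
  each of two index shifts.\<close>

lemma binomial_gap:
  fixes k r a :: nat
  assumes k: "3 \<le> k" and a: "1 \<le> a" "a < r"
  shows "k * (r - a) + r + ((a - 1) choose (k - 1)) \<le> ((r - 1) choose (k - 1)) + (k\<^sup>2 + 2 * k)"
proof -
  have e: "Suc (k - 2) = k - 1" "Suc (r - 2) = r - 1" "k - 1 + 1 = k" using k a by auto
  have "(r - 1) choose (k - 1) = ((r - 2) choose (k - 2)) + ((r - 2) choose (k - 1))"
    using binomial_Suc_Suc[of "r - 2" "k - 2"] unfolding e .
  moreover have "r - 2 \<le> ((r - 2) choose (k - 2)) + (k - 2)" using k by (intro le_binomial_add) simp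
  moreover have "k * (r - 2 - (a - 1)) + ((a - 1) choose (k - 1)) \<le> ((r - 2) choose (k - 1)) + k ^ 2"
    using binomial_diff_ge[of "k - 1" "a - 1" "r - 2"] k a unfolding e by simp
  moreover have "k * (r - a) = k * (r - 2 - (a - 1)) + k"
  proof -
    have "r - a = Suc (r - 2 - (a - 1))" using a by simp
    then show ?thesis by simp
  qed
  ultimately show ?thesis using k a by linarith
qed

text \<open>This makes every summand of \<open>eta\<close> exponentially small in \<open>r\<close>.
  Both sides are multiplied by \<open>k\<close>, then
  \<open>k * (a choose k) = a * ((a - 1) choose (k - 1))\<close> and \<open>binomial_gap\<close>
  reduce the claim to \<open>a\<close> times the inequality that Delta is nonnegative.\<close>

lemma exponent_gap:
  fixes k m N r a :: nat
  assumes k: "3 \<le> k" and m: "1 \<le> m" and a: "1 \<le> a" "a < r" and rc: "k\<^sup>2 + 2 * k \<le> r"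
    and D: "m * ((r - 1) choose (k - 1)) \<le> k * (N - r)"
  shows "a * (r - a) + m * (a choose k) + (r - (k\<^sup>2 + 2 * k)) div k \<le> a * (N - r)"
proof -
  let ?c = "r - (k\<^sup>2 + 2 * k)"
  have g: "k * (r - a) + ?c + ((a - 1) choose (k - 1)) \<le> (r - 1) choose (k - 1)"
    using binomial_gap[OF k a] rc by linarith
  have "k * (a * (r - a) + m * (a choose k) + ?c div k) = k * a * (r - a) + m * (k * (a choose k)) + k * (?c div k)"
    by (simp add: algebra_simps)
  also have "k * (a choose k) = a * ((a - 1) choose (k - 1))" using k by (intro times_binomial_minus1_eq) simp
  also have "k * a * (r - a) + m * (a * ((a - 1) choose (k - 1))) + k * (?c div k)
      \<le> a * m * (k * (r - a)) + m * (a * ((a - 1) choose (k - 1))) + a * m * ?c"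
  proof (intro add_mono order.refl)
    have am: "1 * 1 \<le> a * m" using a m by (intro mult_le_mono) auto
    have "1 * (a * (k * (r - a))) \<le> m * (a * (k * (r - a)))" using m by (intro mult_le_mono1)
    then show "k * a * (r - a) \<le> a * m * (k * (r - a))" by (simp add: mult_ac)
    have "k * (?c div k) \<le> 1 * ?c" by simp
    also have "\<dots> \<le> a * m * ?c" using am by (intro mult_le_mono1) simp
    finally show "k * (?c div k) \<le> a * m * ?c" .
  qed
  also have "\<dots> = a * m * (k * (r - a) + ?c + ((a - 1) choose (k - 1)))" by (simp add: algebra_simps)
  also have "\<dots> \<le> a * m * ((r - 1) choose (k - 1))" using g by (rule mult_le_mono2)
  also have "\<dots> = a * (m * ((r - 1) choose (k - 1)))" by simp
  also have "\<dots> \<le> a * (k * (N - r))" using D by (rule mult_le_mono2)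
  finally have "k * (a * (r - a) + m * (a choose k) + ?c div k) \<le> k * (a * (N - r))" by (simp add: mult_ac)
  then show ?thesis using k by simp
qed

text \<open>As \<open>k - 1 \<ge> 2\<close>, the binomial coefficient is at least the square of
  \<open>r / (2 * k)\<close>. Nonnegative Delta then gives
  \<open>r * r \<le> 4 * k ^ 3 * (N - r)\<close>, the origin of the threshold
  \<open>4 * k ^ 3\<close>.\<close>

lemma codim_large:
  fixes k m N r i :: nat
  assumes k: "3 \<le> k" and m: "1 \<le> m" and r: "4 * k ^ 3 * (i + 1) \<le> r"
    and D: "m * ((r - 1) choose (k - 1)) \<le> k * (N - r)"
  shows "(i + 1) * r \<le> N - r"
proof -
  have kr: "k \<le> r" "2 \<le> r"
  proof -
    have "k * (1 * 1) * 1 \<le> k * (k * k) * (4 * (i + 1))" using k by (intro mult_le_mono) auto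
    also have "\<dots> = 4 * k ^ 3 * (i + 1)" by (simp add: power3_eq_cube algebra_simps)
    finally show "k \<le> r" "2 \<le> r" using r k by auto
  qed
  let ?x = "real (r - 1) / real (k - 1)"
  have x1: "1 \<le> ?x" using kr k by simp
  have "real r / (2 * k) \<le> ?x"
  proof -
    have "real r * real (k - 1) \<le> (2 * real (r - 1)) * real k"
      using kr k by (intro mult_mono) auto
    then show ?thesis using k by (simp add: field_simps)
  qed
  then have "(real r / (2 * k)) ^ 2 \<le> ?x ^ 2" by (intro power_mono) auto
  also have "\<dots> \<le> ?x ^ (k - 1)" using x1 k by (intro power_increasing) auto
  also have "\<dots> \<le> real ((r - 1) choose (k - 1))" using kr by (intro binomial_ge_n_over_k_pow_k) simp
  also have "\<dots> \<le> real (k * (N - r))"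
  proof -
    have "1 * ((r - 1) choose (k - 1)) \<le> m * ((r - 1) choose (k - 1))" using m by (intro mult_le_mono1)
    then show ?thesis using D by (intro of_nat_mono) linarith
  qed
  finally have b: "real r * real r \<le> 4 * real k ^ 3 * real (N - r)"
    using k by (simp add: field_simps power2_eq_square power3_eq_cube)
  have "4 * k ^ 3 * ((i + 1) * r) = (4 * k ^ 3 * (i + 1)) * r" by (simp only: mult_ac)
  also have "\<dots> \<le> r * r" using r by (rule mult_le_mono1)
  also have "\<dots> \<le> 4 * k ^ 3 * (N - r)"
  proof -
    have "real (r * r) \<le> real (4 * k ^ 3 * (N - r))" using b by simp
    then show ?thesis by (simp only: of_nat_le_iff)
  qed
  finally show ?thesis using k by simp
qed

text \<open>By \<open>k * (r choose k) = r * ((r - 1) choose (k - 1))\<close>, the exponent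
  \<open>r * (N - r) - m * (r choose k)\<close> of the mean is \<open>r * Delta / k\<close>. Delta
  is an integer, so a positive value is at least 1. The next two lemmas treat the other signs in the
  same way.\<close>

lemma exponent_pos:
  fixes k m N r :: nat
  assumes k: "3 \<le> k" and D: "m * ((r - 1) choose (k - 1)) < k * (N - r)"
  shows "m * (r choose k) + r div k \<le> r * (N - r)"
proof -
  have "k * (m * (r choose k) + r div k) \<le> m * (k * (r choose k)) + r"
    by (simp add: algebra_simps)
  also have "k * (r choose k) = r * ((r - 1) choose (k - 1))" using k by (intro times_binomial_minus1_eq) simp
  also have "m * (r * ((r - 1) choose (k - 1))) + r = r * Suc (m * ((r - 1) choose (k - 1)))" by (simp add: algebra_simps)
  also have "\<dots> \<le> r * (k * (N - r))" using D by (intro mult_le_mono2) simp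
  finally have "k * (m * (r choose k) + r div k) \<le> k * (r * (N - r))" by (simp add: mult_ac)
  then show ?thesis using k by simp
qed

lemma exponent_neg:
  fixes k m N r :: nat
  assumes k: "3 \<le> k" and D: "k * (N - r) < m * ((r - 1) choose (k - 1))"
  shows "r * (N - r) + r div k \<le> m * (r choose k)"
proof -
  have "k * (r * (N - r) + r div k) \<le> r * Suc (k * (N - r))"
    by (simp add: algebra_simps)
  also have "\<dots> \<le> r * (m * ((r - 1) choose (k - 1)))" using D by (intro mult_le_mono2) simp
  also have "\<dots> = m * (r * ((r - 1) choose (k - 1)))" by simp
  also have "r * ((r - 1) choose (k - 1)) = k * (r choose k)" using k by (intro times_binomial_minus1_eq[symmetric]) simp
  finally have "k * (r * (N - r) + r div k) \<le> k * (m * (r choose k))" by (simp add: mult_ac)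
  then show ?thesis using k by simp
qed

lemma exponent_zero:
  fixes k m N r :: nat
  assumes k: "3 \<le> k" and D: "k * (N - r) = m * ((r - 1) choose (k - 1))"
  shows "m * (r choose k) = r * (N - r)"
proof -
  have "k * (m * (r choose k)) = m * (k * (r choose k))" by simp
  also have "k * (r choose k) = r * ((r - 1) choose (k - 1))" using k by (intro times_binomial_minus1_eq) simp
  also have "m * (r * ((r - 1) choose (k - 1))) = r * (k * (N - r))" using D by simp
  finally have "k * (m * (r choose k)) = k * (r * (N - r))" by (simp only: mult_ac)
  then show ?thesis using k by auto
qed

text \<open>Obtained from \<open>eta\<close> by \<open>exponent_gap\<close> and
  \<open>q \<ge> 2\<close>; it is free of \<open>q\<close>, \<open>m\<close> and \<open>N\<close>,
  so all later limits are uniform in them.\<close>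

definition eta_bound :: "nat \<Rightarrow> nat \<Rightarrow> real" where
  "eta_bound k r = real r * (4 / 2 ^ ((r - (k\<^sup>2 + 2 * k)) div k))"

definition eps_bound :: "nat \<Rightarrow> nat \<Rightarrow> nat \<Rightarrow> real" where
  "eps_bound k r i = 4 / 2 ^ r + 4 * ((1 + eta_bound k r) ^ i - 1)"

lemma filterlim_div_at_top:
  fixes k :: nat
  assumes "0 < k"
  shows "filterlim (\<lambda>r. r div k) at_top at_top"
  unfolding filterlim_at_top
proof
  fix Z
  show "\<forall>\<^sub>F r in at_top. Z \<le> r div k"
    using eventually_ge_at_top[of "Z * k"]
  proof eventually_elim
    case (elim r)
    then show ?case using assms by (metis div_le_mono nonzero_mult_div_cancel_right less_irrefl)
  qed
qed

lemma two_power_div_tendsto: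
  fixes k :: nat
  assumes "0 < k"
  shows "(\<lambda>r. 1 / 2 ^ (r div k)) \<longlonglongrightarrow> (0::real)"
proof -
  have "(\<lambda>n. 1 / 2 ^ n :: real) \<longlonglongrightarrow> 0" by real_asymp
  from filterlim_compose[OF this filterlim_div_at_top[OF assms]] show ?thesis .
qed

text \<open>In terms of the exponent \<open>e\<close> of 2, the factor \<open>r\<close> is at most a
  linear function of \<open>e\<close>.\<close>

lemma eta_bound_tendsto:
  assumes "0 < k"
  shows "eta_bound k \<longlonglongrightarrow> 0"
proof (rule tendsto_sandwich[OF _ _ tendsto_const])
  let ?e = "\<lambda>r. (r - (k\<^sup>2 + 2 * k)) div k"
  let ?b = "\<lambda>e::nat. (real (k\<^sup>2 + 3 * k) + real k * real e) * (4 / 2 ^ e)"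
  show "\<forall>\<^sub>F r in sequentially. 0 \<le> eta_bound k r" by (simp add: eta_bound_def)
  have "filterlim (\<lambda>r. r - (k\<^sup>2 + 2 * k)) at_top sequentially" by (rule filterlim_minus_const_nat_at_top)
  then have f: "filterlim ?e at_top sequentially"
    by (rule filterlim_compose[OF filterlim_div_at_top[OF assms]])
  have "?b \<longlonglongrightarrow> 0" by real_asymp
  from filterlim_compose[OF this f] show "(\<lambda>r. ?b (?e r)) \<longlonglongrightarrow> 0" .
  have "eta_bound k r \<le> ?b (?e r)" for r
  proof -
    have "r \<le> (k\<^sup>2 + 3 * k) + k * ?e r"
      using mult_div_mod_eq[of k "r - (k\<^sup>2 + 2 * k)"] mod_less_divisor[OF assms, of "r - (k\<^sup>2 + 2 * k)"]
      by linarith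
    then have "real r \<le> real (k\<^sup>2 + 3 * k) + real k * real (?e r)"
      by (metis of_nat_add of_nat_le_iff of_nat_mult)
    then show ?thesis unfolding eta_bound_def by (intro mult_right_mono) auto
  qed
  then show "\<forall>\<^sub>F r in sequentially. eta_bound k r \<le> ?b (?e r)" by simp
qed

lemma eps_bound_tendsto:
  assumes "0 < k"
  shows "(\<lambda>r. eps_bound k r i) \<longlonglongrightarrow> 0"
proof -
  have "(\<lambda>r. 4 / 2 ^ r :: real) \<longlonglongrightarrow> 0" by real_asymp
  then have "(\<lambda>r. 4 / 2 ^ r + 4 * ((1 + eta_bound k r) ^ i - 1)) \<longlonglongrightarrow> 0 + 4 * ((1 + 0) ^ i - 1)"
    by (intro tendsto_intros eta_bound_tendsto assms)
  then show ?thesis by (simp add: eps_bound_def)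
qed

section \<open>Partial products of the Euler product that defines \<open>C_const\<close>\<close>

context
  fixes x :: real
  assumes x: "0 \<le> x" "x \<le> 1 / 2"
begin

lemma power_Suc_le_half: "0 \<le> x ^ Suc j" "x ^ Suc j \<le> 1 / 2"
proof -
  have "x ^ Suc j \<le> x ^ 1" using x by (intro power_decreasing) auto
  then show "x ^ Suc j \<le> 1 / 2" using x by simp
qed (use x in simp)

lemma sum_power_Suc_le: "(\<Sum>j<n. x ^ Suc j) \<le> 2 * x" "(\<Sum>j<n. x ^ Suc j) \<le> 1"
proof -
  have "(\<Sum>j<n. x ^ j) * (1 - x) = 1 - x ^ n"
    using one_diff_power_eq[of x n] by (simp add: mult.commute)
  moreover have "(\<Sum>j<n. x ^ j) * (1 / 2) \<le> (\<Sum>j<n. x ^ j) * (1 - x)"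
    using x by (intro mult_left_mono sum_nonneg) auto
  moreover have "0 \<le> x ^ n" using x by simp
  ultimately have "(\<Sum>j<n. x ^ j) \<le> 2" by linarith
  then have "x * (\<Sum>j<n. x ^ j) \<le> x * 2" using x by (intro mult_left_mono) auto
  then show "(\<Sum>j<n. x ^ Suc j) \<le> 2 * x" by (simp add: sum_distrib_left mult.commute)
  then show "(\<Sum>j<n. x ^ Suc j) \<le> 1" using x by linarith
qed

lemma prod_shifted_ge:
  fixes s n :: nat
  shows "1 - x ^ s \<le> (\<Prod>j<n. 1 - x ^ (s + Suc j))" "(\<Prod>j<n. 1 - x ^ (s + Suc j)) \<le> 1"
proof -
  have b: "0 \<le> x ^ (s + Suc j) \<and> x ^ (s + Suc j) \<le> 1" for j
    using x by (intro conjI zero_le_power power_le_one) auto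
  then have "1 - (\<Sum>j<n. x ^ (s + Suc j)) \<le> (\<Prod>j<n. 1 - x ^ (s + Suc j))" by (intro prod_one_minus_ge) auto
  moreover have "(\<Sum>j<n. x ^ (s + Suc j)) = x ^ s * (\<Sum>j<n. x ^ Suc j)"
    unfolding sum_distrib_left by (simp only: power_add)
  moreover have "x ^ s * (\<Sum>j<n. x ^ Suc j) \<le> x ^ s * 1"
    using x sum_power_Suc_le(2) by (intro mult_left_mono) auto
  ultimately show "1 - x ^ s \<le> (\<Prod>j<n. 1 - x ^ (s + Suc j))" by linarith
  show "(\<Prod>j<n. 1 - x ^ (s + Suc j)) \<le> 1" using b by (intro prod_le_1) auto
qed

definition "euler_prod n = (\<Prod>j<n. inverse (1 - x ^ Suc j))"

lemma euler_prod_bounds: "1 \<le> euler_prod n" "euler_prod n \<le> 4" "euler_prod n * (1 - 2 * x) \<le> 1"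
proof -
  let ?P = "\<Prod>j<n. 1 - x ^ Suc j"
  have P: "1 / 4 \<le> ?P" using prod_one_minus_power_ge[OF x] .
  have e: "euler_prod n = inverse ?P" unfolding euler_prod_def using prod_inversef[of "\<lambda>j. 1 - x ^ Suc j" "{..<n}"] by (simp only: comp_def)
  have P1: "?P \<le> 1" using prod_shifted_ge(2)[where s = 0 and n = n] by simp
  show "1 \<le> euler_prod n" using P P1 by (simp add: e one_le_inverse)
  show "euler_prod n \<le> 4" using P by (simp add: e field_simps)
  have "1 - (\<Sum>j<n. x ^ Suc j) \<le> ?P"
  proof (rule prod_one_minus_ge)
    fix j show "0 \<le> x ^ Suc j \<and> x ^ Suc j \<le> 1" using power_Suc_le_half[of j] by linarith
  qed simp
  then have "1 - 2 * x \<le> ?P" using sum_power_Suc_le(1)[of n] by linarith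
  then show "euler_prod n * (1 - 2 * x) \<le> 1" using P by (simp add: e field_simps)
qed

text \<open>The product cancels the last \<open>t\<close> factors, so \<open>prod_shifted_ge\<close>
  controls how much \<open>euler_prod\<close> still grows after \<open>s\<close> factors.\<close>

lemma euler_prod_add: "euler_prod (s + t) * (\<Prod>j<t. 1 - x ^ (s + Suc j)) = euler_prod s"
proof (induction t)
  case (Suc t)
  let ?y = "1 - x ^ Suc (s + t)"
  have "?y \<noteq> 0" using power_Suc_le_half(2)[of "s + t"] by linarith
  moreover have "euler_prod (s + Suc t) = euler_prod (s + t) * inverse ?y" by (simp add: euler_prod_def)
  moreover have "(\<Prod>j<Suc t. 1 - x ^ (s + Suc j)) = (\<Prod>j<t. 1 - x ^ (s + Suc j)) * ?y" by simp
  ultimately have eq: "euler_prod (s + Suc t) * (\<Prod>j<Suc t. 1 - x ^ (s + Suc j))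
      = euler_prod (s + t) * (\<Prod>j<t. 1 - x ^ (s + Suc j)) * (inverse ?y * ?y)" by (simp only: mult_ac)
  have "inverse ?y * ?y = 1" using \<open>?y \<noteq> 0\<close> by (rule left_inverse)
  then show ?case unfolding eq Suc by simp
qed simp

lemma euler_prod_mono: "euler_prod s \<le> euler_prod (s + t)"
proof -
  have "euler_prod (s + t) * (\<Prod>j<t. 1 - x ^ (s + Suc j)) \<le> euler_prod (s + t) * 1"
    using prod_shifted_ge(2)[where s = s and n = t] euler_prod_bounds(1)[of "s + t"] by (intro mult_left_mono) auto
  then show ?thesis unfolding euler_prod_add by simp
qed

text \<open>The partial products increase and are bounded by 4. Convergence of an infinite product
  also demands a nonzero limit, here one that is at least 1.\<close>

lemma euler_prod_tendsto: "euler_prod \<longlonglongrightarrow> (\<Prod>j. inverse (1 - x ^ Suc j))"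
proof -
  have s: "(\<Prod>j\<le>n. inverse (1 - x ^ Suc j)) = euler_prod (Suc n)" for n
    unfolding euler_prod_def lessThan_Suc_atMost ..
  have "incseq (\<lambda>n. euler_prod (Suc n))" using euler_prod_mono[of "Suc _" 1] by (intro incseq_SucI) simp
  then obtain L where L: "(\<lambda>n. euler_prod (Suc n)) \<longlonglongrightarrow> L"
    using incseq_convergent[of _ 4] euler_prod_bounds(2) by metis
  have "1 \<le> L" using euler_prod_bounds(1) by (intro LIMSEQ_le_const[OF L]) auto
  moreover have inz: "inverse (1 - x ^ Suc j) \<noteq> 0" for j using power_Suc_le_half(2)[of j] by simp
  ultimately have "convergent_prod (\<lambda>j. inverse (1 - x ^ Suc j))"
    using L limI[OF L] unfolding convergent_prod_iff_convergent[OF inz] s convergent_def by auto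
  then have "(\<lambda>n. euler_prod (Suc n)) \<longlonglongrightarrow> (\<Prod>j. inverse (1 - x ^ Suc j))"
    using convergent_prod_LIMSEQ unfolding s[symmetric] by blast
  then show ?thesis by (subst (asm) filterlim_sequentially_Suc)
qed

text \<open>The first two bounds squeeze \<open>C_const q\<close> to 1 for growing \<open>q\<close>;
  the last two give the rate at which the critical mean approaches it.\<close>

lemma euler_prod_limit_bounds:
  defines "C \<equiv> \<Prod>j. inverse (1 - x ^ Suc j)"
  shows "1 \<le> C" "C * (1 - 2 * x) \<le> 1" "euler_prod s \<le> C" "C - euler_prod s \<le> 4 * x ^ s"
proof -
  note l = euler_prod_tendsto[folded C_def]
  show c1: "1 \<le> C" using euler_prod_bounds(1) by (intro LIMSEQ_le_const[OF l]) auto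
  have c4: "C \<le> 4" using euler_prod_bounds(2) by (intro LIMSEQ_le_const2[OF l]) auto
  show "C * (1 - 2 * x) \<le> 1"
    using euler_prod_bounds(3) by (intro LIMSEQ_le_const2[OF tendsto_mult_right[OF l]]) auto
  note l' = LIMSEQ_ignore_initial_segment[OF l, of s]
  show "euler_prod s \<le> C"
    using euler_prod_mono[of s] by (intro LIMSEQ_le_const[OF l']) (simp add: add.commute)
  have "C * (1 - x ^ s) \<le> euler_prod s"
  proof (rule LIMSEQ_le_const2[OF tendsto_mult_right[OF l']], intro exI allI impI)
    fix t
    have "euler_prod (s + t) * (1 - x ^ s) \<le> euler_prod (s + t) * (\<Prod>j<t. 1 - x ^ (s + Suc j))"
      using prod_shifted_ge(1) euler_prod_bounds(1)[of "s + t"] by (intro mult_left_mono) auto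
    then show "euler_prod (t + s) * (1 - x ^ s) \<le> euler_prod s" unfolding euler_prod_add by (simp add: add.commute)
  qed
  then have "C - euler_prod s \<le> C * x ^ s" by (simp add: algebra_simps)
  also have "\<dots> \<le> 4 * x ^ s" using c4 x by (intro mult_right_mono) auto
  finally show "C - euler_prod s \<le> 4 * x ^ s" .
qed

end

lemma C_const_tendsto:
  assumes q: "\<And>n. 2 \<le> q n" and lim: "filterlim q at_top sequentially"
  shows "(\<lambda>n. C_const (q n)) \<longlonglongrightarrow> 1"
proof (rule tendsto_sandwich[OF _ _ tendsto_const])
  have x: "0 \<le> 1 / real (q n)" "1 / real (q n) \<le> 1 / 2" for n
    using q[of n] by (auto simp: field_simps)
  have C: "C_const (q n) = (\<Prod>j. inverse (1 - (1 / real (q n)) ^ Suc j))" for n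
    by (simp only: C_const_def power_one_over)
  note b = euler_prod_limit_bounds[OF x, folded C]
  show "\<forall>\<^sub>F n in sequentially. 1 \<le> C_const (q n)" using b(1) by simp
  \<comment> \<open>For \<open>q = 2\<close> the denominator \<open>1 - 2 / q\<close> would be
    zero.\<close>
  have "\<forall>\<^sub>F n in sequentially. 3 \<le> q n" using lim by (simp add: filterlim_at_top)
  then show "\<forall>\<^sub>F n in sequentially. C_const (q n) \<le> 1 / (1 - 2 / real (q n))"
  proof eventually_elim
    case (elim n)
    then show ?case using b(2)[of n] by (simp add: field_simps)
  qed
  have "(\<lambda>n. 1 / (1 - 2 / real n)) \<longlonglongrightarrow> 1" by real_asymp
  from filterlim_compose[OF this lim] show "(\<lambda>n. 1 / (1 - 2 / real (q n))) \<longlonglongrightarrow> 1" .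
qed

lemma abs_exp_minus_diff_le:
  fixes a b :: real
  assumes "0 \<le> a" "0 \<le> b"
  shows "\<bar>exp (- a) - exp (- b)\<bar> \<le> \<bar>a - b\<bar>"
proof -
  have *: "exp (- a) - exp (- b) \<le> b - a" if "0 \<le> a" "a \<le> b" for a b :: real
  proof -
    have "exp (- a) - exp (- b) = exp (- a) * (1 - exp (- (b - a)))"
      by (simp add: algebra_simps flip: exp_add)
    also have "\<dots> \<le> 1 * (b - a)"
    proof (rule mult_mono)
      show "1 - exp (- (b - a)) \<le> b - a" using exp_ge_add_one_self[of "- (b - a)"] by linarith
    qed (use that in auto)
    finally show ?thesis by simp
  qed
  have m: "exp (- b) \<le> exp (- a)" if "a \<le> b" for a b :: real using that by simp
  show ?thesis using *[of a b] *[of b a] m[of a b] m[of b a] assms by linarith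
qed

text \<open>The summands are, with \<open>lam \<le> 4\<close>: the two error terms of the truncated
  Bonferroni inequality, the shortage of direct families compared with
  \<open>lam ^ i / fact i\<close>, the Taylor remainder of \<open>exp (- lam)\<close>, and the
  distance of \<open>lam\<close> from \<open>C_const q\<close>.\<close>

definition poisson_bound :: "nat \<Rightarrow> nat \<Rightarrow> nat \<Rightarrow> real" where
  "poisson_bound k n r = 4 ^ n / fact n + n * (\<Sum>j<2 * n. 2 ^ j * (4 ^ Suc j * eps_bound k r j))
     + (\<Sum>i<n. 4 ^ i * (1 - (1 - 4 / 2 ^ r) ^ i)) + exp 4 * (4 ^ n / fact n) + 8 * (1 / 2 ^ r)"

text \<open>For a fixed truncation \<open>n\<close> everything vanishes as \<open>r\<close> grows,
  except the two truncation errors; these become small only with \<open>n\<close>.\<close>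

lemma poisson_bound_tendsto:
  assumes "0 < k"
  shows "poisson_bound k n \<longlonglongrightarrow> (1 + exp 4) * (4 ^ n / fact n)"
proof -
  have "(\<lambda>r. 4 / 2 ^ r :: real) \<longlonglongrightarrow> 0" "(\<lambda>r. 1 / 2 ^ r :: real) \<longlonglongrightarrow> 0" by real_asymp+
  then have "poisson_bound k n \<longlonglongrightarrow> 4 ^ n / fact n + real n * (\<Sum>j<2 * n. 2 ^ j * (4 ^ Suc j * 0))
     + (\<Sum>i<n. 4 ^ i * (1 - (1 - 0) ^ i)) + exp 4 * (4 ^ n / fact n) + 8 * 0"
    unfolding poisson_bound_def by (intro tendsto_intros eps_bound_tendsto assms)
  then show ?thesis by (simp add: distrib_right add_divide_distrib)
qed

context finite_scalar_field
begin

lemma two_power_le: "2 ^ n \<le> real q ^ n"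
  using q_real(1) by (intro power_mono) auto

section \<open>Estimates for large \<open>r\<close>, uniform in the other parameters\<close>

context
  fixes N k m r :: nat
  assumes k: "3 \<le> k" and m: "1 \<le> m" and r: "r \<le> N" "4 * k ^ 3 \<le> r"
begin

lemma r_large: "1 \<le> r" "k\<^sup>2 + 2 * k \<le> r" "2 \<le> k"
proof -
  have "k\<^sup>2 + 2 * k \<le> k\<^sup>2 + k * k" using k by (intro add_mono mult_le_mono1) auto
  also have "\<dots> = 2 * (k * k)" by (simp add: power2_eq_square)
  also have "\<dots> \<le> 4 * (k * k * k)" using k by (intro mult_le_mono) auto
  also have "\<dots> = 4 * k ^ 3" by (simp add: power3_eq_cube)
  finally show c: "k\<^sup>2 + 2 * k \<le> r" using r by linarith
  then show "1 \<le> r" "2 \<le> k" using k by auto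
qed

context
  assumes D: "m * ((r - 1) choose (k - 1)) \<le> k * (N - r)"
begin

lemma eta_le: "eta N k m r \<le> eta_bound k r"
proof -
  let ?e = "(r - (k\<^sup>2 + 2 * k)) div k"
  have "eta N k m r \<le> (\<Sum>a\<in>{1..<r}. 4 / 2 ^ ?e)"
    unfolding eta_def
  proof (rule sum_mono)
    fix a assume a: "a \<in> {1..<r}"
    have "a * (r - a) + m * (a choose k) + ?e \<le> a * (N - r)"
      using exponent_gap[OF k m _ _ r_large(2) D] a by simp
    then have "real q ^ (a * (r - a) + m * (a choose k) + ?e) \<le> real q ^ (a * (N - r))"
      using q_real(1) by (intro power_increasing) auto
    then have "real q ^ (a * (r - a)) * (real q ^ (m * (a choose k)) / real q ^ (a * (N - r))) \<le> 1 / real q ^ ?e"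
      using q_real(1) by (simp add: power_add field_simps)
    also have "\<dots> \<le> 1 / 2 ^ ?e" using two_power_le[of ?e] by (simp add: frac_le)
    finally show "4 * real q ^ (a * (r - a)) * (real q ^ (m * (a choose k)) / real q ^ (a * (N - r))) \<le> 4 / 2 ^ ?e" by simp
  qed
  also have "\<dots> \<le> eta_bound k r" unfolding eta_bound_def by (simp add: divide_right_mono)
  finally show ?thesis .
qed

lemma meeting_le:
  assumes i: "4 * k ^ 3 * (i + 1) \<le> r"
  shows "4 * (real q ^ (i * r) / real q ^ (N - r)) \<le> 4 / 2 ^ r"
proof -
  have "i * r + r \<le> N - r" using codim_large[OF k m i D] by simp
  then have "real q ^ (i * r + r) \<le> real q ^ (N - r)" using q_real(1) by (intro power_increasing) auto
  then have "real q ^ (i * r) / real q ^ (N - r) \<le> 1 / real q ^ r"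
    using q_real(1) by (simp add: power_add field_simps)
  also have "\<dots> \<le> 1 / 2 ^ r" using two_power_le[of r] by (simp add: frac_le)
  finally show ?thesis by simp
qed

lemma eps_le:
  assumes i: "4 * k ^ 3 * (i + 1) \<le> r"
  shows "eps N k m r i \<le> eps_bound k r i"
  using meeting_le[OF i] eta_le eta_nonneg[of N k m r]
  unfolding eps_def eps_bound_def by (intro add_mono mult_left_mono diff_mono power_mono) auto

end

lemma lam_ge:
  assumes "m * (r choose k) + s \<le> r * (N - r)"
  shows "2 ^ s \<le> lam N k m r"
proof -
  have "2 ^ s * real q ^ (m * (r choose k)) \<le> real q ^ (m * (r choose k) + s)"
    unfolding add.commute[of _ s] power_add using two_power_le[of s] by (intro mult_right_mono) auto
  also have "\<dots> \<le> real q ^ (r * (N - r))" using assms q_real(1) by (intro power_increasing) auto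
  also have "\<dots> \<le> card (subs N r)" by (rule card_subs_ge[OF r_large(3,1) r(1)])
  finally show ?thesis using q_real(1) by (simp add: lam_def le_divide_eq)
qed

lemma lam_le:
  assumes "r * (N - r) + s \<le> m * (r choose k)"
  shows "lam N k m r \<le> 4 / 2 ^ s"
proof -
  have "real (card (subs N r)) * 2 ^ s \<le> 4 * real q ^ (r * (N - r)) * real q ^ s"
    using card_subs_le[OF r_large(3,1) r(1)] two_power_le[of s] by (intro mult_mono) auto
  also have "\<dots> = 4 * real q ^ (r * (N - r) + s)" by (simp add: power_add)
  also have "\<dots> \<le> 4 * real q ^ (m * (r choose k))"
    using assms q_real(1) by (intro mult_left_mono power_increasing) auto
  finally show ?thesis using q_real(1) by (simp add: lam_def field_simps)
qed

text \<open>Since \<open>exponent_pos\<close> makes the mean exponentially large, the second moment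
  bound applies; the threshold \<open>8 * k ^ 3\<close> is that of \<open>codim_large\<close> for a
  family of one member.\<close>

lemma prob_none_supercritical:
  assumes "8 * k ^ 3 \<le> r" "m * ((r - 1) choose (k - 1)) < k * (N - r)"
  shows "prob_none N k m r \<le> 1 / 2 ^ (r div k) + eps_bound k r 1"
proof -
  have l: "2 ^ (r div k) \<le> lam N k m r" by (rule lam_ge[OF exponent_pos[OF k assms(2)]])
  then have l0: "0 < lam N k m r" by (smt (verit) zero_less_power)
  have "prob_none N k m r \<le> 1 / lam N k m r + eps N k m r 1" by (rule prob_none_le[OF r_large(3,1) r(1) l0])
  also have "\<dots> \<le> 1 / 2 ^ (r div k) + eps_bound k r 1"
    using l l0 assms by (intro add_mono eps_le frac_le) auto
  finally show ?thesis .
qed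

lemma prob_none_subcritical:
  assumes "k * (N - r) < m * ((r - 1) choose (k - 1))"
  shows "1 - prob_none N k m r \<le> 4 * (1 / 2 ^ (r div k))"
  using prob_some_le[OF r_large(3,1) r(1), of m] lam_le[OF exponent_neg[OF k assms]] by simp

context
  assumes D0: "k * (N - r) = m * ((r - 1) choose (k - 1))"
begin

text \<open>For vanishing Delta the probability of being null is exactly
  \<open>q ^ (- r * (N - r))\<close>. It is distributed as \<open>q ^ (- (N - r))\<close> over the
  \<open>r\<close> factors of the Gaussian binomial coefficient, taken in reverse order.\<close>

lemma lam_critical_eq:
  "lam N k m r = euler_prod (1 / real q) r * (\<Prod>j<r. 1 - (1 / real q) ^ (N - r + Suc j))"
proof -
  let ?x = "1 / real q"
  have q0: "0 < real q" using q_real(1) by linarith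
  have f: "(real q ^ N - real q ^ (r - Suc j)) / (real q ^ r - real q ^ (r - Suc j)) * ?x ^ (N - r)
      = inverse (1 - ?x ^ Suc j) * (1 - ?x ^ (N - r + Suc j))" if j: "j < r" for j
  proof -
    have e: "real q ^ r = real q ^ (r - Suc j) * real q ^ Suc j"
      "real q ^ N = real q ^ (r - Suc j) * real q ^ (N - r + Suc j)"
      unfolding power_add[symmetric] using j r by simp_all
    have p: "0 < real q ^ (r - Suc j)" "0 < real q ^ Suc j" "0 < real q ^ (N - r)" using q0 by auto
    have p1: "1 < real q ^ Suc j" using q_real(1) by (intro one_less_power) auto
    have "(real q ^ N - real q ^ (r - Suc j)) / (real q ^ r - real q ^ (r - Suc j))
        = (real q ^ (r - Suc j) * (real q ^ (N - r + Suc j) - 1)) / (real q ^ (r - Suc j) * (real q ^ Suc j - 1))"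
      unfolding e by (simp add: algebra_simps)
    also have "\<dots> = (real q ^ (N - r + Suc j) - 1) / (real q ^ Suc j - 1)"
      by (rule mult_divide_mult_cancel_left) (use p(1) in linarith)
    also have "\<dots> * ?x ^ (N - r) = inverse (1 - ?x ^ Suc j) * (1 - ?x ^ (N - r + Suc j))"
      using p p1 unfolding power_one_over power_add by (simp add: field_simps del: power_Suc)
    finally show ?thesis .
  qed
  have "lam N k m r = real (card (subs N r)) * ?x ^ (r * (N - r))"
    unfolding lam_def exponent_zero[OF k D0] by (simp add: power_one_over)
  also have "real (card (subs N r)) = (\<Prod>i<r. (real q ^ N - real q ^ i) / (real q ^ r - real q ^ i))"
    unfolding card_subs[OF r_large(3,1) r(1)] lessThan_atLeast0 ..
  also have "\<dots> = (\<Prod>j<r. (real q ^ N - real q ^ (r - Suc j)) / (real q ^ r - real q ^ (r - Suc j)))"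
    by (rule prod.nat_diff_reindex[symmetric])
  also have "?x ^ (r * (N - r)) = (\<Prod>j<r. ?x ^ (N - r))" by (simp add: mult.commute flip: power_mult)
  also have "(\<Prod>j<r. (real q ^ N - real q ^ (r - Suc j)) / (real q ^ r - real q ^ (r - Suc j))) * (\<Prod>j<r. ?x ^ (N - r))
      = (\<Prod>j<r. inverse (1 - ?x ^ Suc j) * (1 - ?x ^ (N - r + Suc j)))"
    unfolding prod.distrib[symmetric] using f by (intro prod.cong) auto
  finally show ?thesis unfolding prod.distrib using q_real(1) by (simp add: euler_prod_def)
qed

text \<open>The first factor of \<open>lam_critical_eq\<close> is a partial product of
  \<open>C_const q\<close>, within \<open>4 / 2 ^ r\<close> of it; as \<open>r \<le> N - r\<close>,
  the second factor costs another \<open>4 / 2 ^ r\<close>.\<close>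

lemma lam_critical:
  "\<bar>lam N k m r - C_const q\<bar> \<le> 8 * (1 / 2 ^ r)" "lam N k m r \<le> 4"
proof -
  let ?x = "1 / real q" and ?A = "euler_prod (1 / real q) r"
  let ?P = "\<Prod>j<r. 1 - ?x ^ (N - r + Suc j)"
  have x: "0 \<le> ?x" "?x \<le> 1 / 2" using q_real(1) by (auto simp: field_simps)
  have C: "C_const q = (\<Prod>j. inverse (1 - ?x ^ Suc j))" by (simp only: C_const_def power_one_over)
  note A = euler_prod_bounds[OF x, of r] and AC = euler_prod_limit_bounds(3,4)[OF x, of r, folded C]
  note P = prod_shifted_ge[OF x, where s = "N - r" and n = r]
  have "r \<le> N - r" using codim_large[OF k m, of 0 r N] D0 r by simp
  then have "?x ^ (N - r) \<le> ?x ^ r" using x by (intro power_decreasing) auto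
  also have xr: "?x ^ r \<le> 1 / 2 ^ r" using power_mono[OF x(2) x(1), of r] by (simp add: power_one_over)
  finally have xN: "?x ^ (N - r) \<le> 1 / 2 ^ r" .
  have le: "lam N k m r \<le> ?A" unfolding lam_critical_eq using A(1) mult_left_le[OF P(2), of ?A] by linarith
  then show "lam N k m r \<le> 4" using A(2) by linarith
  have "?A - lam N k m r = ?A * (1 - ?P)" unfolding lam_critical_eq by (simp add: algebra_simps)
  also have "\<dots> \<le> 4 * ?x ^ (N - r)" using A P by (intro mult_mono) auto
  finally have "?A - lam N k m r \<le> 4 * (1 / 2 ^ r)" using xN by linarith
  then show "\<bar>lam N k m r - C_const q\<bar> \<le> 8 * (1 / 2 ^ r)" using AC le xr by linarith
qed

lemma prob_none_critical:
  assumes n: "1 \<le> n" and rn: "4 * k ^ 3 * (2 * n + 1) \<le> r"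
  shows "\<bar>prob_none N k m r - exp (- C_const q)\<bar> \<le> poisson_bound k n r"
proof -
  let ?l = "lam N k m r" and ?d = "4 / 2 ^ r :: real"
  let ?f = "\<lambda>i. card (fam (finite_vectorspace.direct F (func_space {..<N}) r) (subs N r) i)
    * (1 / real q ^ (m * (r choose k))) ^ i"
  note h = r_large(3,1) r(1)
  have D: "m * ((r - 1) choose (k - 1)) \<le> k * (N - r)" using D0 by simp
  have l: "0 \<le> ?l" "?l \<le> 4" using lam_nonneg lam_critical(2) by auto
  have lp: "?l ^ j \<le> 4 ^ j" for j using l by (intro power_mono) auto
  \<comment> \<open>The error term of the Bonferroni inequality runs over families of up to
    \<open>2 * n - 1\<close> members, which explains the factor \<open>2 * n + 1\<close> in the
    hypothesis.\<close>
  have small: "4 * k ^ 3 * (j + 1) \<le> r" if "j \<le> 2 * n" for j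
    using that rn by (intro order.trans[OF mult_le_mono2 rn]) simp
  have d: "0 \<le> ?d" "?d \<le> 1"
  proof -
    have "2 ^ 2 \<le> (2 ^ r :: real)" using r_large(2) k by (intro power_increasing) (auto simp: power2_eq_square)
    then show "?d \<le> 1" by simp
  qed simp
  have 1: "\<bar>prob_none N k m r - (\<Sum>i<n. (-1) ^ i * ?f i)\<bar>
      \<le> 4 ^ n / fact n + n * (\<Sum>j<2 * n. 2 ^ j * (4 ^ Suc j * eps_bound k r j))"
  proof -
    have "?l ^ Suc j * eps N k m r j \<le> 4 ^ Suc j * eps_bound k r j" if "j < 2 * n" for j
      using lp[of "Suc j"] l(1) eps_le[OF D small[of j]] eps_nonneg that by (intro mult_mono) auto
    then have "n * (\<Sum>j<2 * n. 2 ^ j * (?l ^ Suc j * eps N k m r j)) \<le> n * (\<Sum>j<2 * n. 2 ^ j * (4 ^ Suc j * eps_bound k r j))"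
      by (intro mult_left_mono sum_mono) auto
    moreover have "?l ^ n / fact n \<le> 4 ^ n / fact n" using lp by (intro divide_right_mono) auto
    ultimately show ?thesis using prob_none_approx[OF h n, of m] by linarith
  qed
  have 2: "\<bar>(\<Sum>i<n. (-1) ^ i * ?f i) - (\<Sum>i<n. (- ?l) ^ i / fact i)\<bar> \<le> (\<Sum>i<n. 4 ^ i * (1 - (1 - ?d) ^ i))"
  proof -
    have "\<bar>(-1) ^ i * ?f i - (- ?l) ^ i / fact i\<bar> \<le> 4 ^ i * (1 - (1 - ?d) ^ i)" if i: "i < n" for i
    proof -
      have up: "?f i \<le> ?l ^ i / fact i" by (rule fam_upper[OF h])
      have lo: "?l ^ i * (1 - ?d) ^ i / fact i \<le> ?f i"
        using fam_lower[OF h, of i n] meeting_le[OF D small[of n]] d(2) i by simp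
      have "(-1) ^ i * ?f i - (- ?l) ^ i / fact i = (-1) ^ i * (?f i - ?l ^ i / fact i)"
        by (subst power_minus) (simp add: algebra_simps)
      then have "\<bar>(-1) ^ i * ?f i - (- ?l) ^ i / fact i\<bar> = ?l ^ i / fact i - ?f i"
        using up by (simp add: abs_mult power_abs)
      also have "\<dots> \<le> ?l ^ i / fact i - ?l ^ i * (1 - ?d) ^ i / fact i" using lo by simp
      also have "\<dots> = (?l ^ i / fact i) * (1 - (1 - ?d) ^ i)" by (simp add: field_simps)
      also have "\<dots> \<le> 4 ^ i * (1 - (1 - ?d) ^ i)"
      proof (rule mult_right_mono)
        have "?l ^ i / fact i \<le> ?l ^ i / 1" using l by (intro divide_left_mono) (auto simp: fact_ge_1)
        then show "?l ^ i / fact i \<le> 4 ^ i" using lp[of i] by simp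
        show "0 \<le> 1 - (1 - ?d) ^ i" using d power_le_one[of "1 - ?d" i] by simp
      qed
      finally show ?thesis .
    qed
    then show ?thesis unfolding sum_subtractf[symmetric]
      by (intro order.trans[OF sum_abs sum_mono]) simp
  qed
  have 3: "\<bar>exp (- ?l) - (\<Sum>i<n. (- ?l) ^ i / fact i)\<bar> \<le> exp 4 * (4 ^ n / fact n)"
  proof -
    \<comment> \<open>The intermediate point of the Taylor remainder satisfies
      \<open>\<bar>t\<bar> \<le> lam \<le> 4\<close>, hence the constant
      \<open>exp 4\<close>.\<close>
    obtain t where t: "\<bar>t\<bar> \<le> \<bar>- ?l\<bar>" "exp (- ?l) = (\<Sum>i<n. (- ?l) ^ i / fact i) + exp t / fact n * (- ?l) ^ n"
      using Maclaurin_exp_le by blast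
    have "\<bar>exp t / fact n * (- ?l) ^ n\<bar> = exp t * (?l ^ n / fact n)"
      using l by (simp add: abs_mult power_abs)
    also have "\<dots> \<le> exp 4 * (4 ^ n / fact n)"
      using t(1) l lp[of n] by (intro mult_mono divide_right_mono) auto
    finally show ?thesis unfolding t(2) by simp
  qed
  have C1: "0 \<le> C_const q"
  proof -
    have x: "0 \<le> 1 / real q" "1 / real q \<le> 1 / 2" using q_real(1) by (auto simp: field_simps)
    show ?thesis using euler_prod_limit_bounds(1)[OF x] unfolding C_const_def power_one_over by linarith
  qed
  have "\<bar>exp (- ?l) - exp (- C_const q)\<bar> \<le> \<bar>?l - C_const q\<bar>" by (rule abs_exp_minus_diff_le[OF l(1) C1])
  then have 4: "\<bar>exp (- ?l) - exp (- C_const q)\<bar> \<le> 8 * (1 / 2 ^ r)" using lam_critical(1) by linarith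
  show ?thesis using 1 2 3 4 unfolding poisson_bound_def by linarith
qed

end

end

text \<open>The exterior power of the zero subspace is zero because \<open>k\<close> is positive. So
  the maximum defining \<open>null_dim\<close> is taken over a nonempty set.\<close>

lemma zero_null:
  assumes "2 \<le> k" "\<Theta> \<in> exterior_hom F k N m"
  shows "null_subspace F k N m \<Theta> {\<zero>\<^bsub>func_space {..<N}\<^esub>}"
proof -
  interpret V: finite_vectorspace F "func_space {..<N}" by (rule finite_vectorspace_coord)
  have z: "{\<zero>\<^bsub>func_space {..<N}\<^esub>} = supp_space {..<N} {}"
    by (auto simp: supp_space_def PiE_iff extensional_def)
  have e0: "{S \<in> ksubs N k. S \<subseteq> {}} = {}" using assms(1) by (auto simp: ksubs_def)
  then have "exterior_power_of F k N {\<zero>\<^bsub>func_space {..<N}\<^esub>} = supp_space (ksubs N k) {}"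
    using ext_supp_space[OF empty_subsetI, where N = N and k = k] z e0 by metis
  also have "\<dots> = {\<lambda>S\<in>ksubs N k. \<zero>}" by (auto simp: supp_space_def PiE_iff extensional_def)
  finally have e: "exterior_power_of F k N {\<zero>\<^bsub>func_space {..<N}\<^esub>} = {\<lambda>S\<in>ksubs N k. \<zero>}" .
  have "\<Theta> \<in> lin_maps (ksubs N k) {..<m}" using assms exterior_hom_eq by blast
  from lin_mapsD(5)[OF this] show ?thesis
    unfolding null_subspace_iff[OF assms(1) V.subspace_zero] e by simp
qed

text \<open>Subspaces of a null subspace are null, and a subspace contains subspaces of every
  smaller dimension.\<close>

lemma null_dim_ge_iff:
  assumes k: "2 \<le> k" and \<Theta>: "\<Theta> \<in> exterior_hom F k N m"
  shows "r \<le> null_dim F k N m \<Theta> \<longleftrightarrow> (\<exists>H\<in>subs N r. null_subspace F k N m \<Theta> H)"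
proof -
  interpret V: finite_vectorspace F "func_space {..<N}" by (rule finite_vectorspace_coord)
  let ?Z = "{\<zero>\<^bsub>func_space {..<N}\<^esub>}"
  let ?nul = "null_subspace F k N m \<Theta>"
  have sub: "subspace F H (func_space {..<N})" if "?nul H" for H
    using that by (simp add: null_subspace_def coord_space_eq)
  have e: "null_dim F k N m \<Theta> = Max (V.sdim ` {H. ?nul H})"
    unfolding null_dim_def coord_space_eq by (rule arg_cong[of _ _ Max]) (auto simp: V.sdim_def)
  have fin: "finite {H. ?nul H}"
    by (rule finite_subset[of _ "Pow (carrier (func_space {..<N}))"])
      (use V.finite_carrier V.subspaceD(1) sub in \<open>auto simp del: func_space_simps\<close>)
  have ne: "{H. ?nul H} \<noteq> {}" using zero_null[OF k \<Theta>] by blast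
  show ?thesis
  proof
    assume "r \<le> null_dim F k N m \<Theta>"
    then obtain H where H: "?nul H" "r \<le> V.sdim H"
      unfolding e using fin ne by (auto simp: Max_ge_iff)
    note sH = sub[OF H(1)]
    have "V.between ?Z H r \<noteq> {}"
      using V.subspaceD(2)[OF sH] H(2) V.sdim_zero by (intro V.between_nonempty V.subspace_zero sH) auto
    then obtain H' where H': "subspace F H' (func_space {..<N})" "H' \<subseteq> H" "V.sdim H' = r"
      by (auto simp: V.between_def)
    have "exterior_power_of F k N H' \<subseteq> exterior_power_of F k N H"
      using H'(2) V.subspaceD(1)[OF sH] by (intro ext_mono) simp_all
    then have "?nul H'" using H(1) unfolding null_subspace_iff[OF k sH] null_subspace_iff[OF k H'(1)] by blast
    then show "\<exists>H\<in>subs N r. ?nul H" using H' by (auto simp: subs_def)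
  next
    assume "\<exists>H\<in>subs N r. ?nul H"
    then obtain H where "?nul H" "V.sdim H = r" by (auto simp: subs_def)
    then show "r \<le> null_dim F k N m \<Theta>" unfolding e using fin by (auto intro: Max_ge)
  qed
qed

lemma prob_null_dim_less:
  assumes "2 \<le> k"
  shows "measure_pmf.prob (random_hom F k N m) {\<Theta>. null_dim F k N m \<Theta> < r} = prob_none N k m r"
proof -
  note h = exterior_hom_finite_nonempty[OF field_axioms finite_scalars, of k N m]
  have "exterior_hom F k N m \<inter> {\<Theta>. null_dim F k N m \<Theta> < r}
      = {\<Theta> \<in> exterior_hom F k N m. \<forall>H\<in>subs N r. \<not> null_subspace F k N m \<Theta> H}"
    using null_dim_ge_iff[OF assms, of _ N m r] by (auto simp: not_le[symmetric])
  then show ?thesis unfolding random_hom_def measure_pmf_of_set[OF h(2,1)] by (simp add: prob_none_def)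
qed

lemma prob_null_dim_eq:
  assumes "2 \<le> k"
  shows "measure_pmf.prob (random_hom F k N m) {\<Theta>. null_dim F k N m \<Theta> = r}
    = prob_none N k m (Suc r) - prob_none N k m r"
proof -
  have "{\<Theta>. null_dim F k N m \<Theta> = r} = {\<Theta>. null_dim F k N m \<Theta> < Suc r} - {\<Theta>. null_dim F k N m \<Theta> < r}"
    by auto
  then show ?thesis using prob_null_dim_less[OF assms]
    by (simp add: measure_pmf.finite_measure_Diff subset_eq)
qed

lemma prob_none_le_1: "2 \<le> k \<Longrightarrow> prob_none N k m r \<le> 1"
  using prob_null_dim_less[of k N m r] measure_pmf.prob_le_1 by metis

text \<open>This covers dimension \<open>Suc (critical_dim k m N)\<close> when it exceeds
  \<open>N\<close>, where natural subtraction would make the comparison of exponents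
  meaningless.\<close>

lemma prob_none_eq_1:
  assumes "N < r"
  shows "prob_none N k m r = 1"
proof -
  interpret V: finite_vectorspace F "func_space {..<N}" by (rule finite_vectorspace_coord)
  have "V.sdim H \<le> N" if "subspace F H (func_space {..<N})" for H
    using V.sdim_mono[OF that V.subspace_carrier V.subspaceD(1)[OF that]] sdim_coord[of N] by simp
  then have "subs N r = {}" using assms by (force simp: subs_def)
  then show ?thesis
    using exterior_hom_finite_nonempty[OF field_axioms finite_scalars, of k N m] by (simp add: prob_none_def)
qed

end

section \<open>The critical dimension\<close>

lemma Delta_eq:
  assumes "r \<le> N"
  shows "Delta k m N r = int (k * (N - r)) - int (m * ((r - 1) choose (k - 1)))"
  using assms by (simp add: Delta_def of_nat_diff)

text \<open>The set under the maximum contains 1, since the binomial coefficient vanishes there for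
  \<open>2 \<le> k\<close>. The last claim is Delta being negative just above the maximum.\<close>

lemma critical_dim:
  fixes k m N :: nat
  assumes "2 \<le> k" "1 \<le> N"
  defines "M \<equiv> critical_dim k m N"
  shows "1 \<le> M" "M \<le> N" "\<And>r. 1 \<le> r \<Longrightarrow> r \<le> N \<Longrightarrow> 0 \<le> Delta k m N r \<Longrightarrow> r \<le> M"
    "Suc M \<le> N \<Longrightarrow> k * (N - Suc M) < m * ((Suc M - 1) choose (k - 1))"
proof -
  let ?R = "{r. 1 \<le> r \<and> r \<le> N \<and> 0 \<le> Delta k m N r}"
  have fin: "finite ?R" by (rule finite_subset[of _ "{..N}"]) auto
  have "1 \<in> ?R" using assms(1,2) by (simp add: Delta_def binomial_eq_0)
  then have "M \<in> ?R" unfolding M_def critical_dim_def using fin by (intro Max_in) auto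
  then show "1 \<le> M" "M \<le> N" by auto
  show max: "r \<le> M" if "1 \<le> r" "r \<le> N" "0 \<le> Delta k m N r" for r
    unfolding M_def critical_dim_def using fin that by (intro Max_ge) auto
  assume N: "Suc M \<le> N"
  then have "Delta k m N (Suc M) < 0" using max[of "Suc M"] by fastforce
  then show "k * (N - Suc M) < m * ((Suc M - 1) choose (k - 1))"
    unfolding Delta_eq[OF N] by (simp only: diff_less_0_iff_less of_nat_less_iff)
qed

text \<open>With \<open>m\<close> fixed, any given \<open>R\<close> satisfies
  \<open>Delta k m N R \<ge> 0\<close> once \<open>N\<close> is large.\<close>

lemma critical_dim_tendsto:
  assumes k: "2 \<le> k" and N: "\<And>n. 1 \<le> N n" "filterlim N at_top sequentially"
  shows "filterlim (\<lambda>n. critical_dim k m (N n)) at_top sequentially"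
  unfolding filterlim_at_top_ge[where c = "1::nat"]
proof (intro allI impI)
  fix R :: nat assume R: "1 \<le> R"
  have "\<forall>\<^sub>F n in sequentially. R + m * ((R - 1) choose (k - 1)) \<le> N n"
    using N(2) by (simp add: filterlim_at_top)
  then show "\<forall>\<^sub>F n in sequentially. R \<le> critical_dim k m (N n)"
  proof eventually_elim
    case (elim n)
    have "m * ((R - 1) choose (k - 1)) \<le> 1 * (N n - R)" using elim by simp
    also have "\<dots> \<le> k * (N n - R)" using k by (intro mult_le_mono1) simp
    finally have d: "m * ((R - 1) choose (k - 1)) \<le> k * (N n - R)" .
    have "R \<le> N n" using elim by simp
    then have "0 \<le> Delta k m (N n) R"
      using d by (simp only: Delta_eq diff_ge_0_iff_ge of_nat_le_iff)
    then show ?case using R elim by (intro critical_dim(3)[OF k N(1)]) auto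
  qed
qed

section \<open>Asymptotics\<close>

context
  fixes F :: "nat \<Rightarrow> ('a, 'b) ring_scheme" and k :: nat and m N r :: "nat \<Rightarrow> nat"
  assumes F: "\<And>n. finite_scalar_field (F n)" and k: "3 \<le> k" and m: "\<And>n. 1 \<le> m n"
    and r: "filterlim r at_top sequentially"
begin

lemma eventually_large: "\<forall>\<^sub>F n in sequentially. R \<le> r n"
  using r by (simp add: filterlim_at_top)

lemma prob_none_tendsto_0:
  assumes "\<forall>\<^sub>F n in sequentially. r n \<le> N n \<and> m n * ((r n - 1) choose (k - 1)) < k * (N n - r n)"
  shows "(\<lambda>n. finite_scalar_field.prob_none (F n) (N n) k (m n) (r n)) \<longlonglongrightarrow> 0"
proof (rule tendsto_sandwich[OF _ _ tendsto_const])
  let ?b = "\<lambda>r. 1 / 2 ^ (r div k) + eps_bound k r 1"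
  show "\<forall>\<^sub>F n in sequentially. 0 \<le> finite_scalar_field.prob_none (F n) (N n) k (m n) (r n)"
    using finite_scalar_field.prob_none_nonneg[OF F] by simp
  show "\<forall>\<^sub>F n in sequentially. finite_scalar_field.prob_none (F n) (N n) k (m n) (r n) \<le> ?b (r n)"
    using assms eventually_large[of "8 * k ^ 3"]
  proof eventually_elim
    case (elim n)
    then show ?case by (intro finite_scalar_field.prob_none_supercritical[OF F k m]) auto
  qed
  have "?b \<longlonglongrightarrow> 0 + 0" using k by (intro tendsto_add two_power_div_tendsto eps_bound_tendsto) auto
  from filterlim_compose[OF this r] show "(\<lambda>n. ?b (r n)) \<longlonglongrightarrow> 0" by simp
qed

lemma prob_none_tendsto_1:
  assumes "\<forall>\<^sub>F n in sequentially. r n \<le> N n \<longrightarrow> k * (N n - r n) < m n * ((r n - 1) choose (k - 1))"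
  shows "(\<lambda>n. finite_scalar_field.prob_none (F n) (N n) k (m n) (r n)) \<longlonglongrightarrow> 1"
proof (rule tendsto_sandwich[OF _ _ _ tendsto_const])
  let ?b = "\<lambda>r. 1 - 4 * (1 / 2 ^ (r div k)) :: real"
  have "2 \<le> k" using k by simp
  from finite_scalar_field.prob_none_le_1[OF F this]
  show "\<forall>\<^sub>F n in sequentially. finite_scalar_field.prob_none (F n) (N n) k (m n) (r n) \<le> 1" by simp
  show "\<forall>\<^sub>F n in sequentially. ?b (r n) \<le> finite_scalar_field.prob_none (F n) (N n) k (m n) (r n)"
    using assms eventually_large[of "4 * k ^ 3"]
  proof eventually_elim
    case (elim n)
    show ?case
    proof (cases "r n \<le> N n")
      case True
      then show ?thesis using finite_scalar_field.prob_none_subcritical[OF F k m True, of n n] elim by force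
    next
      case False
      then show ?thesis using finite_scalar_field.prob_none_eq_1[OF F, of "N n" "r n" n k "m n"] by simp
    qed
  qed
  have "?b \<longlonglongrightarrow> 1 - 4 * 0" using k by (intro tendsto_intros two_power_div_tendsto) auto
  from filterlim_compose[OF this r] show "(\<lambda>n. ?b (r n)) \<longlonglongrightarrow> 1" by simp
qed

text \<open>The truncation \<open>L\<close> is fixed first, so that the limit of
  \<open>poisson_bound\<close> in \<open>r\<close> is below \<open>e\<close>; only then
  \<open>r\<close> is made large.\<close>

lemma prob_none_tendsto_exp:
  assumes "\<And>n. r n \<le> N n \<and> k * (N n - r n) = m n * ((r n - 1) choose (k - 1))"
  shows "(\<lambda>n. finite_scalar_field.prob_none (F n) (N n) k (m n) (r n) - exp (- C_const (card (carrier (F n))))) \<longlonglongrightarrow> 0"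
proof (rule tendstoI)
  fix e :: real assume e: "0 < e"
  have "(\<lambda>n. 4 ^ n / fact n :: real) \<longlonglongrightarrow> 0"
    using summable_LIMSEQ_zero[OF summable_exp[of "4::real"]] by (simp add: field_simps)
  then have "(\<lambda>n. (1 + exp 4) * (4 ^ n / fact n) :: real) \<longlonglongrightarrow> (1 + exp 4) * 0" by (intro tendsto_intros)
  then have "\<forall>\<^sub>F n in sequentially. (1 + exp 4) * (4 ^ n / fact n) < e"
    using e by (intro order_tendstoD(2)) auto
  then have "\<forall>\<^sub>F n in sequentially. 1 \<le> n \<and> (1 + exp 4) * (4 ^ n / fact n) < e"
    using eventually_ge_at_top[of 1] by eventually_elim simp
  then obtain L where L: "1 \<le> L" "(1 + exp 4) * (4 ^ L / fact L) < e"
    using eventually_happens'[OF sequentially_bot] by blast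
  have "\<forall>\<^sub>F s in sequentially. poisson_bound k L s < e"
    using L(2) k by (intro order_tendstoD(2)[OF poisson_bound_tendsto]) auto
  then have "\<forall>\<^sub>F n in sequentially. poisson_bound k L (r n) < e" by (rule eventually_compose_filterlim[OF _ r])
  then show "\<forall>\<^sub>F n in sequentially. dist (finite_scalar_field.prob_none (F n) (N n) k (m n) (r n)
      - exp (- C_const (card (carrier (F n))))) 0 < e"
    using eventually_large[of "4 * k ^ 3 * (2 * L + 1)"]
  proof eventually_elim
    case (elim n)
    have "4 * k ^ 3 * 1 \<le> 4 * k ^ 3 * (2 * L + 1)" by (intro mult_le_mono2) simp
    then have "4 * k ^ 3 \<le> r n" using elim by linarith
    from finite_scalar_field.prob_none_critical[OF F[of n] k m[of n] _ this _ L(1) elim(2), of "N n"] show ?case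
      using assms[of n] elim(1) by (simp add: dist_real_def)
  qed
qed

end

theorem corollary6p16:
  fixes k :: nat
  assumes "k \<ge> 3"
  shows
    "(\<forall>(F :: ('a, 'b) ring_scheme) (m :: nat) (N :: nat \<Rightarrow> nat).
        field F \<longrightarrow> finite (carrier F) \<longrightarrow> m \<ge> 1 \<longrightarrow>
        (\<forall>n. N n \<ge> 1) \<longrightarrow> filterlim N at_top sequentially \<longrightarrow>
        (\<forall>n. Delta k m (N n) (critical_dim k m (N n)) > 0) \<longrightarrow>
        (\<lambda>n. measure_pmf.prob (random_hom F k (N n) m)
               {\<Theta>. null_dim F k (N n) m \<Theta> = critical_dim k m (N n)}) \<longlonglongrightarrow> 1)
     \<and>
     (\<forall>(F :: nat \<Rightarrow> ('a, 'b) ring_scheme) (m :: nat \<Rightarrow> nat) (N :: nat \<Rightarrow> nat) (r :: nat \<Rightarrow> nat).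
        (\<forall>n. field (F n) \<and> finite (carrier (F n)) \<and> m n \<ge> 1 \<and> N n \<ge> 1 \<and>
             r n = critical_dim k (m n) (N n) \<and> Delta k (m n) (N n) (r n) = 0) \<longrightarrow>
        filterlim r at_top sequentially \<longrightarrow>
        (\<lambda>n. measure_pmf.prob (random_hom (F n) k (N n) (m n))
               {\<Theta>. null_dim (F n) k (N n) (m n) \<Theta> \<notin> {r n - 1, r n}}) \<longlonglongrightarrow> 0
        \<and>
        (\<lambda>n. measure_pmf.prob (random_hom (F n) k (N n) (m n))
               {\<Theta>. null_dim (F n) k (N n) (m n) \<Theta> = r n}
             - (1 - exp (- C_const (card (carrier (F n)))))) \<longlonglongrightarrow> 0
        \<and>
        (\<lambda>n. measure_pmf.prob (random_hom (F n) k (N n) (m n))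
               {\<Theta>. null_dim (F n) k (N n) (m n) \<Theta> = r n - 1}
             - exp (- C_const (card (carrier (F n))))) \<longlonglongrightarrow> 0
        \<and>
        (filterlim (\<lambda>n. card (carrier (F n))) at_top sequentially \<longrightarrow>
          (\<lambda>n. measure_pmf.prob (random_hom (F n) k (N n) (m n))
                 {\<Theta>. null_dim (F n) k (N n) (m n) \<Theta> = r n}) \<longlonglongrightarrow> 1 - exp (- 1)
          \<and>
          (\<lambda>n. measure_pmf.prob (random_hom (F n) k (N n) (m n))
                 {\<Theta>. null_dim (F n) k (N n) (m n) \<Theta> = r n - 1}) \<longlonglongrightarrow> exp (- 1)))"
proof -
  have k2: "2 \<le> k" using assms by simp
  show ?thesis
  proof (rule conjI; intro allI impI)
    fix F :: "('a, 'b) ring_scheme" and m :: nat and N :: "nat \<Rightarrow> nat"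
    assume "field F" "finite (carrier F)" and m: "m \<ge> 1" and N: "\<forall>n. N n \<ge> 1" "filterlim N at_top sequentially"
      and D: "\<forall>n. Delta k m (N n) (critical_dim k m (N n)) > 0"
    then interpret finite_scalar_field F
      by (simp add: finite_scalar_field_def finite_scalar_field_axioms_def)
    let ?M = "\<lambda>n. critical_dim k m (N n)"
    have M: "filterlim ?M at_top sequentially" using N by (intro critical_dim_tendsto k2) auto
    then have SM: "filterlim (\<lambda>n. Suc (?M n)) at_top sequentially" by (rule filterlim_compose[OF filterlim_Suc])
    note c = critical_dim(2,4)[OF k2 N(1)[rule_format]]
    have "(\<lambda>n. prob_none (N n) k m (?M n)) \<longlonglongrightarrow> 0"
    proof (rule prob_none_tendsto_0[OF finite_scalar_field_axioms assms m M])
      show "\<forall>\<^sub>F n in sequentially. ?M n \<le> N n \<and> m * ((?M n - 1) choose (k - 1)) < k * (N n - ?M n)"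
      proof (intro always_eventually allI conjI)
        fix n show l: "?M n \<le> N n" using c(1) by blast
        show "m * ((?M n - 1) choose (k - 1)) < k * (N n - ?M n)"
          using D[rule_format, of n] unfolding Delta_eq[OF l] by (simp only: diff_gt_0_iff_gt of_nat_less_iff)
      qed
    qed
    \<comment> \<open>Above the critical dimension Delta is negative by maximality, or the dimension
      exceeds that of the space.\<close>
    moreover have "(\<lambda>n. prob_none (N n) k m (Suc (?M n))) \<longlonglongrightarrow> 1"
      using c(2) by (intro prob_none_tendsto_1[OF finite_scalar_field_axioms assms m SM] always_eventually) blast
    ultimately have "(\<lambda>n. prob_none (N n) k m (Suc (?M n)) - prob_none (N n) k m (?M n)) \<longlonglongrightarrow> 1 - 0"
      by (intro tendsto_diff)
    then show "(\<lambda>n. measure_pmf.prob (random_hom F k (N n) m) {\<Theta>. null_dim F k (N n) m \<Theta> = ?M n}) \<longlonglongrightarrow> 1"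
      unfolding prob_null_dim_eq[OF k2] by simp
  next
    fix F :: "nat \<Rightarrow> ('a, 'b) ring_scheme" and m N r :: "nat \<Rightarrow> nat"
    assume h: "\<forall>n. field (F n) \<and> finite (carrier (F n)) \<and> m n \<ge> 1 \<and> N n \<ge> 1 \<and>
        r n = critical_dim k (m n) (N n) \<and> Delta k (m n) (N n) (r n) = 0"
      and r: "filterlim r at_top sequentially"
    have F: "finite_scalar_field (F n)" and m: "1 \<le> m n" for n
      using h by (auto simp: finite_scalar_field_def finite_scalar_field_axioms_def)
    define p where "p n s = finite_scalar_field.prob_none (F n) (N n) k (m n) s" for n s
    define C where "C n = C_const (card (carrier (F n)))" for n
    let ?P = "\<lambda>n. measure_pmf.prob (random_hom (F n) k (N n) (m n))"
    let ?\<alpha> = "\<lambda>n. null_dim (F n) k (N n) (m n)"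
    have c: "1 \<le> r n" "r n \<le> N n" "Suc (r n) \<le> N n \<longrightarrow> k * (N n - Suc (r n)) < m n * ((Suc (r n) - 1) choose (k - 1))" for n
      using critical_dim[OF k2, of "N n" "m n"] h by metis+
    have D: "k * (N n - r n) = m n * ((r n - 1) choose (k - 1))" for n
    proof -
      have "Delta k (m n) (N n) (r n) = 0" using h by blast
      then show ?thesis unfolding Delta_eq[OF c(2)] by (simp only: right_minus_eq of_nat_eq_iff)
    qed
    have Sr: "filterlim (\<lambda>n. Suc (r n)) at_top sequentially" using r by (rule filterlim_compose[OF filterlim_Suc])
    have rS: "filterlim (\<lambda>n. r n - 1) at_top sequentially"
      using r by (rule filterlim_compose[OF filterlim_minus_const_nat_at_top])
    have p0: "(\<lambda>n. p n (r n - 1)) \<longlonglongrightarrow> 0"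
      unfolding p_def
    proof (rule prob_none_tendsto_0[OF F assms m rS], intro always_eventually allI conjI)
      fix n
      show "r n - 1 \<le> N n" using c(2)[of n] by simp
      \<comment> \<open>Delta strictly decreases, so it is positive at \<open>r n - 1\<close> if it
        vanishes at \<open>r n\<close>: the binomial part does not grow and the codimension
        increases by one.\<close>
      have "(r n - 1 - 1) choose (k - 1) \<le> (r n - 1) choose (k - 1)" by (rule binomial_right_mono) simp
      then have "m n * ((r n - 1 - 1) choose (k - 1)) \<le> k * (N n - r n)" unfolding D by (rule mult_le_mono2)
      also have "\<dots> < k * (N n - (r n - 1))" using c(1,2)[of n] k2 by (intro mult_less_mono2) auto
      finally show "m n * ((r n - 1 - 1) choose (k - 1)) < k * (N n - (r n - 1))" .
    qed
    have p1: "(\<lambda>n. p n (Suc (r n))) \<longlonglongrightarrow> 1"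
      unfolding p_def using c(3) by (intro prob_none_tendsto_1[OF F assms m Sr] always_eventually) blast
    have pC: "(\<lambda>n. p n (r n) - exp (- C n)) \<longlonglongrightarrow> 0"
      unfolding p_def C_def using c(2) D by (intro prob_none_tendsto_exp[OF F assms m r]) blast
    have eq: "?P n {\<Theta>. ?\<alpha> n \<Theta> = s} = p n (Suc s) - p n s" for n s
      unfolding p_def by (rule finite_scalar_field.prob_null_dim_eq[OF F k2])
    have "{\<Theta>. ?\<alpha> n \<Theta> \<notin> {r n - 1, r n}} = space (measure_pmf (random_hom (F n) k (N n) (m n)))
        - ({\<Theta>. ?\<alpha> n \<Theta> = r n - 1} \<union> {\<Theta>. ?\<alpha> n \<Theta> = r n})" for n by auto
    then have "?P n {\<Theta>. ?\<alpha> n \<Theta> \<notin> {r n - 1, r n}}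
        = 1 - ?P n ({\<Theta>. ?\<alpha> n \<Theta> = r n - 1} \<union> {\<Theta>. ?\<alpha> n \<Theta> = r n})" for n
      by (simp only: measure_pmf.prob_compl sets_measure_pmf UNIV_I)
    moreover have "?P n ({\<Theta>. ?\<alpha> n \<Theta> = r n - 1} \<union> {\<Theta>. ?\<alpha> n \<Theta> = r n})
        = ?P n {\<Theta>. ?\<alpha> n \<Theta> = r n - 1} + ?P n {\<Theta>. ?\<alpha> n \<Theta> = r n}" for n
      using c(1)[of n] by (intro measure_pmf.finite_measure_Union) auto
    ultimately have out: "?P n {\<Theta>. ?\<alpha> n \<Theta> \<notin> {r n - 1, r n}} = 1 - p n (Suc (r n)) + p n (r n - 1)" for n
      using c(1)[of n] by (simp add: eq)
    \<comment> \<open>Here \<open>1 \<le> r n\<close> is needed for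
      \<open>Suc (r n - 1) = r n\<close>.\<close>
    have lower: "?P n {\<Theta>. ?\<alpha> n \<Theta> = r n - 1} = p n (r n) - p n (r n - 1)" for n using c(1)[of n] by (simp add: eq)
    have "(\<lambda>n. 1 - p n (Suc (r n)) + p n (r n - 1)) \<longlonglongrightarrow> 1 - 1 + 0" by (intro tendsto_intros p0 p1)
    then have 1: "(\<lambda>n. ?P n {\<Theta>. ?\<alpha> n \<Theta> \<notin> {r n - 1, r n}}) \<longlonglongrightarrow> 0" unfolding out by simp
    have "(\<lambda>n. (p n (Suc (r n)) - 1) - (p n (r n) - exp (- C n))) \<longlonglongrightarrow> (1 - 1) - 0" by (intro tendsto_intros p1 pC)
    then have 2: "(\<lambda>n. ?P n {\<Theta>. ?\<alpha> n \<Theta> = r n} - (1 - exp (- C n))) \<longlonglongrightarrow> 0"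
      unfolding eq by (simp add: algebra_simps)
    have "(\<lambda>n. (p n (r n) - exp (- C n)) - p n (r n - 1)) \<longlonglongrightarrow> 0 - 0" by (intro tendsto_intros p0 pC)
    then have 3: "(\<lambda>n. ?P n {\<Theta>. ?\<alpha> n \<Theta> = r n - 1} - exp (- C n)) \<longlonglongrightarrow> 0"
      unfolding lower by (simp add: algebra_simps)
    have 4: "(\<lambda>n. ?P n {\<Theta>. ?\<alpha> n \<Theta> = r n}) \<longlonglongrightarrow> 1 - exp (- 1)" 
      "(\<lambda>n. ?P n {\<Theta>. ?\<alpha> n \<Theta> = r n - 1}) \<longlonglongrightarrow> exp (- 1)"
      if q: "filterlim (\<lambda>n. card (carrier (F n))) at_top sequentially"
    proof -
      have "2 \<le> card (carrier (F n))" for n using finite_scalar_field.q_real(1)[OF F, of n] by simp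
      then have "C \<longlonglongrightarrow> 1" unfolding C_def using q by (rule C_const_tendsto)
      then have e: "(\<lambda>n. exp (- C n)) \<longlonglongrightarrow> exp (- 1)" by (intro tendsto_intros)
      show "(\<lambda>n. ?P n {\<Theta>. ?\<alpha> n \<Theta> = r n}) \<longlonglongrightarrow> 1 - exp (- 1)"
        using tendsto_add[OF 2 tendsto_diff[OF tendsto_const[of 1] e]] by simp
      show "(\<lambda>n. ?P n {\<Theta>. ?\<alpha> n \<Theta> = r n - 1}) \<longlonglongrightarrow> exp (- 1)" using tendsto_add[OF 3 e] by simp
    qed
    show "(\<lambda>n. ?P n {\<Theta>. ?\<alpha> n \<Theta> \<notin> {r n - 1, r n}}) \<longlonglongrightarrow> 0 \<and>
        (\<lambda>n. ?P n {\<Theta>. ?\<alpha> n \<Theta> = r n} - (1 - exp (- C_const (card (carrier (F n)))))) \<longlonglongrightarrow> 0 \<and>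
        (\<lambda>n. ?P n {\<Theta>. ?\<alpha> n \<Theta> = r n - 1} - exp (- C_const (card (carrier (F n))))) \<longlonglongrightarrow> 0 \<and>
        (filterlim (\<lambda>n. card (carrier (F n))) at_top sequentially \<longrightarrow>
          (\<lambda>n. ?P n {\<Theta>. ?\<alpha> n \<Theta> = r n}) \<longlonglongrightarrow> 1 - exp (- 1) \<and>
          (\<lambda>n. ?P n {\<Theta>. ?\<alpha> n \<Theta> = r n - 1}) \<longlonglongrightarrow> exp (- 1))"
      using 1 2 3 4 unfolding C_def by blast
  qed
qed

end
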